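(* Let $k$ be a field, let $(H,\Delta,\varepsilon,\phi)$ be a finite-dimensional quasi-Hopf algebra over $k$, and let $K\subset H$ be a quasi-Hopf subalgebra. Then every Hopf module $M\in{}_K\mathcal M^H_K$ that is finitely generated as a $K$-module is free as a left $K$-module.
   Context: All algebras, tensor products and dimensions are over the base field $k$; algebras are associative and unital, and algebra maps are unital. A quasibialgebra $(H,\Delta,\varepsilon,\phi)$ consists of an algebra $H$, algebra maps $\Delta\colon H\to H\otimes H$ and $\varepsilon\colon H\to k$, and an invertible element $\phi\in H\otimes H\otimes H$ (the associator) such that for all $h\in H$: $(\varepsilon\otimes \mathrm{id})\Delta(h)=h=(\mathrm{id}\otimes\varepsilon)\Delta(h)$; $(\mathrm{id}\otimes\Delta)\Delta(h)\cdot\phi=\phi\cdot(\Delta\otimes \mathrm{id})\Delta(h)$; $(\mathrm{id}\otimes \mathrm{id}\otimes\Delta)(\phi)\cdot(\Delta\otimes \mathrm{id}\otimes \mathrm{id})(\phi)=(1\otimes\phi)\cdot(\mathrm{id}\otimes\Delta\otimes \mathrm{id})(\phi)\cdot(\phi\otimes 1)$; $(\mathrm{id}\otimes\varepsilon\otimes \mathrm{id})(\phi)=1$. Write $\Delta(h)=h_{(1)}\otimes h_{(2)}$, $\phi=\phi^{(1)}\otimes\phi^{(2)}\otimes\phi^{(3)}$, $\phi^{-1}=\phi^{(-1)}\otimes\phi^{(-2)}\otimes\phi^{(-3)}$ (summation suppressed). A quasiantipode $(S,\alpha,\beta)$ for a quasibialgebra $H$ consists of an algebra antiautomorphism $S$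 of $H$ and elements $\alpha,\beta\in H$ such that for all $h\in H$: $S(h_{(1)})\alpha h_{(2)}=\varepsilon(h)\alpha$, $h_{(1)}\beta S(h_{(2)})=\varepsilon(h)\beta$, $\phi^{(1)}\beta S(\phi^{(2)})\alpha\phi^{(3)}=1$, and $S(\phi^{(-1)})\alpha\phi^{(-2)}\beta\phi^{(-3)}=1$. A quasi-Hopf algebra is a quasibialgebra with a quasiantipode. A quasi-Hopf subalgebra $K\subset H$ is a unital subalgebra that is a (non-coassociative) subcoalgebra, i.e. $\Delta(K)\subset K\otimes K$, such that $\phi\in K\otimes K\otimes K$, and such that the quasibialgebra $(K,\Delta|_K,\varepsilon|_K,\phi)$ is itself a quasi-Hopf algebra, i.e. admits a quasiantipode. A Hopf module $M\in{}_K\mathcal M^H_K$ is a right $H$-comodule within the monoidal category of $K$-$K$-bimodules. Explicitly, $M$ is a $K$-$K$-bimodule (with $k$ acting centrally) equipped with a $K$-$K$-bimodule map $\delta\colon M\to M\otimes H$, $\delta(m)=m_{(0)}\otimes m_{(1)}$, where $M\otimes H$ has the diagonal bimodule structure $x(m\otimes h)y=x_{(1)}my_{(1)}\otimes x_{(2)}hy_{(2)}$ for $x,y\in K$, such that for all $m\in M$: $m_{(0)}\varepsilon(m_{(1)})=m$ and $$(\mathrm{id}_M\otimes\Delta)\delta(m)\cdot\phi=\phi\cdot(\delta\otimes \mathrm{id}_H)\delta(m),$$ where multiplication by $\phi\in K\otimes K\otimes K$ is taken in the $(K\otimes K\otimes K)$-bimodule $M\otimes H\otimes H$. Since $K$ is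 finite-dimensional, "finitely generated as a $K$-module" (on either side) is equivalent to $M$ being finite-dimensional over $k$. *)

theory Defs
  imports Complex_Main "HOL-Library.Poly_Mapping"
begin

text \<open>
  A tensor over a field \<open>k\<close> is represented by a formal sum of pure tensors, that is, by a list of
  tuples: \<open>[(a\<^sub>1, b\<^sub>1), \<dots>, (a\<^sub>n, b\<^sub>n)]\<close> stands for \<open>a\<^sub>1 \<otimes> b\<^sub>1 + \<dots> + a\<^sub>n \<otimes> b\<^sub>n\<close>.  Sweedler notation then
  becomes a list comprehension or a sum over a list.  Two lists are equal as tensors iff
  the corresponding elements of the free vector space on the set of tuples agree modulo the
  subspace spanned by the multilinearity relations; this is the usual construction of the
  tensor product as a quotient.  Every identity between tensors below is stated modulo this relation.
  All vector spaces that can be subspaces of a bigger one come with an explicit carrier set.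
\<close>

definition formal_sum :: "'w list \<Rightarrow> 'w \<Rightarrow>\<^sub>0 'k::field" where
  "formal_sum ws = (\<Sum>w\<leftarrow>ws. Poly_Mapping.single w 1)"

definition tensor_eq :: "('w \<Rightarrow>\<^sub>0 'k::field) set \<Rightarrow> 'w list \<Rightarrow> 'w list \<Rightarrow> bool" where
  "tensor_eq R xs ys \<longleftrightarrow>
     formal_sum xs - formal_sum ys \<in> module.span (\<lambda>c. Poly_Mapping.map ((*) c)) R"

text \<open>
  Linearity in one tensor factor with carrier \<open>A\<close>; the function \<open>ins\<close> inserts
  a vector into that factor, all other factors being fixed.
\<close>

definition slot_relations ::
  "('k::field \<Rightarrow> 'a::ab_group_add \<Rightarrow> 'a) \<Rightarrow> 'a set \<Rightarrow> ('a \<Rightarrow> 'w) \<Rightarrow> ('w \<Rightarrow>\<^sub>0 'k) set" where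
  "slot_relations s A ins =
     {Poly_Mapping.single (ins (x + y)) 1 - Poly_Mapping.single (ins x) 1
        - Poly_Mapping.single (ins y) 1 | x y. x \<in> A \<and> y \<in> A} \<union>
     {Poly_Mapping.single (ins (s c x)) 1 - Poly_Mapping.single (ins x) c | c x. x \<in> A}"

definition tensor2_eq ::
  "('k::field \<Rightarrow> 'a::ab_group_add \<Rightarrow> 'a) \<Rightarrow> 'a set \<Rightarrow> ('k \<Rightarrow> 'b::ab_group_add \<Rightarrow> 'b) \<Rightarrow> 'b set \<Rightarrow>
   ('a \<times> 'b) list \<Rightarrow> ('a \<times> 'b) list \<Rightarrow> bool" where
  "tensor2_eq s A t B = tensor_eq
     ((\<Union>b\<in>B. slot_relations s A (\<lambda>x. (x, b))) \<union>
      (\<Union>a\<in>A. slot_relations t B (\<lambda>x. (a, x))))"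

definition tensor3_eq ::
  "('k::field \<Rightarrow> 'a::ab_group_add \<Rightarrow> 'a) \<Rightarrow> 'a set \<Rightarrow> ('k \<Rightarrow> 'b::ab_group_add \<Rightarrow> 'b) \<Rightarrow> 'b set \<Rightarrow>
   ('k \<Rightarrow> 'c::ab_group_add \<Rightarrow> 'c) \<Rightarrow> 'c set \<Rightarrow>
   ('a \<times> 'b \<times> 'c) list \<Rightarrow> ('a \<times> 'b \<times> 'c) list \<Rightarrow> bool" where
  "tensor3_eq s A t B u C = tensor_eq
     ((\<Union>b\<in>B. \<Union>c\<in>C. slot_relations s A (\<lambda>x. (x, b, c))) \<union>
      (\<Union>a\<in>A. \<Union>c\<in>C. slot_relations t B (\<lambda>x. (a, x, c))) \<union>
      (\<Union>a\<in>A. \<Union>b\<in>B. slot_relations u C (\<lambda>x. (a, b, x))))"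

definition tensor4_eq ::
  "('k::field \<Rightarrow> 'a::ab_group_add \<Rightarrow> 'a) \<Rightarrow> 'a set \<Rightarrow>
   ('a \<times> 'a \<times> 'a \<times> 'a) list \<Rightarrow> ('a \<times> 'a \<times> 'a \<times> 'a) list \<Rightarrow> bool" where
  "tensor4_eq s A = tensor_eq
     ((\<Union>b\<in>A. \<Union>c\<in>A. \<Union>d\<in>A. slot_relations s A (\<lambda>x. (x, b, c, d))) \<union>
      (\<Union>a\<in>A. \<Union>c\<in>A. \<Union>d\<in>A. slot_relations s A (\<lambda>x. (a, x, c, d))) \<union>
      (\<Union>a\<in>A. \<Union>b\<in>A. \<Union>d\<in>A. slot_relations s A (\<lambda>x. (a, b, x, d))) \<union>
      (\<Union>a\<in>A. \<Union>b\<in>A. \<Union>c\<in>A. slot_relations s A (\<lambda>x. (a, b, c, x))))"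

definition tensor2_mult ::
  "('a::ring_1 \<times> 'a) list \<Rightarrow> ('a \<times> 'a) list \<Rightarrow> ('a \<times> 'a) list" where
  "tensor2_mult xs ys = [(a * a', b * b'). (a, b) \<leftarrow> xs, (a', b') \<leftarrow> ys]"

definition tensor3_mult ::
  "('a::ring_1 \<times> 'a \<times> 'a) list \<Rightarrow> ('a \<times> 'a \<times> 'a) list \<Rightarrow> ('a \<times> 'a \<times> 'a) list" where
  "tensor3_mult xs ys = [(a * a', b * b', c * c'). (a, b, c) \<leftarrow> xs, (a', b', c') \<leftarrow> ys]"

definition tensor4_mult ::
  "('a::ring_1 \<times> 'a \<times> 'a \<times> 'a) list \<Rightarrow> ('a \<times> 'a \<times> 'a \<times> 'a) list \<Rightarrow>
   ('a \<times> 'a \<times> 'a \<times> 'a) list" where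
  "tensor4_mult xs ys =
     [(a * a', b * b', c * c', d * d'). (a, b, c, d) \<leftarrow> xs, (a', b', c', d') \<leftarrow> ys]"

locale k_algebra = vector_space scale
  for scale :: "'k::field \<Rightarrow> 'a::ring_1 \<Rightarrow> 'a" +
  assumes scale_mult_left: "scale c x * y = scale c (x * y)"
    and scale_mult_right: "x * scale c y = scale c (x * y)"

definition unital_subalgebra :: "('k::field \<Rightarrow> 'a::ring_1 \<Rightarrow> 'a) \<Rightarrow> 'a set \<Rightarrow> bool" where
  "unital_subalgebra scale A \<longleftrightarrow>
     module.subspace scale A \<and> 1 \<in> A \<and> (\<forall>x\<in>A. \<forall>y\<in>A. x * y \<in> A)"

definition tensor3_inverse ::
  "('k::field \<Rightarrow> 'a::ring_1 \<Rightarrow> 'a) \<Rightarrow> 'a set \<Rightarrow>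
   ('a \<times> 'a \<times> 'a) list \<Rightarrow> ('a \<times> 'a \<times> 'a) list \<Rightarrow> bool" where
  "tensor3_inverse scale A \<phi> \<psi> \<longleftrightarrow>
     set \<psi> \<subseteq> A \<times> A \<times> A \<and>
     tensor3_eq scale A scale A scale A (tensor3_mult \<phi> \<psi>) [(1, 1, 1)] \<and>
     tensor3_eq scale A scale A scale A (tensor3_mult \<psi> \<phi>) [(1, 1, 1)]"

text \<open>
  The quasibialgebra structure lives on the unital subalgebra \<open>A\<close> of the ambient algebra, so that
  the notion applies both to an algebra (\<open>A = UNIV\<close>) and to its subalgebras.  The values of \<open>\<Delta>\<close> and
  \<open>\<epsilon>\<close> outside \<open>A\<close> are irrelevant.
\<close>

locale quasibialgebra = k_algebra scale
  for scale :: "'k::field \<Rightarrow> 'a::ring_1 \<Rightarrow> 'a" +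
  fixes A :: "'a set"
    and \<Delta> :: "'a \<Rightarrow> ('a \<times> 'a) list"
    and \<epsilon> :: "'a \<Rightarrow> 'k"
    and \<phi> :: "('a \<times> 'a \<times> 'a) list"
  assumes subalgebra: "unital_subalgebra scale A"
    and comult_closed: "x \<in> A \<Longrightarrow> set (\<Delta> x) \<subseteq> A \<times> A"
    and comult_add: "x \<in> A \<Longrightarrow> y \<in> A \<Longrightarrow>
      tensor2_eq scale A scale A (\<Delta> (x + y)) (\<Delta> x @ \<Delta> y)"
    and comult_scale: "x \<in> A \<Longrightarrow>
      tensor2_eq scale A scale A (\<Delta> (scale c x)) [(scale c a, b). (a, b) \<leftarrow> \<Delta> x]"
    and comult_one: "tensor2_eq scale A scale A (\<Delta> 1) [(1, 1)]"
    and comult_mult: "x \<in> A \<Longrightarrow> y \<in> A \<Longrightarrow>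
      tensor2_eq scale A scale A (\<Delta> (x * y)) (tensor2_mult (\<Delta> x) (\<Delta> y))"
    and counit_add: "x \<in> A \<Longrightarrow> y \<in> A \<Longrightarrow> \<epsilon> (x + y) = \<epsilon> x + \<epsilon> y"
    and counit_scale: "x \<in> A \<Longrightarrow> \<epsilon> (scale c x) = c * \<epsilon> x"
    and counit_one: "\<epsilon> 1 = 1"
    and counit_mult: "x \<in> A \<Longrightarrow> y \<in> A \<Longrightarrow> \<epsilon> (x * y) = \<epsilon> x * \<epsilon> y"
    and associator_closed: "set \<phi> \<subseteq> A \<times> A \<times> A"
    and associator_invertible: "\<exists>\<psi>. tensor3_inverse scale A \<phi> \<psi>"
    and counit_left: "x \<in> A \<Longrightarrow> (\<Sum>(a, b)\<leftarrow>\<Delta> x. scale (\<epsilon> a) b) = x"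
    and counit_right: "x \<in> A \<Longrightarrow> (\<Sum>(a, b)\<leftarrow>\<Delta> x. scale (\<epsilon> b) a) = x"
    and quasi_coassoc: "x \<in> A \<Longrightarrow>
      tensor3_eq scale A scale A scale A
        (tensor3_mult [(a, c, d). (a, b) \<leftarrow> \<Delta> x, (c, d) \<leftarrow> \<Delta> b] \<phi>)
        (tensor3_mult \<phi> [(c, d, b). (a, b) \<leftarrow> \<Delta> x, (c, d) \<leftarrow> \<Delta> a])"
    and pentagon:
      "tensor4_eq scale A
        (tensor4_mult [(a, b, d, e). (a, b, c) \<leftarrow> \<phi>, (d, e) \<leftarrow> \<Delta> c]
                      [(d, e, b, c). (a, b, c) \<leftarrow> \<phi>, (d, e) \<leftarrow> \<Delta> a])
        (tensor4_mult
          (tensor4_mult [(1, a, b, c). (a, b, c) \<leftarrow> \<phi>]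
                        [(a, d, e, c). (a, b, c) \<leftarrow> \<phi>, (d, e) \<leftarrow> \<Delta> b])
          [(a, b, c, 1). (a, b, c) \<leftarrow> \<phi>])"
    and associator_counit:
      "tensor2_eq scale A scale A [(scale (\<epsilon> b) a, c). (a, b, c) \<leftarrow> \<phi>] [(1, 1)]"

locale quasiantipode = quasibialgebra scale A \<Delta> \<epsilon> \<phi>
  for scale :: "'k::field \<Rightarrow> 'a::ring_1 \<Rightarrow> 'a"
    and A :: "'a set"
    and \<Delta> :: "'a \<Rightarrow> ('a \<times> 'a) list"
    and \<epsilon> :: "'a \<Rightarrow> 'k"
    and \<phi> :: "('a \<times> 'a \<times> 'a) list" +
  fixes S :: "'a \<Rightarrow> 'a" and \<alpha> \<beta> :: 'a
  assumes antipode_bij: "bij_betw S A A"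
    and antipode_add: "x \<in> A \<Longrightarrow> y \<in> A \<Longrightarrow> S (x + y) = S x + S y"
    and antipode_scale: "x \<in> A \<Longrightarrow> S (scale c x) = scale c (S x)"
    and antipode_one: "S 1 = 1"
    and antipode_mult: "x \<in> A \<Longrightarrow> y \<in> A \<Longrightarrow> S (x * y) = S y * S x"
    and alpha_closed: "\<alpha> \<in> A"
    and beta_closed: "\<beta> \<in> A"
    and antipode_alpha: "x \<in> A \<Longrightarrow> (\<Sum>(a, b)\<leftarrow>\<Delta> x. S a * \<alpha> * b) = scale (\<epsilon> x) \<alpha>"
    and antipode_beta: "x \<in> A \<Longrightarrow> (\<Sum>(a, b)\<leftarrow>\<Delta> x. a * \<beta> * S b) = scale (\<epsilon> x) \<beta>"
    and antipode_associator: "(\<Sum>(a, b, c)\<leftarrow>\<phi>. a * \<beta> * S b * \<alpha> * c) = 1"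
    and antipode_associator_inverse: "tensor3_inverse scale A \<phi> \<psi> \<Longrightarrow>
      (\<Sum>(a, b, c)\<leftarrow>\<psi>. S a * \<alpha> * b * \<beta> * S c) = 1"

definition quasi_hopf_algebra ::
  "('k::field \<Rightarrow> 'a::ring_1 \<Rightarrow> 'a) \<Rightarrow> 'a set \<Rightarrow> ('a \<Rightarrow> ('a \<times> 'a) list) \<Rightarrow> ('a \<Rightarrow> 'k) \<Rightarrow>
   ('a \<times> 'a \<times> 'a) list \<Rightarrow> bool" where
  "quasi_hopf_algebra scale A \<Delta> \<epsilon> \<phi> \<longleftrightarrow>
     quasibialgebra scale A \<Delta> \<epsilon> \<phi> \<and> (\<exists>S \<alpha> \<beta>. quasiantipode scale A \<Delta> \<epsilon> \<phi> S \<alpha> \<beta>)"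

text \<open>
  \<open>\<Delta>'\<close> and \<open>\<phi>'\<close> are the same tensors as \<open>\<Delta>\<close> (on \<open>K\<close>) and \<open>\<phi>\<close>, but written with entries in \<open>K\<close>; their
  existence says that \<open>\<Delta>(K) \<subseteq> K \<otimes> K\<close> and \<open>\<phi> \<in> K \<otimes> K \<otimes> K\<close>.
\<close>

definition quasi_hopf_subalgebra ::
  "('k::field \<Rightarrow> 'a::ring_1 \<Rightarrow> 'a) \<Rightarrow> ('a \<Rightarrow> ('a \<times> 'a) list) \<Rightarrow> ('a \<Rightarrow> 'k) \<Rightarrow>
   ('a \<times> 'a \<times> 'a) list \<Rightarrow> 'a set \<Rightarrow> bool" where
  "quasi_hopf_subalgebra scale \<Delta> \<epsilon> \<phi> K \<longleftrightarrow>
     unital_subalgebra scale K \<and>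
     (\<exists>\<Delta>' \<phi>'.
        (\<forall>x\<in>K. set (\<Delta>' x) \<subseteq> K \<times> K \<and> tensor2_eq scale UNIV scale UNIV (\<Delta>' x) (\<Delta> x)) \<and>
        set \<phi>' \<subseteq> K \<times> K \<times> K \<and>
        tensor3_eq scale UNIV scale UNIV scale UNIV \<phi>' \<phi> \<and>
        quasi_hopf_algebra scale K \<Delta>' \<epsilon> \<phi>')"

text \<open>
  A bimodule over the subalgebra \<open>K\<close>; the values of the actions outside \<open>K\<close> are irrelevant.
  The last two assumptions say that \<open>k\<close> acts centrally, through the given vector space structure.
\<close>

locale bimodule_over = vector_space scaleM
  for scale :: "'k::field \<Rightarrow> 'a::ring_1 \<Rightarrow> 'a"
    and K :: "'a set"
    and scaleM :: "'k \<Rightarrow> 'm::ab_group_add \<Rightarrow> 'm"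
    and lact :: "'a \<Rightarrow> 'm \<Rightarrow> 'm"
    and ract :: "'m \<Rightarrow> 'a \<Rightarrow> 'm" +
  assumes lact_add_left: "x \<in> K \<Longrightarrow> y \<in> K \<Longrightarrow> lact (x + y) m = lact x m + lact y m"
    and lact_add_right: "x \<in> K \<Longrightarrow> lact x (m + n) = lact x m + lact x n"
    and lact_mult: "x \<in> K \<Longrightarrow> y \<in> K \<Longrightarrow> lact (x * y) m = lact x (lact y m)"
    and lact_one: "lact 1 m = m"
    and ract_add_left: "x \<in> K \<Longrightarrow> ract (m + n) x = ract m x + ract n x"
    and ract_add_right: "x \<in> K \<Longrightarrow> y \<in> K \<Longrightarrow> ract m (x + y) = ract m x + ract m y"
    and ract_mult: "x \<in> K \<Longrightarrow> y \<in> K \<Longrightarrow> ract m (x * y) = ract (ract m x) y"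
    and ract_one: "ract m 1 = m"
    and lact_ract: "x \<in> K \<Longrightarrow> y \<in> K \<Longrightarrow> ract (lact x m) y = lact x (ract m y)"
    and lact_scalar: "lact (scale c 1) m = scaleM c m"
    and ract_scalar: "ract m (scale c 1) = scaleM c m"

text \<open>
  Since the actions on \<open>M\<close> are only meaningful for elements of \<open>K\<close>, the elements \<open>\<Delta> x\<close> for \<open>x \<in> K\<close> and
  \<open>\<phi>\<close> are replaced by arbitrary representatives \<open>xs\<close> and \<open>\<psi>\<close> with entries in \<open>K\<close>.
\<close>

locale hopf_module = bimodule_over scale K scaleM lact ract
  for scale :: "'k::field \<Rightarrow> 'a::ring_1 \<Rightarrow> 'a"
    and \<Delta> :: "'a \<Rightarrow> ('a \<times> 'a) list"
    and \<epsilon> :: "'a \<Rightarrow> 'k"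
    and \<phi> :: "('a \<times> 'a \<times> 'a) list"
    and K :: "'a set"
    and scaleM :: "'k \<Rightarrow> 'm::ab_group_add \<Rightarrow> 'm"
    and lact :: "'a \<Rightarrow> 'm \<Rightarrow> 'm"
    and ract :: "'m \<Rightarrow> 'a \<Rightarrow> 'm" +
  fixes \<delta> :: "'m \<Rightarrow> ('m \<times> 'a) list"
  assumes coact_add:
      "tensor2_eq scaleM UNIV scale UNIV (\<delta> (m + n)) (\<delta> m @ \<delta> n)"
    and coact_scale:
      "tensor2_eq scaleM UNIV scale UNIV (\<delta> (scaleM c m)) [(scaleM c n, h). (n, h) \<leftarrow> \<delta> m]"
    and coact_lact: "x \<in> K \<Longrightarrow> set xs \<subseteq> K \<times> K \<Longrightarrow>
      tensor2_eq scale UNIV scale UNIV xs (\<Delta> x) \<Longrightarrow>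
      tensor2_eq scaleM UNIV scale UNIV (\<delta> (lact x m))
        [(lact a n, b * h). (a, b) \<leftarrow> xs, (n, h) \<leftarrow> \<delta> m]"
    and coact_ract: "x \<in> K \<Longrightarrow> set xs \<subseteq> K \<times> K \<Longrightarrow>
      tensor2_eq scale UNIV scale UNIV xs (\<Delta> x) \<Longrightarrow>
      tensor2_eq scaleM UNIV scale UNIV (\<delta> (ract m x))
        [(ract n a, h * b). (n, h) \<leftarrow> \<delta> m, (a, b) \<leftarrow> xs]"
    and coact_counit: "(\<Sum>(n, h)\<leftarrow>\<delta> m. scaleM (\<epsilon> h) n) = m"
    and coact_coassoc: "set \<psi> \<subseteq> K \<times> K \<times> K \<Longrightarrow>
      tensor3_eq scale UNIV scale UNIV scale UNIV \<psi> \<phi> \<Longrightarrow>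
      tensor3_eq scaleM UNIV scale UNIV scale UNIV
        [(ract n p, a * q, b * r). (n, h) \<leftarrow> \<delta> m, (a, b) \<leftarrow> \<Delta> h, (p, q, r) \<leftarrow> \<psi>]
        [(lact p n', q * h', r * h). (p, q, r) \<leftarrow> \<psi>, (n, h) \<leftarrow> \<delta> m, (n', h') \<leftarrow> \<delta> n]"

text \<open>In the following two definitions \<open>act a m\<close> is the left, or the right, action of \<open>a \<in> K\<close> on \<open>m\<close>.\<close>

definition finitely_generated_module ::
  "'a::ring_1 set \<Rightarrow> ('a \<Rightarrow> 'm::ab_group_add \<Rightarrow> 'm) \<Rightarrow> bool" where
  "finitely_generated_module K act \<longleftrightarrow>
     (\<exists>B. finite B \<and> (\<forall>m. \<exists>c. c ` B \<subseteq> K \<and> m = (\<Sum>b\<in>B. act (c b) b)))"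

definition free_module ::
  "'a::ring_1 set \<Rightarrow> ('a \<Rightarrow> 'm::ab_group_add \<Rightarrow> 'm) \<Rightarrow> bool" where
  "free_module K act \<longleftrightarrow>
     (\<exists>B. (\<forall>m. \<exists>F c. finite F \<and> F \<subseteq> B \<and> c ` F \<subseteq> K \<and> m = (\<Sum>b\<in>F. act (c b) b)) \<and>
          (\<forall>F c. finite F \<longrightarrow> F \<subseteq> B \<longrightarrow> c ` F \<subseteq> K \<longrightarrow> (\<Sum>b\<in>F. act (c b) b) = 0 \<longrightarrow>
             (\<forall>b\<in>F. c b = 0)))"

end

theory Submission
  imports Defs "HOL-Library.Function_Algebras"
begin

text \<open>
Let \<open>d = dim K\<close>, \<open>n = dim H\<close> and \<open>N = dim M\<close>, and for a finite-dimensional left \<open>K\<close>-module \<open>X\<close> let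
\<open>h(X)\<close> be the dimension of \<open>Hom\<^sub>K(M, X)\<close>.  A free module of dimension \<open>N\<close> satisfies
\<open>d h(X) = N dim X\<close> for all \<open>X\<close>.  The proof establishes the inequality
\<open>d h(X) \<le> N dim X\<close> for all \<open>X\<close>, and shows that the inequality already forces \<open>M\<close> to be free.

The inequality comes from the coaction.  Let \<open>H\<^sup>*\<close> be the dual of \<open>H\<close>, with the left action
\<open>(x v)(y) = v(y x)\<close>.  A \<open>K\<close>-linear map \<open>f : M \<rightarrow> X\<close> and a form \<open>v \<in> H\<^sup>*\<close> yield the \<open>K\<close>-linear map
\<open>M \<rightarrow> X \<otimes> H\<^sup>*, m \<mapsto> f(m\<^sub>0) \<otimes> m\<^sub>1 v\<close>, and \<open>Hom\<^sub>K(M, X) \<otimes> H\<^sup>*\<close> is thereby embedded into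
\<open>Hom\<^sub>K(M, X \<otimes> H\<^sup>*)\<close> (\<open>coaction_separates\<close>).  So the latter space has dimension at least \<open>n h(X)\<close>.
On the other hand, restricting forms from \<open>H\<close> to \<open>K\<close> is a \<open>K\<close>-linear surjection \<open>H\<^sup>* \<rightarrow> K\<^sup>*\<close> with kernel
\<open>(H/K)\<^sup>*\<close>, and a \<open>K\<close>-linear map into \<open>X \<otimes> K\<^sup>*\<close> is determined by a single linear map \<open>M \<rightarrow> X\<close>
(\<open>restriction_determined\<close>), as in the case of \<open>Hom\<^sub>K(M, K\<^sup>*) = M\<^sup>*\<close>.  Together this gives
\<open>n h(X) \<le> N dim X + h(X \<otimes> (H/K)\<^sup>*)\<close> (\<open>hom_dim_inequality\<close>).  If \<open>c\<close> is the supremum of the ratios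
\<open>h(X) / dim X\<close>, it follows that \<open>n c \<le> N + (n - d) c\<close>, that is, \<open>d c \<le> N\<close> (\<open>ratio_bound\<close>).

For Hopf algebras the two statements about linear maps follow from \<open>S(m\<^sub>1) m\<^sub>2 = \<epsilon>(m)\<close>.  In the quasi-Hopf case
the associator has to be carried along, and the cancellation that remains is an identity between
the associator, its inverse and the antipode.  Each of the two statements needs one such identity, in one case for the
antipode of \<open>K\<close> (\<open>antipode_pentagon\<close>), in the other for the inverse of the antipode of \<open>H\<close>
(\<open>inverse_antipode_pentagon\<close>); both are contractions of the pentagon.  The right action of \<open>K\<close> on \<open>M\<close> is what allows
the associator to pass from one side of the coassociativity law to the other.

Freeness follows by counting.  If \<open>h(X) \<le> r dim X\<close> for all \<open>X\<close>, then \<open>r\<close> elements generate \<open>M\<close>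
(\<open>generated_by\<close>).  Since \<open>N / d\<close> is not known to be an integer in advance, this is first applied to \<open>M\<^sup>d\<close> with \<open>r = N\<close>:
the module \<open>M\<^sup>d\<close> has \<open>N\<close> generators and dimension \<open>d N\<close>, so it is free of rank \<open>N\<close>.  Counting homomorphisms to the
one-dimensional module \<open>k\<close> given by \<open>\<epsilon>\<close> then shows \<open>N \<le> d h(k)\<close>, hence \<open>N = d h(k)\<close>.  So
\<open>h(X) \<le> h(k) dim X\<close> for all \<open>X\<close>, and \<open>M\<close> has \<open>h(k)\<close> generators and dimension \<open>d h(k)\<close>; it is free
(\<open>freeness_criterion\<close>).
\<close>

section \<open>Evaluating tensors by multilinear forms\<close>

definition lin ::
  "('k::field \<Rightarrow> 'a::ab_group_add \<Rightarrow> 'a) \<Rightarrow> ('k \<Rightarrow> 'b::ab_group_add \<Rightarrow> 'b) \<Rightarrow> ('a \<Rightarrow> 'b) \<Rightarrow> bool" where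
  "lin s t f \<longleftrightarrow> (\<forall>x y. f (x + y) = f x + f y) \<and> (\<forall>c x. f (s c x) = t c (f x))"

definition bilin ::
  "('k::field \<Rightarrow> 'a::ab_group_add \<Rightarrow> 'a) \<Rightarrow> ('k \<Rightarrow> 'b::ab_group_add \<Rightarrow> 'b) \<Rightarrow> ('a \<Rightarrow> 'b \<Rightarrow> 'k) \<Rightarrow> bool" where
  "bilin s t \<Phi> \<longleftrightarrow> (\<forall>b. lin s (*) (\<lambda>a. \<Phi> a b)) \<and> (\<forall>a. lin t (*) (\<lambda>b. \<Phi> a b))"

definition trilin ::
  "('k::field \<Rightarrow> 'a::ab_group_add \<Rightarrow> 'a) \<Rightarrow> ('k \<Rightarrow> 'b::ab_group_add \<Rightarrow> 'b) \<Rightarrow>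
   ('k \<Rightarrow> 'c::ab_group_add \<Rightarrow> 'c) \<Rightarrow> ('a \<Rightarrow> 'b \<Rightarrow> 'c \<Rightarrow> 'k) \<Rightarrow> bool" where
  "trilin s t u \<Phi> \<longleftrightarrow> (\<forall>b c. lin s (*) (\<lambda>a. \<Phi> a b c)) \<and> (\<forall>a c. lin t (*) (\<lambda>b. \<Phi> a b c)) \<and>
     (\<forall>a b. lin u (*) (\<lambda>c. \<Phi> a b c))"

definition quadlin ::
  "('k::field \<Rightarrow> 'a::ab_group_add \<Rightarrow> 'a) \<Rightarrow> ('a \<Rightarrow> 'a \<Rightarrow> 'a \<Rightarrow> 'a \<Rightarrow> 'k) \<Rightarrow> bool" where
  "quadlin s \<Phi> \<longleftrightarrow> (\<forall>b c d. lin s (*) (\<lambda>a. \<Phi> a b c d)) \<and> (\<forall>a c d. lin s (*) (\<lambda>b. \<Phi> a b c d)) \<and>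
     (\<forall>a b d. lin s (*) (\<lambda>c. \<Phi> a b c d)) \<and> (\<forall>a b c. lin s (*) (\<lambda>d. \<Phi> a b c d))"

lemma linD:
  assumes "lin s t f"
  shows "f (x + y) = f x + f y" "f (s c x) = t c (f x)" "f 0 = 0" "f (- x) = - f x"
    "f (x - y) = f x - f y"
proof -
  interpret additive f using assms by unfold_locales (simp add: lin_def)
  show "f (x + y) = f x + f y" "f (s c x) = t c (f x)" "f 0 = 0" "f (- x) = - f x"
    "f (x - y) = f x - f y"
    using assms by (auto simp: lin_def zero minus diff)
qed

lemma lin_sum: "lin s t f \<Longrightarrow> f (sum g I) = (\<Sum>i\<in>I. f (g i))"
  by (induction I rule: infinite_finite_induct) (auto simp: linD)

lemma lin_sum_list2: "lin s t f \<Longrightarrow> f (\<Sum>(a, b)\<leftarrow>xs. g a b) = (\<Sum>(a, b)\<leftarrow>xs. f (g a b))"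
  by (induction xs) (auto simp: linD)

lemma lin_sum_list3: "lin s t f \<Longrightarrow> f (\<Sum>(a, b, c)\<leftarrow>xs. g a b c) = (\<Sum>(a, b, c)\<leftarrow>xs. f (g a b c))"
  by (induction xs) (auto simp: linD)

lemma lin_id: "lin s s (\<lambda>x. x)"
  by (simp add: lin_def)

lemma lin_compose: "lin s t f \<Longrightarrow> lin r s g \<Longrightarrow> lin r t (\<lambda>x. f (g x))"
  by (simp add: lin_def)

lemma lin_sum_listI: "(\<And>z. z \<in> set zs \<Longrightarrow> lin s (*) (\<lambda>x. f z x)) \<Longrightarrow> lin s (*) (\<lambda>x. \<Sum>z\<leftarrow>zs. f z x)"
proof (induction zs)
  case Nil then show ?case by (simp add: lin_def)
next
  case (Cons a zs)
  have "lin s (*) (f a)" "lin s (*) (\<lambda>x. \<Sum>z\<leftarrow>zs. f z x)" using Cons by auto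
  then show ?case by (simp add: lin_def algebra_simps)
qed

lemma lin_sumI: "(\<And>z. z \<in> I \<Longrightarrow> lin s (*) (\<lambda>x. f z x)) \<Longrightarrow> lin s (*) (\<lambda>x. \<Sum>z\<in>I. f z x)"
  by (induction I rule: infinite_finite_induct) (auto simp: lin_def algebra_simps)

lemma lin_case_prod: "(\<And>a b. z = (a, b) \<Longrightarrow> lin s (*) (\<lambda>x. f a b x)) \<Longrightarrow> lin s (*) (\<lambda>x. case z of (a, b) \<Rightarrow> f a b x)"
  by (cases z) simp

lemma lin_const_mult: "lin s (*) f \<Longrightarrow> lin s (*) (\<lambda>x. c * f x)"
  by (simp add: lin_def algebra_simps)

lemma lin_mult_const: "lin s (*) f \<Longrightarrow> lin s (*) (\<lambda>x. f x * c)"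
  by (simp add: lin_def algebra_simps)

lemmas lin_form_intros = lin_sum_listI lin_sumI lin_case_prod lin_const_mult lin_mult_const

lemma bilinI: "(\<And>b. lin s (*) (\<lambda>a. \<Phi> a b)) \<Longrightarrow> (\<And>a. lin t (*) (\<lambda>b. \<Phi> a b)) \<Longrightarrow> bilin s t \<Phi>"
  by (simp add: bilin_def)

lemma trilinI: "(\<And>b c. lin s (*) (\<lambda>a. \<Phi> a b c)) \<Longrightarrow> (\<And>a c. lin t (*) (\<lambda>b. \<Phi> a b c)) \<Longrightarrow>
    (\<And>a b. lin u (*) (\<lambda>c. \<Phi> a b c)) \<Longrightarrow> trilin s t u \<Phi>"
  by (simp add: trilin_def)

lemma quadlinI: "(\<And>b c d. lin s (*) (\<lambda>a. \<Phi> a b c d)) \<Longrightarrow> (\<And>a c d. lin s (*) (\<lambda>b. \<Phi> a b c d)) \<Longrightarrow>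
    (\<And>a b d. lin s (*) (\<lambda>c. \<Phi> a b c d)) \<Longrightarrow> (\<And>a b c. lin s (*) (\<lambda>d. \<Phi> a b c d)) \<Longrightarrow> quadlin s \<Phi>"
  by (simp add: quadlin_def)

lemma bilinD:
  assumes "bilin s t \<Phi>"
  shows "lin r s g \<Longrightarrow> lin r (*) (\<lambda>x. \<Phi> (g x) b)" "lin r t h \<Longrightarrow> lin r (*) (\<lambda>x. \<Phi> a (h x))"
  using assms by (auto simp: bilin_def intro: lin_compose)

lemma trilinD:
  assumes "trilin s t u \<Phi>"
  shows "lin r s f \<Longrightarrow> lin r (*) (\<lambda>x. \<Phi> (f x) b c)" "lin r t g \<Longrightarrow> lin r (*) (\<lambda>x. \<Phi> a (g x) c)"
    "lin r u h \<Longrightarrow> lin r (*) (\<lambda>x. \<Phi> a b (h x))"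
  using assms by (auto simp: trilin_def lin_def)

lemma quadlinD:
  assumes "quadlin s \<Phi>" and g: "lin r s g"
  shows "lin r (*) (\<lambda>x. \<Phi> (g x) b c d)" "lin r (*) (\<lambda>x. \<Phi> a (g x) c d)"
    "lin r (*) (\<lambda>x. \<Phi> a b (g x) d)" "lin r (*) (\<lambda>x. \<Phi> a b c (g x))"
  using assms by (auto simp: quadlin_def lin_def)

lemma sum_list_swap: "(\<Sum>x\<leftarrow>xs. \<Sum>y\<leftarrow>ys. f x y :: 'a::comm_monoid_add) = (\<Sum>y\<leftarrow>ys. \<Sum>x\<leftarrow>xs. f x y)"
  by (induction xs) (simp_all add: sum_list_addf)

lemma sum_list_map_concat: "(\<Sum>x\<leftarrow>concat xss. f x) = (\<Sum>xs\<leftarrow>xss. \<Sum>x\<leftarrow>xs. f x :: 'a::monoid_add)"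
  by (induction xss) simp_all

text \<open>These rules turn a sum over a list comprehension into an iterated sum.\<close>
lemmas tensor_sum_simps = sum_list_map_concat map_map o_def case_prod_unfold fst_conv snd_conv

definition linear_extension :: "('w \<Rightarrow> 'k::field) \<Rightarrow> ('w \<Rightarrow>\<^sub>0 'k) \<Rightarrow> 'k" where
  "linear_extension \<Phi> p = (\<Sum>w\<in>Poly_Mapping.keys p. Poly_Mapping.lookup p w * \<Phi> w)"

lemma linear_extension_superset:
  assumes "finite W" "Poly_Mapping.keys p \<subseteq> W"
  shows "linear_extension \<Phi> p = (\<Sum>w\<in>W. Poly_Mapping.lookup p w * \<Phi> w)"
  unfolding linear_extension_def
  by (rule sum.mono_neutral_left) (use assms in \<open>auto simp: in_keys_iff\<close>)

lemma lookup_map_times: "Poly_Mapping.lookup (Poly_Mapping.map ((*) c) p) w = (c::'k::field) * Poly_Mapping.lookup p w"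
  by (simp add: Poly_Mapping.map.rep_eq when_def)

lemma linear_extension_add: "linear_extension \<Phi> (p + q) = linear_extension \<Phi> p + linear_extension \<Phi> q"
proof -
  let ?W = "Poly_Mapping.keys p \<union> Poly_Mapping.keys q"
  have "Poly_Mapping.keys (p + q) \<subseteq> ?W" by (rule Poly_Mapping.keys_add)
  then show ?thesis
    by (subst (1 2 3) linear_extension_superset[of ?W])
      (auto simp: lookup_add sum.distrib algebra_simps)
qed

lemma linear_extension_map: "linear_extension \<Phi> (Poly_Mapping.map ((*) c) p) = c * linear_extension \<Phi> p"
proof -
  have "Poly_Mapping.keys (Poly_Mapping.map ((*) c) p) \<subseteq> Poly_Mapping.keys p"
    by (auto simp: in_keys_iff lookup_map_times)
  then show ?thesis
    by (subst (1 2) linear_extension_superset[of "Poly_Mapping.keys p"])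
      (auto simp: lookup_map_times sum_distrib_left algebra_simps)
qed

lemma linear_extension_zero: "linear_extension \<Phi> 0 = 0"
  by (simp add: linear_extension_def)

lemma linear_extension_diff: "linear_extension \<Phi> (p - q) = linear_extension \<Phi> p - linear_extension \<Phi> q"
  using linear_extension_add[of \<Phi> "p - q" q] by simp

lemma linear_extension_single: "linear_extension \<Phi> (Poly_Mapping.single w c) = c * \<Phi> w"
  by (simp add: linear_extension_def)

lemma linear_extension_formal_sum: "linear_extension \<Phi> (formal_sum xs) = (\<Sum>w\<leftarrow>xs. \<Phi> w)"
  by (induction xs)
    (simp_all add: formal_sum_def linear_extension_add linear_extension_zero linear_extension_single)

lemma free_vector_space_module:
  "module (\<lambda>(c::'k::field) p :: 'w \<Rightarrow>\<^sub>0 'k. Poly_Mapping.map ((*) c) p)"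
  by unfold_locales (auto intro!: poly_mapping_eqI simp: lookup_map_times lookup_add algebra_simps)

text \<open>
A form that is linear in each factor extends linearly to the free vector space on the tuples and
vanishes on the multilinearity relations, so it takes the same value on equal tensors.  All tensor
identities are used in this way: both sides are evaluated at an arbitrary multilinear form.
\<close>

lemma tensor_eq_evaluate:
  fixes \<Phi> :: "'w \<Rightarrow> 'k::field"
  assumes "tensor_eq R xs ys" and R: "\<And>r. r \<in> R \<Longrightarrow> linear_extension \<Phi> r = 0"
  shows "(\<Sum>w\<leftarrow>xs. \<Phi> w) = (\<Sum>w\<leftarrow>ys. \<Phi> w)"
proof -
  interpret module "\<lambda>(c::'k) p :: 'w \<Rightarrow>\<^sub>0 'k. Poly_Mapping.map ((*) c) p"
    by (rule free_vector_space_module)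
  have "linear_extension \<Phi> r = 0" if "r \<in> span R" for r
    using that
    by (induction rule: span_induct)
      (auto simp: R subspace_def linear_extension_add linear_extension_map linear_extension_zero)
  from this[of "formal_sum xs - formal_sum ys"] show ?thesis
    using assms(1) by (simp add: tensor_eq_def linear_extension_diff linear_extension_formal_sum)
qed

lemma slot_relations_evaluate:
  assumes "r \<in> slot_relations s A ins" and "lin s (*) (\<lambda>x. \<Phi> (ins x))"
  shows "linear_extension \<Phi> r = 0"
  using assms(1) linD(1,2)[OF assms(2)]
  by (auto simp: slot_relations_def linear_extension_diff linear_extension_single)

lemma tensor2_eq_evaluate:
  assumes "tensor2_eq s A t B xs ys" and \<Phi>: "bilin s t \<Phi>"
  shows "(\<Sum>(a, b)\<leftarrow>xs. \<Phi> a b) = (\<Sum>(a, b)\<leftarrow>ys. \<Phi> a b)"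
  using assms(1) unfolding tensor2_eq_def
  by (rule tensor_eq_evaluate)
    (use \<Phi> in \<open>auto simp: bilin_def elim!: slot_relations_evaluate\<close>)

lemma tensor3_eq_evaluate:
  assumes "tensor3_eq s A t B u C xs ys" and \<Phi>: "trilin s t u \<Phi>"
  shows "(\<Sum>(a, b, c)\<leftarrow>xs. \<Phi> a b c) = (\<Sum>(a, b, c)\<leftarrow>ys. \<Phi> a b c)"
  using assms(1) unfolding tensor3_eq_def
  by (rule tensor_eq_evaluate)
    (use \<Phi> in \<open>auto simp: trilin_def elim!: slot_relations_evaluate\<close>)

lemma tensor4_eq_evaluate:
  assumes "tensor4_eq s A xs ys" and \<Phi>: "quadlin s \<Phi>"
  shows "(\<Sum>(a, b, c, d)\<leftarrow>xs. \<Phi> a b c d) = (\<Sum>(a, b, c, d)\<leftarrow>ys. \<Phi> a b c d)"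
  using assms(1) unfolding tensor4_eq_def
  by (rule tensor_eq_evaluate)
    (use \<Phi> in \<open>auto simp: quadlin_def elim!: slot_relations_evaluate\<close>)

section \<open>Quasibialgebras under multilinear forms\<close>

lemma sum_list_cong2: "(\<And>a b. (a, b) \<in> set xs \<Longrightarrow> f a b = g a b) \<Longrightarrow>
    (\<Sum>(a, b)\<leftarrow>xs. f a b) = (\<Sum>(a, b)\<leftarrow>xs. g a b)"
  by (rule arg_cong[where f = sum_list], rule map_cong) auto

lemma sum_list_cong3: "(\<And>a b c. (a, b, c) \<in> set xs \<Longrightarrow> f a b c = g a b c) \<Longrightarrow>
    (\<Sum>(a, b, c)\<leftarrow>xs. f a b c) = (\<Sum>(a, b, c)\<leftarrow>xs. g a b c)"
  by (rule arg_cong[where f = sum_list], rule map_cong) auto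

lemma sum_list_swap22: "(\<Sum>(a, b)\<leftarrow>xs. \<Sum>(c, d)\<leftarrow>ys. f a b c d :: 'a::comm_monoid_add) =
    (\<Sum>(c, d)\<leftarrow>ys. \<Sum>(a, b)\<leftarrow>xs. f a b c d)"
  unfolding split_beta by (rule sum_list_swap)

lemma sum_list_swap23: "(\<Sum>(a, b)\<leftarrow>xs. \<Sum>(c, d, e)\<leftarrow>ys. f a b c d e :: 'a::comm_monoid_add) =
    (\<Sum>(c, d, e)\<leftarrow>ys. \<Sum>(a, b)\<leftarrow>xs. f a b c d e)"
  unfolding split_beta by (rule sum_list_swap)

lemma sum_list_swap33: "(\<Sum>(a, b, c)\<leftarrow>xs. \<Sum>(d, e, f)\<leftarrow>ys. g a b c d e f :: 'a::comm_monoid_add) =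
    (\<Sum>(d, e, f)\<leftarrow>ys. \<Sum>(a, b, c)\<leftarrow>xs. g a b c d e f)"
  unfolding split_beta by (rule sum_list_swap)

lemma sum_list_mult_const2: "(\<Sum>(a, b)\<leftarrow>xs. c * f a b :: 'a::semiring_0) = c * (\<Sum>(a, b)\<leftarrow>xs. f a b)"
  unfolding split_beta by (rule sum_list_const_mult)

lemma sum_list_mult_const3: "(\<Sum>(a, b, d)\<leftarrow>xs. c * f a b d :: 'a::semiring_0) = c * (\<Sum>(a, b, d)\<leftarrow>xs. f a b d)"
  unfolding split_beta by (rule sum_list_const_mult)

context k_algebra begin

lemma lin_mult_left: "lin r scale g \<Longrightarrow> lin r scale (\<lambda>x. y * g x)"
  by (simp add: lin_def scale_mult_right distrib_left)

lemma lin_mult_right: "lin r scale g \<Longrightarrow> lin r scale (\<lambda>x. g x * y)"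
  by (simp add: lin_def scale_mult_left distrib_right)

lemmas lin_intros = lin_id lin_mult_left lin_mult_right lin_form_intros

end

text \<open>
The linear projection \<open>P\<close> onto the subalgebra \<open>A\<close> extends everything that is only meaningful on \<open>A\<close> to the
ambient algebra.  Linearity can then be stated without side conditions, while multiplicativity is
still restricted to \<open>A\<close>.  The tensor \<open>\<psi>\<close> is a chosen inverse of the associator.
\<close>

locale projected_quasibialgebra = quasibialgebra scale A \<Delta> \<epsilon> \<phi>
  for scale :: "'k::field \<Rightarrow> 'a::ring_1 \<Rightarrow> 'a"
    and A :: "'a set"
    and \<Delta> :: "'a \<Rightarrow> ('a \<times> 'a) list"
    and \<epsilon> :: "'a \<Rightarrow> 'k"
    and \<phi> :: "('a \<times> 'a \<times> 'a) list" +
  fixes P :: "'a \<Rightarrow> 'a" and \<psi> :: "('a \<times> 'a \<times> 'a) list"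
  assumes projection_lin: "lin scale scale P"
    and projection_in: "P x \<in> A"
    and projection_id: "x \<in> A \<Longrightarrow> P x = x"
    and associator_inverse: "tensor3_inverse scale A \<phi> \<psi>"
begin

text \<open>
The comultiplication and the counit, extended along the projection to the whole algebra, where they are linear;
for the comultiplication this holds up to equality of tensors.
\<close>

definition D where "D x = \<Delta> (P x)"
definition E where "E x = \<epsilon> (P x)"

lemma D_eq: "x \<in> A \<Longrightarrow> D x = \<Delta> x" by (simp add: D_def projection_id)
lemma E_eq: "x \<in> A \<Longrightarrow> E x = \<epsilon> x" by (simp add: E_def projection_id)

lemma one_in: "1 \<in> A" and mult_in: "x \<in> A \<Longrightarrow> y \<in> A \<Longrightarrow> x * y \<in> A"
  using subalgebra by (auto simp: unital_subalgebra_def)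

lemma D_in: "(a, b) \<in> set (D x) \<Longrightarrow> a \<in> A" "(a, b) \<in> set (D x) \<Longrightarrow> b \<in> A"
  using comult_closed[OF projection_in[of x]] by (auto simp: D_def)

lemma phi_in: "(a, b, c) \<in> set \<phi> \<Longrightarrow> a \<in> A" "(a, b, c) \<in> set \<phi> \<Longrightarrow> b \<in> A" "(a, b, c) \<in> set \<phi> \<Longrightarrow> c \<in> A"
  using associator_closed by auto

lemma psi_in: "(a, b, c) \<in> set \<psi> \<Longrightarrow> a \<in> A" "(a, b, c) \<in> set \<psi> \<Longrightarrow> b \<in> A" "(a, b, c) \<in> set \<psi> \<Longrightarrow> c \<in> A"
  using associator_inverse by (auto simp: tensor3_inverse_def)

lemma D_lin:
  assumes \<Phi>: "bilin scale scale \<Phi>" and g: "lin r scale g"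
  shows "lin r (*) (\<lambda>x. \<Sum>(a, b)\<leftarrow>D (g x). \<Phi> a b)"
proof -
  have hom: "\<Phi> (scale c a) b = c * \<Phi> a b" for c a b
    using \<Phi> by (simp add: bilin_def lin_def)
  have "(\<Sum>(a, b)\<leftarrow>D (g x + g y). \<Phi> a b) = (\<Sum>(a, b)\<leftarrow>D (g x). \<Phi> a b) + (\<Sum>(a, b)\<leftarrow>D (g y). \<Phi> a b)" for x y
    using tensor2_eq_evaluate[OF comult_add[OF projection_in[of "g x"] projection_in[of "g y"]] \<Phi>]
    by (simp add: D_def linD[OF projection_lin])
  moreover have "(\<Sum>(a, b)\<leftarrow>D (scale c (g x)). \<Phi> a b) = c * (\<Sum>(a, b)\<leftarrow>D (g x). \<Phi> a b)" for c x
    using tensor2_eq_evaluate[OF comult_scale[OF projection_in[of "g x"], of c] \<Phi>]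
    by (simp add: D_def linD[OF projection_lin] tensor_sum_simps hom sum_list_const_mult)
  ultimately show ?thesis using g by (simp add: lin_def)
qed

lemma E_lin: "lin r scale g \<Longrightarrow> lin r (*) (\<lambda>x. E (g x))"
  using counit_add[OF projection_in projection_in] counit_scale[OF projection_in] projection_lin
  by (simp add: lin_def E_def)

lemma E_mult: "x \<in> A \<Longrightarrow> y \<in> A \<Longrightarrow> E (x * y) = E x * E y"
  by (simp add: E_eq mult_in counit_mult)

lemma E_one: "E 1 = 1"
  by (simp add: E_eq one_in counit_one)

lemma D_mult:
  assumes "bilin scale scale \<Phi>" "x \<in> A" "y \<in> A"
  shows "(\<Sum>(a, b)\<leftarrow>D (x * y). \<Phi> a b) = (\<Sum>(a, b)\<leftarrow>D x. \<Sum>(c, d)\<leftarrow>D y. \<Phi> (a * c) (b * d))"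
  using tensor2_eq_evaluate[OF comult_mult[OF assms(2,3)] assms(1)]
  by (simp add: D_eq assms mult_in tensor2_mult_def tensor_sum_simps)

lemma D_one:
  assumes "bilin scale scale \<Phi>"
  shows "(\<Sum>(a, b)\<leftarrow>D 1. \<Phi> a b) = \<Phi> 1 1"
  using tensor2_eq_evaluate[OF comult_one assms] by (simp add: D_eq one_in)

lemma D_counit_left:
  assumes "lin scale (*) l" "x \<in> A"
  shows "(\<Sum>(a, b)\<leftarrow>D x. E a * l b) = l x"
proof -
  have "(\<Sum>(a, b)\<leftarrow>D x. E a * l b) = (\<Sum>(a, b)\<leftarrow>\<Delta> x. l (scale (\<epsilon> a) b))"
    unfolding D_eq[OF assms(2)]
    by (rule sum_list_cong2) (use comult_closed[OF assms(2)] in \<open>auto simp: linD[OF assms(1)] E_eq\<close>)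
  then show ?thesis
    using lin_sum_list2[OF assms(1), of "\<lambda>a b. scale (\<epsilon> a) b" "\<Delta> x"] counit_left[OF assms(2)] by simp
qed

lemma D_counit_right:
  assumes "lin scale (*) l" "x \<in> A"
  shows "(\<Sum>(a, b)\<leftarrow>D x. E b * l a) = l x"
proof -
  have "(\<Sum>(a, b)\<leftarrow>D x. E b * l a) = (\<Sum>(a, b)\<leftarrow>\<Delta> x. l (scale (\<epsilon> b) a))"
    unfolding D_eq[OF assms(2)]
    by (rule sum_list_cong2) (use comult_closed[OF assms(2)] in \<open>auto simp: linD[OF assms(1)] E_eq\<close>)
  then show ?thesis
    using lin_sum_list2[OF assms(1), of "\<lambda>a b. scale (\<epsilon> b) a" "\<Delta> x"] counit_right[OF assms(2)] by simp
qed

lemma phi_psi: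
  assumes "trilin scale scale scale \<Phi>"
  shows "(\<Sum>(a, b, c)\<leftarrow>\<phi>. \<Sum>(p, q, r)\<leftarrow>\<psi>. \<Phi> (a * p) (b * q) (c * r)) = \<Phi> 1 1 1"
    and "(\<Sum>(p, q, r)\<leftarrow>\<psi>. \<Sum>(a, b, c)\<leftarrow>\<phi>. \<Phi> (p * a) (q * b) (r * c)) = \<Phi> 1 1 1"
proof -
  have "tensor3_eq scale A scale A scale A (tensor3_mult \<phi> \<psi>) [(1, 1, 1)]"
    and "tensor3_eq scale A scale A scale A (tensor3_mult \<psi> \<phi>) [(1, 1, 1)]"
    using associator_inverse by (simp_all add: tensor3_inverse_def)
  from this[THEN tensor3_eq_evaluate[OF _ assms]]
  show "(\<Sum>(a, b, c)\<leftarrow>\<phi>. \<Sum>(p, q, r)\<leftarrow>\<psi>. \<Phi> (a * p) (b * q) (c * r)) = \<Phi> 1 1 1"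
    and "(\<Sum>(p, q, r)\<leftarrow>\<psi>. \<Sum>(a, b, c)\<leftarrow>\<phi>. \<Phi> (p * a) (q * b) (r * c)) = \<Phi> 1 1 1"
    by (simp_all add: tensor3_mult_def tensor_sum_simps)
qed

lemma phi_D:
  "(\<Sum>(a, b, c)\<leftarrow>\<phi>. \<Sum>(d, e)\<leftarrow>\<Delta> a. F a b c d e) = (\<Sum>(a, b, c)\<leftarrow>\<phi>. \<Sum>(d, e)\<leftarrow>D a. F a b c d e :: 'k)"
  "(\<Sum>(a, b, c)\<leftarrow>\<phi>. \<Sum>(d, e)\<leftarrow>\<Delta> b. F a b c d e) = (\<Sum>(a, b, c)\<leftarrow>\<phi>. \<Sum>(d, e)\<leftarrow>D b. F a b c d e :: 'k)"
  "(\<Sum>(a, b, c)\<leftarrow>\<phi>. \<Sum>(d, e)\<leftarrow>\<Delta> c. F a b c d e) = (\<Sum>(a, b, c)\<leftarrow>\<phi>. \<Sum>(d, e)\<leftarrow>D c. F a b c d e :: 'k)"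
  by (rule sum_list_cong3; simp add: D_eq phi_in)+

lemma D_D:
  "(\<Sum>(a, b)\<leftarrow>D x. \<Sum>(d, e)\<leftarrow>\<Delta> a. F a b d e) = (\<Sum>(a, b)\<leftarrow>D x. \<Sum>(d, e)\<leftarrow>D a. F a b d e :: 'k)"
  "(\<Sum>(a, b)\<leftarrow>D x. \<Sum>(d, e)\<leftarrow>\<Delta> b. F a b d e) = (\<Sum>(a, b)\<leftarrow>D x. \<Sum>(d, e)\<leftarrow>D b. F a b d e :: 'k)"
  by (rule sum_list_cong2, subst D_eq, erule D_in, rule refl)+

lemma D_coassoc:
  assumes "trilin scale scale scale \<Phi>" "x \<in> A"
  shows "(\<Sum>(a, b)\<leftarrow>D x. \<Sum>(c, d)\<leftarrow>D b. \<Sum>(p, q, r)\<leftarrow>\<phi>. \<Phi> (a * p) (c * q) (d * r)) =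
         (\<Sum>(p, q, r)\<leftarrow>\<phi>. \<Sum>(a, b)\<leftarrow>D x. \<Sum>(c, d)\<leftarrow>D a. \<Phi> (p * c) (q * d) (r * b))"
  using tensor3_eq_evaluate[OF quasi_coassoc[OF assms(2)] assms(1)]
  unfolding D_D[symmetric] by (simp add: D_eq[OF assms(2)] tensor3_mult_def tensor_sum_simps)

lemma phi_counit2:
  assumes "bilin scale scale G"
  shows "(\<Sum>(a, b, c)\<leftarrow>\<phi>. E b * G a c) = G 1 1"
proof -
  have hom: "G (scale c a) b = c * G a b" for c a b
    using assms by (simp add: bilin_def lin_def)
  have "(\<Sum>(a, b, c)\<leftarrow>\<phi>. E b * G a c) = (\<Sum>(a, b, c)\<leftarrow>\<phi>. \<epsilon> b * G a c)"
    by (rule sum_list_cong3) (simp add: E_eq phi_in)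
  with tensor2_eq_evaluate[OF associator_counit assms] show ?thesis
    by (simp add: tensor_sum_simps hom)
qed

lemma pentagon_sum:
  assumes "quadlin scale L"
  shows "(\<Sum>(a, b, c)\<leftarrow>\<phi>. \<Sum>(d, e)\<leftarrow>D c. \<Sum>(a', b', c')\<leftarrow>\<phi>. \<Sum>(d', e')\<leftarrow>D a'.
           L (a * d') (b * e') (d * b') (e * c')) =
         (\<Sum>(a, b, c)\<leftarrow>\<phi>. \<Sum>(a', b', c')\<leftarrow>\<phi>. \<Sum>(d, e)\<leftarrow>D b'. \<Sum>(a'', b'', c'')\<leftarrow>\<phi>.
           L (a' * a'') (a * d * b'') (b * e * c'') (c * c'))"
  using tensor4_eq_evaluate[OF pentagon assms]
  unfolding phi_D[symmetric] by (simp add: tensor4_mult_def tensor_sum_simps)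

end

section \<open>The pentagon and the antipode\<close>

context k_algebra begin

text \<open>
Fourfold tensors that no multilinear form distinguishes.  This is a congruence for the product, so the
factors of the pentagon can be cancelled as in a monoid.
\<close>

definition tensor4_equal :: "('a \<times> 'a \<times> 'a \<times> 'a) list \<Rightarrow> ('a \<times> 'a \<times> 'a \<times> 'a) list \<Rightarrow> bool" (infix "\<approx>" 50)
  where "X \<approx> Y \<longleftrightarrow> (\<forall>L. quadlin scale L \<longrightarrow> (\<Sum>(a, b, c, d)\<leftarrow>X. L a b c d) = (\<Sum>(a, b, c, d)\<leftarrow>Y. L a b c d))"

abbreviation tensor4_times (infixl "\<odot>" 70) where "X \<odot> Y \<equiv> tensor4_mult X Y"

lemma tensor4_equal_refl: "X \<approx> X"
  by (simp add: tensor4_equal_def)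

lemma tensor4_equal_sym: "X \<approx> Y \<Longrightarrow> Y \<approx> X"
  by (simp add: tensor4_equal_def)

lemma tensor4_equal_trans [trans]: "X \<approx> Y \<Longrightarrow> Y \<approx> Z \<Longrightarrow> X \<approx> Z"
  by (simp add: tensor4_equal_def)

lemma tensor4_sum_mult: "(\<Sum>(a, b, c, d)\<leftarrow>X \<odot> Y. L a b c d) =
    (\<Sum>(a, b, c, d)\<leftarrow>X. \<Sum>(a', b', c', d')\<leftarrow>Y. L (a * a') (b * b') (c * c') (d * d') :: 'k)"
  by (simp add: tensor4_mult_def tensor_sum_simps)

lemma tensor4_mult_cong:
  assumes "X \<approx> X'" "Y \<approx> Y'"
  shows "X \<odot> Y \<approx> X' \<odot> Y'"
  unfolding tensor4_equal_def
proof (intro allI impI)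
  fix L assume L: "quadlin scale L"
  have "quadlin scale (\<lambda>a b c d. \<Sum>(a', b', c', d')\<leftarrow>Y. L (a * a') (b * b') (c * c') (d * d'))"
    by (intro quadlinI lin_intros quadlinD[OF L])
  with assms(1) have "(\<Sum>(a, b, c, d)\<leftarrow>X \<odot> Y. L a b c d) = (\<Sum>(a, b, c, d)\<leftarrow>X' \<odot> Y. L a b c d)"
    unfolding tensor4_sum_mult by (simp add: tensor4_equal_def)
  also have "quadlin scale (\<lambda>a' b' c' d'. L (a * a') (b * b') (c * c') (d * d'))" for a b c d
    by (intro quadlinI lin_intros quadlinD[OF L])
  with assms(2) have "(\<Sum>(a, b, c, d)\<leftarrow>X' \<odot> Y. L a b c d) = (\<Sum>(a, b, c, d)\<leftarrow>X' \<odot> Y'. L a b c d)"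
    unfolding tensor4_sum_mult by (simp add: tensor4_equal_def)
  finally show "(\<Sum>(a, b, c, d)\<leftarrow>X \<odot> Y. L a b c d) = (\<Sum>(a, b, c, d)\<leftarrow>X' \<odot> Y'. L a b c d)" .
qed

lemma tensor4_mult_assoc: "X \<odot> Y \<odot> Z \<approx> X \<odot> (Y \<odot> Z)"
  by (simp add: tensor4_equal_def tensor4_sum_mult mult.assoc)

lemma tensor4_cancel:
  assumes "X \<approx> [(1, 1, 1, 1)]"
  shows "X \<odot> Y \<approx> Y" "Y \<odot> X \<approx> Y"
proof -
  have "[(1, 1, 1, 1)] \<odot> Y = Y" "Y \<odot> [(1, 1, 1, 1)] = Y"
    by (induction Y) (auto simp: tensor4_mult_def)
  with tensor4_mult_cong[OF assms tensor4_equal_refl, of Y] tensor4_mult_cong[OF tensor4_equal_refl assms, of Y]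
  show "X \<odot> Y \<approx> Y" "Y \<odot> X \<approx> Y" by simp_all
qed

end

context projected_quasibialgebra begin

text \<open>
The axioms only concern the middle factor of the associator.  Applying \<open>\<epsilon>\<close> to the second factor of the
pentagon removes all associators but two on the right and one on the left; the remaining two
are \<open>\<phi>\<close> and the contraction of \<open>\<phi>\<close> in the first factor, and \<open>\<phi>\<close> is cancelled by \<open>\<psi>\<close>.
\<close>

lemma phi_counit1:
  assumes G: "bilin scale scale G"
  shows "(\<Sum>(a, b, c)\<leftarrow>\<phi>. E a * G b c) = G 1 1"
proof -
  have red: "(\<Sum>(a, b, c)\<leftarrow>\<phi>. G3 a b c) = (\<Sum>(a, b, c)\<leftarrow>\<phi>. \<Sum>(a', b', c')\<leftarrow>\<phi>. E a * G3 a' (b * b') (c * c'))"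
    if G3: "trilin scale scale scale G3" for G3
  proof -
    let ?L = "\<lambda>a b c d. E b * G3 a c d"
    have L: "quadlin scale ?L"
      by (intro quadlinI lin_intros trilinD[OF G3] E_lin)
    have "(\<Sum>(a, b, c)\<leftarrow>\<phi>. \<Sum>(d, e)\<leftarrow>D c. \<Sum>(a', b', c')\<leftarrow>\<phi>. \<Sum>(d', e')\<leftarrow>D a'.
             ?L (a * d') (b * e') (d * b') (e * c')) =
          (\<Sum>(a, b, c)\<leftarrow>\<phi>. \<Sum>(d, e)\<leftarrow>D c. \<Sum>(a', b', c')\<leftarrow>\<phi>. E b * G3 (a * a') (d * b') (e * c'))"
    proof (intro sum_list_cong3 sum_list_cong2)
      fix a b c d e a' b' c' assume "(a, b, c) \<in> set \<phi>" "(a', b', c') \<in> set \<phi>"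
      then have "(\<Sum>(d', e')\<leftarrow>D a'. ?L (a * d') (b * e') (d * b') (e * c')) =
          (\<Sum>(d', e')\<leftarrow>D a'. E e' * (E b * G3 (a * d') (d * b') (e * c')))"
        by (intro sum_list_cong2) (simp add: E_mult phi_in D_in)
      also have "\<dots> = E b * G3 (a * a') (d * b') (e * c')"
        by (rule D_counit_right, intro lin_intros trilinD[OF G3], rule phi_in(1), fact)
      finally show "(\<Sum>(d', e')\<leftarrow>D a'. ?L (a * d') (b * e') (d * b') (e * c')) = E b * G3 (a * a') (d * b') (e * c')" .
    qed
    also have "\<dots> = (\<Sum>(a, b, c)\<leftarrow>\<phi>. E b * (\<Sum>(d, e)\<leftarrow>D c. \<Sum>(a', b', c')\<leftarrow>\<phi>. G3 (a * a') (d * b') (e * c')))"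
      by (simp add: sum_list_mult_const2 sum_list_mult_const3)
    also have "\<dots> = (\<Sum>(d, e)\<leftarrow>D 1. \<Sum>(a', b', c')\<leftarrow>\<phi>. G3 (1 * a') (d * b') (e * c'))"
      by (rule phi_counit2) (intro bilinI D_lin lin_intros trilinD[OF G3])
    also have "\<dots> = (\<Sum>(a', b', c')\<leftarrow>\<phi>. G3 a' b' c')"
      by (subst D_one) (auto intro!: bilinI lin_intros trilinD[OF G3])
    finally have lhs: "(\<Sum>(a, b, c)\<leftarrow>\<phi>. \<Sum>(d, e)\<leftarrow>D c. \<Sum>(a', b', c')\<leftarrow>\<phi>. \<Sum>(d', e')\<leftarrow>D a'.
             ?L (a * d') (b * e') (d * b') (e * c')) = (\<Sum>(a', b', c')\<leftarrow>\<phi>. G3 a' b' c')" .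
    have "(\<Sum>(a, b, c)\<leftarrow>\<phi>. \<Sum>(a', b', c')\<leftarrow>\<phi>. \<Sum>(d, e)\<leftarrow>D b'. \<Sum>(a'', b'', c'')\<leftarrow>\<phi>.
           ?L (a' * a'') (a * d * b'') (b * e * c'') (c * c')) =
        (\<Sum>(a, b, c)\<leftarrow>\<phi>. \<Sum>(a', b', c')\<leftarrow>\<phi>. E a * G3 a' (b * b') (c * c'))"
    proof (intro sum_list_cong3)
      fix a b c a' b' c' assume in\<phi>: "(a, b, c) \<in> set \<phi>" "(a', b', c') \<in> set \<phi>"
      have "(\<Sum>(d, e)\<leftarrow>D b'. \<Sum>(a'', b'', c'')\<leftarrow>\<phi>. ?L (a' * a'') (a * d * b'') (b * e * c'') (c * c')) =
          (\<Sum>(d, e)\<leftarrow>D b'. E d * (E a * (\<Sum>(a'', b'', c'')\<leftarrow>\<phi>. E b'' * G3 (a' * a'') (b * e * c'') (c * c'))))"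
        unfolding sum_list_mult_const3[symmetric]
        by (intro sum_list_cong2 sum_list_cong3) (use in\<phi> in \<open>simp add: E_mult phi_in D_in mult_in mult.assoc\<close>)
      also have "\<dots> = (\<Sum>(d, e)\<leftarrow>D b'. E d * (E a * G3 a' (b * e) (c * c')))"
        by (subst phi_counit2) (auto intro!: bilinI lin_intros trilinD[OF G3])
      also have "\<dots> = E a * G3 a' (b * b') (c * c')"
        by (rule D_counit_left, intro lin_intros trilinD[OF G3], rule phi_in(2), rule in\<phi>)
      finally show "(\<Sum>(d, e)\<leftarrow>D b'. \<Sum>(a'', b'', c'')\<leftarrow>\<phi>. ?L (a' * a'') (a * d * b'') (b * e * c'') (c * c')) =
          E a * G3 a' (b * b') (c * c')" .
    qed
    with lhs pentagon_sum[OF L] show ?thesis by simp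
  qed
  let ?G4 = "\<lambda>a b c. E a * G b c"
  have G4: "trilin scale scale scale ?G4"
    by (intro trilinI lin_intros bilinD[OF G] E_lin)
  \<comment> \<open>Evaluating at this form amounts to multiplying by the inverse of the associator on the right.\<close>
  let ?G3 = "\<lambda>a b c. \<Sum>(p, q, r)\<leftarrow>\<psi>. ?G4 (a * p) (b * q) (c * r)"
  have "G 1 1 = (\<Sum>(a, b, c)\<leftarrow>\<phi>. ?G3 a b c)"
    by (subst phi_psi(1)[OF G4]) (simp add: E_one)
  also have "\<dots> = (\<Sum>(a, b, c)\<leftarrow>\<phi>. \<Sum>(a', b', c')\<leftarrow>\<phi>. E a * ?G3 a' (b * b') (c * c'))"
    by (rule red) (intro trilinI lin_intros trilinD[OF G4])
  also have "\<dots> = (\<Sum>(a, b, c)\<leftarrow>\<phi>. E a * (\<Sum>(a', b', c')\<leftarrow>\<phi>. \<Sum>(p, q, r)\<leftarrow>\<psi>. ?G4 (a' * p) (b * (b' * q)) (c * (c' * r))))"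
    by (simp only: sum_list_mult_const3 mult.assoc)
  also have "\<dots> = (\<Sum>(a, b, c)\<leftarrow>\<phi>. E a * G b c)"
    by (subst phi_psi(1)) (auto intro!: trilinI lin_intros trilinD[OF G4] simp: E_one)
  finally show ?thesis by simp
qed

text \<open>
As in the previous lemma, now with \<open>\<epsilon>\<close> applied to the third factor of the pentagon.
\<close>

lemma phi_counit3:
  assumes G: "bilin scale scale G"
  shows "(\<Sum>(a, b, c)\<leftarrow>\<phi>. E c * G a b) = G 1 1"
proof -
  have red: "(\<Sum>(a, b, c)\<leftarrow>\<phi>. G3 a b c) = (\<Sum>(a, b, c)\<leftarrow>\<phi>. \<Sum>(a', b', c')\<leftarrow>\<phi>. E c' * G3 (a * a') (b * b') c)"
    if G3: "trilin scale scale scale G3" for G3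
  proof -
    let ?L = "\<lambda>a b c d. E c * G3 a b d"
    have L: "quadlin scale ?L"
      by (intro quadlinI lin_intros trilinD[OF G3] E_lin)
    have "(\<Sum>(a, b, c)\<leftarrow>\<phi>. \<Sum>(d, e)\<leftarrow>D c. \<Sum>(a', b', c')\<leftarrow>\<phi>. \<Sum>(d', e')\<leftarrow>D a'.
             ?L (a * d') (b * e') (d * b') (e * c')) =
          (\<Sum>(a, b, c)\<leftarrow>\<phi>. G3 a b c)"
    proof (intro sum_list_cong3)
      fix a b c assume in\<phi>: "(a, b, c) \<in> set \<phi>"
      have "(\<Sum>(d, e)\<leftarrow>D c. \<Sum>(a', b', c')\<leftarrow>\<phi>. \<Sum>(d', e')\<leftarrow>D a'. ?L (a * d') (b * e') (d * b') (e * c')) =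
          (\<Sum>(d, e)\<leftarrow>D c. E d * (\<Sum>(a', b', c')\<leftarrow>\<phi>. E b' * (\<Sum>(d', e')\<leftarrow>D a'. G3 (a * d') (b * e') (e * c'))))"
        unfolding sum_list_mult_const3[symmetric] sum_list_mult_const2[symmetric]
        by (intro sum_list_cong2 sum_list_cong3) (use in\<phi> in \<open>simp add: E_mult phi_in D_in mult.assoc\<close>)
      also have "\<dots> = (\<Sum>(d, e)\<leftarrow>D c. E d * (\<Sum>(d', e')\<leftarrow>D 1. G3 (a * d') (b * e') (e * 1)))"
        by (subst phi_counit2) (auto intro!: bilinI D_lin lin_intros trilinD[OF G3])
      also have "\<dots> = (\<Sum>(d, e)\<leftarrow>D c. E d * G3 a b e)"
        by (subst D_one) (auto intro!: bilinI lin_intros trilinD[OF G3])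
      also have "\<dots> = G3 a b c"
        by (rule D_counit_left, intro lin_intros trilinD[OF G3], rule phi_in(3), rule in\<phi>)
      finally show "(\<Sum>(d, e)\<leftarrow>D c. \<Sum>(a', b', c')\<leftarrow>\<phi>. \<Sum>(d', e')\<leftarrow>D a'. ?L (a * d') (b * e') (d * b') (e * c')) = G3 a b c" .
    qed
    moreover have "(\<Sum>(a, b, c)\<leftarrow>\<phi>. \<Sum>(a', b', c')\<leftarrow>\<phi>. \<Sum>(d, e)\<leftarrow>D b'. \<Sum>(a'', b'', c'')\<leftarrow>\<phi>.
           ?L (a' * a'') (a * d * b'') (b * e * c'') (c * c')) =
        (\<Sum>(a', b', c')\<leftarrow>\<phi>. \<Sum>(a'', b'', c'')\<leftarrow>\<phi>. E c'' * G3 (a' * a'') (b' * b'') c')"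
    proof -
      have "(\<Sum>(d, e)\<leftarrow>D b'. \<Sum>(a'', b'', c'')\<leftarrow>\<phi>. ?L (a' * a'') (a * d * b'') (b * e * c'') (c * c')) =
          E b * (\<Sum>(a'', b'', c'')\<leftarrow>\<phi>. E c'' * G3 (a' * a'') (a * b' * b'') (c * c'))"
        if in\<phi>: "(a, b, c) \<in> set \<phi>" "(a', b', c') \<in> set \<phi>" for a b c a' b' c'
      proof -
        have "(\<Sum>(d, e)\<leftarrow>D b'. \<Sum>(a'', b'', c'')\<leftarrow>\<phi>. ?L (a' * a'') (a * d * b'') (b * e * c'') (c * c')) =
          (\<Sum>(d, e)\<leftarrow>D b'. E e * (E b * (\<Sum>(a'', b'', c'')\<leftarrow>\<phi>. E c'' * G3 (a' * a'') (a * d * b'') (c * c'))))"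
          unfolding sum_list_mult_const3[symmetric]
          by (intro sum_list_cong2 sum_list_cong3) (use in\<phi> in \<open>simp add: E_mult phi_in D_in mult_in mult.assoc\<close>)
        also have "\<dots> = E b * (\<Sum>(a'', b'', c'')\<leftarrow>\<phi>. E c'' * G3 (a' * a'') (a * b' * b'') (c * c'))"
          by (rule D_counit_right, intro lin_intros trilinD[OF G3], rule phi_in(2), rule in\<phi>)
        finally show ?thesis .
      qed
      then have "(\<Sum>(a, b, c)\<leftarrow>\<phi>. \<Sum>(a', b', c')\<leftarrow>\<phi>. \<Sum>(d, e)\<leftarrow>D b'. \<Sum>(a'', b'', c'')\<leftarrow>\<phi>.
           ?L (a' * a'') (a * d * b'') (b * e * c'') (c * c')) =
         (\<Sum>(a, b, c)\<leftarrow>\<phi>. E b * (\<Sum>(a', b', c')\<leftarrow>\<phi>. \<Sum>(a'', b'', c'')\<leftarrow>\<phi>. E c'' * G3 (a' * a'') (a * b' * b'') (c * c')))"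
        unfolding sum_list_mult_const3[symmetric, of "E _"] by (intro sum_list_cong3)
      also have "\<dots> = (\<Sum>(a', b', c')\<leftarrow>\<phi>. \<Sum>(a'', b'', c'')\<leftarrow>\<phi>. E c'' * G3 (a' * a'') (1 * b' * b'') (1 * c'))"
        by (rule phi_counit2) (intro bilinI lin_intros trilinD[OF G3])
      finally show ?thesis by simp
    qed
    ultimately show ?thesis using pentagon_sum[OF L] by simp
  qed
  let ?G4 = "\<lambda>a b c. E c * G a b"
  have G4: "trilin scale scale scale ?G4"
    by (intro trilinI lin_intros bilinD[OF G] E_lin)
  let ?G3 = "\<lambda>a b c. \<Sum>(p, q, r)\<leftarrow>\<psi>. ?G4 (p * a) (q * b) (r * c)"
  have "G 1 1 = (\<Sum>(p, q, r)\<leftarrow>\<psi>. \<Sum>(a, b, c)\<leftarrow>\<phi>. ?G4 (p * a) (q * b) (r * c))"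
    by (subst phi_psi(2)[OF G4]) (simp add: E_one)
  also have "\<dots> = (\<Sum>(a, b, c)\<leftarrow>\<phi>. ?G3 a b c)"
    by (rule sum_list_swap33)
  also have "\<dots> = (\<Sum>(a, b, c)\<leftarrow>\<phi>. \<Sum>(a', b', c')\<leftarrow>\<phi>. E c' * ?G3 (a * a') (b * b') c)"
    by (rule red) (intro trilinI lin_intros trilinD[OF G4])
  also have "\<dots> = (\<Sum>(a', b', c')\<leftarrow>\<phi>. \<Sum>(a, b, c)\<leftarrow>\<phi>. E c' * ?G3 (a * a') (b * b') c)"
    by (rule sum_list_swap33)
  also have "\<dots> = (\<Sum>(a', b', c')\<leftarrow>\<phi>. E c' * (\<Sum>(p, q, r)\<leftarrow>\<psi>. \<Sum>(a, b, c)\<leftarrow>\<phi>. ?G4 (p * a * a') (q * b * b') (r * c)))"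
    by (intro sum_list_cong3, simp only: sum_list_mult_const3 mult.assoc, subst sum_list_swap33, rule refl)
  also have "\<dots> = (\<Sum>(a, b, c)\<leftarrow>\<phi>. E c * G a b)"
    by (subst phi_psi(2)) (auto intro!: trilinI lin_intros trilinD[OF G4] simp: E_one)
  finally show ?thesis by simp
qed

lemma psi_counit1:
  assumes G: "bilin scale scale G"
  shows "(\<Sum>(p, q, r)\<leftarrow>\<psi>. E p * G q r) = G 1 1"
proof -
  let ?G4 = "\<lambda>a b c. E a * G b c"
  have G4: "trilin scale scale scale ?G4"
    by (intro trilinI lin_intros bilinD[OF G] E_lin)
  have "G 1 1 = (\<Sum>(a, b, c)\<leftarrow>\<phi>. \<Sum>(p, q, r)\<leftarrow>\<psi>. ?G4 (a * p) (b * q) (c * r))"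
    by (subst phi_psi(1)[OF G4]) (simp add: E_one)
  also have "\<dots> = (\<Sum>(a, b, c)\<leftarrow>\<phi>. E a * (\<Sum>(p, q, r)\<leftarrow>\<psi>. E p * G (b * q) (c * r)))"
    unfolding sum_list_mult_const3[symmetric]
    by (intro sum_list_cong3) (simp add: E_mult phi_in psi_in mult.assoc)
  also have "\<dots> = (\<Sum>(p, q, r)\<leftarrow>\<psi>. E p * G q r)"
    by (subst phi_counit1) (auto intro!: bilinI lin_intros bilinD[OF G])
  finally show ?thesis by simp
qed

lemma psi_counit2:
  assumes G: "bilin scale scale G"
  shows "(\<Sum>(p, q, r)\<leftarrow>\<psi>. E q * G p r) = G 1 1"
proof -
  let ?G4 = "\<lambda>a b c. E b * G a c"
  have G4: "trilin scale scale scale ?G4"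
    by (intro trilinI lin_intros bilinD[OF G] E_lin)
  have "G 1 1 = (\<Sum>(a, b, c)\<leftarrow>\<phi>. \<Sum>(p, q, r)\<leftarrow>\<psi>. ?G4 (a * p) (b * q) (c * r))"
    by (subst phi_psi(1)[OF G4]) (simp add: E_one)
  also have "\<dots> = (\<Sum>(a, b, c)\<leftarrow>\<phi>. E b * (\<Sum>(p, q, r)\<leftarrow>\<psi>. E q * G (a * p) (c * r)))"
    unfolding sum_list_mult_const3[symmetric]
    by (intro sum_list_cong3) (simp add: E_mult phi_in psi_in mult.assoc)
  also have "\<dots> = (\<Sum>(p, q, r)\<leftarrow>\<psi>. E q * G p r)"
    by (subst phi_counit2) (auto intro!: bilinI lin_intros bilinD[OF G])
  finally show ?thesis by simp
qed

text \<open>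
The five factors of the pentagon arise from the associator by applying the comultiplication to one
tensor factor, or by adding a unit on one side.
\<close>

definition "split1 t = [(d, e, b, c). (a, b, c) \<leftarrow> t, (d, e) \<leftarrow> D a]"
definition "split2 t = [(a, d, e, c). (a, b, c) \<leftarrow> t, (d, e) \<leftarrow> D b]"
definition "split3 t = [(a, b, d, e). (a, b, c) \<leftarrow> t, (d, e) \<leftarrow> D c]"
definition pad_left :: "('a \<times> 'a \<times> 'a) list \<Rightarrow> ('a \<times> 'a \<times> 'a \<times> 'a) list" where
  "pad_left t = [(1, a, b, c). (a, b, c) \<leftarrow> t]"
definition pad_right :: "('a \<times> 'a \<times> 'a) list \<Rightarrow> ('a \<times> 'a \<times> 'a \<times> 'a) list" where
  "pad_right t = [(a, b, c, 1). (a, b, c) \<leftarrow> t]"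

lemma split_sums:
  fixes L :: "'a \<Rightarrow> 'a \<Rightarrow> 'a \<Rightarrow> 'a \<Rightarrow> 'k"
  shows "(\<Sum>(a, b, c, d)\<leftarrow>split1 t. L a b c d) = (\<Sum>(a, b, c)\<leftarrow>t. \<Sum>(d, e)\<leftarrow>D a. L d e b c)"
    "(\<Sum>(a, b, c, d)\<leftarrow>split2 t. L a b c d) = (\<Sum>(a, b, c)\<leftarrow>t. \<Sum>(d, e)\<leftarrow>D b. L a d e c)"
    "(\<Sum>(a, b, c, d)\<leftarrow>split3 t. L a b c d) = (\<Sum>(a, b, c)\<leftarrow>t. \<Sum>(d, e)\<leftarrow>D c. L a b d e)"
    "(\<Sum>(a, b, c, d)\<leftarrow>pad_left t. L a b c d) = (\<Sum>(a, b, c)\<leftarrow>t. L 1 a b c)"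
    "(\<Sum>(a, b, c, d)\<leftarrow>pad_right t. L a b c d) = (\<Sum>(a, b, c)\<leftarrow>t. L a b c 1)"
  by (simp_all add: split1_def split2_def split3_def pad_left_def pad_right_def tensor_sum_simps)

lemma pentagon_split: "split3 \<phi> \<odot> split1 \<phi> \<approx> pad_left \<phi> \<odot> split2 \<phi> \<odot> pad_right \<phi>"
  unfolding tensor4_equal_def tensor4_sum_mult split_sums by (auto dest: pentagon_sum)

lemma split_inverse:
  "split1 \<phi> \<odot> split1 \<psi> \<approx> [(1, 1, 1, 1)]"
  "split2 \<psi> \<odot> split2 \<phi> \<approx> [(1, 1, 1, 1)]"
  "pad_left \<psi> \<odot> pad_left \<phi> \<approx> [(1, 1, 1, 1)]"
proof -
  have "(\<Sum>(a, b, c, d)\<leftarrow>split1 \<phi> \<odot> split1 \<psi>. L a b c d) = L 1 1 1 1"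
    "(\<Sum>(a, b, c, d)\<leftarrow>split2 \<psi> \<odot> split2 \<phi>. L a b c d) = L 1 1 1 1"
    "(\<Sum>(a, b, c, d)\<leftarrow>pad_left \<psi> \<odot> pad_left \<phi>. L a b c d) = L 1 1 1 1"
    if L: "quadlin scale L" for L
  proof -
    have "(\<Sum>(a, b, c, d)\<leftarrow>split1 \<phi> \<odot> split1 \<psi>. L a b c d) =
        (\<Sum>(a, b, c)\<leftarrow>\<phi>. \<Sum>(p, q, r)\<leftarrow>\<psi>. \<Sum>(d, e)\<leftarrow>D a. \<Sum>(d', e')\<leftarrow>D p. L (d * d') (e * e') (b * q) (c * r))"
      unfolding tensor4_sum_mult split_sums by (intro sum_list_cong3 sum_list_swap23)
    also have "\<dots> = (\<Sum>(a, b, c)\<leftarrow>\<phi>. \<Sum>(p, q, r)\<leftarrow>\<psi>. \<Sum>(d, e)\<leftarrow>D (a * p). L d e (b * q) (c * r))"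
      by (intro sum_list_cong3, subst D_mult) (auto intro!: bilinI lin_intros quadlinD[OF L] elim: phi_in psi_in)
    also have "\<dots> = (\<Sum>(d, e)\<leftarrow>D 1. L d e 1 1)"
      by (subst phi_psi(1)) (auto intro!: trilinI D_lin bilinI lin_intros quadlinD[OF L])
    also have "\<dots> = L 1 1 1 1"
      by (rule D_one) (intro bilinI lin_intros quadlinD[OF L])
    finally show "(\<Sum>(a, b, c, d)\<leftarrow>split1 \<phi> \<odot> split1 \<psi>. L a b c d) = L 1 1 1 1" .
    have "(\<Sum>(a, b, c, d)\<leftarrow>split2 \<psi> \<odot> split2 \<phi>. L a b c d) =
        (\<Sum>(p, q, r)\<leftarrow>\<psi>. \<Sum>(a, b, c)\<leftarrow>\<phi>. \<Sum>(d, e)\<leftarrow>D q. \<Sum>(d', e')\<leftarrow>D b. L (p * a) (d * d') (e * e') (r * c))"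
      unfolding tensor4_sum_mult split_sums by (intro sum_list_cong3 sum_list_swap23)
    also have "\<dots> = (\<Sum>(p, q, r)\<leftarrow>\<psi>. \<Sum>(a, b, c)\<leftarrow>\<phi>. \<Sum>(d, e)\<leftarrow>D (q * b). L (p * a) d e (r * c))"
      by (intro sum_list_cong3, subst D_mult) (auto intro!: bilinI lin_intros quadlinD[OF L] elim: phi_in psi_in)
    also have "\<dots> = (\<Sum>(d, e)\<leftarrow>D 1. L 1 d e 1)"
      by (subst phi_psi(2)) (auto intro!: trilinI D_lin bilinI lin_intros quadlinD[OF L])
    also have "\<dots> = L 1 1 1 1"
      by (rule D_one) (intro bilinI lin_intros quadlinD[OF L])
    finally show "(\<Sum>(a, b, c, d)\<leftarrow>split2 \<psi> \<odot> split2 \<phi>. L a b c d) = L 1 1 1 1" .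
    have "(\<Sum>(a, b, c, d)\<leftarrow>pad_left \<psi> \<odot> pad_left \<phi>. L a b c d) =
        (\<Sum>(p, q, r)\<leftarrow>\<psi>. \<Sum>(a, b, c)\<leftarrow>\<phi>. L 1 (p * a) (q * b) (r * c))"
      unfolding tensor4_sum_mult split_sums by simp
    also have "\<dots> = L 1 1 1 1"
      by (rule phi_psi(2)) (intro trilinI lin_intros quadlinD[OF L])
    finally show "(\<Sum>(a, b, c, d)\<leftarrow>pad_left \<psi> \<odot> pad_left \<phi>. L a b c d) = L 1 1 1 1" .
  qed
  then show "split1 \<phi> \<odot> split1 \<psi> \<approx> [(1, 1, 1, 1)]" "split2 \<psi> \<odot> split2 \<phi> \<approx> [(1, 1, 1, 1)]"
    "pad_left \<psi> \<odot> pad_left \<phi> \<approx> [(1, 1, 1, 1)]"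
    by (simp_all add: tensor4_equal_def)
qed

text \<open>
Moving factors of the pentagon to the other side leaves products on the right-hand sides of this lemma and
of the next one in which every split factor can be contracted with the antipode.
\<close>

lemma pentagon_rotated: "pad_left \<psi> \<odot> split3 \<phi> \<approx> split2 \<phi> \<odot> (pad_right \<phi> \<odot> split1 \<psi>)"
proof -
  have "pad_left \<psi> \<odot> split3 \<phi> \<approx> (pad_left \<psi> \<odot> split3 \<phi>) \<odot> (split1 \<phi> \<odot> split1 \<psi>)"
    by (rule tensor4_equal_sym[OF tensor4_cancel(2)[OF split_inverse(1)]])
  also have "\<dots> \<approx> (pad_left \<psi> \<odot> (split3 \<phi> \<odot> split1 \<phi>)) \<odot> split1 \<psi>"
    by (simp add: tensor4_equal_def tensor4_sum_mult mult.assoc)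
  also have "\<dots> \<approx> (pad_left \<psi> \<odot> (pad_left \<phi> \<odot> split2 \<phi> \<odot> pad_right \<phi>)) \<odot> split1 \<psi>"
    by (intro tensor4_mult_cong tensor4_equal_refl pentagon_split)
  also have "\<dots> \<approx> (pad_left \<psi> \<odot> pad_left \<phi>) \<odot> (split2 \<phi> \<odot> (pad_right \<phi> \<odot> split1 \<psi>))"
    by (simp add: tensor4_equal_def tensor4_sum_mult mult.assoc)
  also have "\<dots> \<approx> split2 \<phi> \<odot> (pad_right \<phi> \<odot> split1 \<psi>)"
    by (rule tensor4_cancel(1)[OF split_inverse(3)])
  finally show ?thesis .
qed

lemma pentagon_rotated': "pad_right \<phi> \<odot> split1 \<psi> \<approx> split2 \<psi> \<odot> (pad_left \<psi> \<odot> split3 \<phi>)"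
proof -
  have "pad_right \<phi> \<odot> split1 \<psi> \<approx> (split2 \<psi> \<odot> split2 \<phi>) \<odot> (pad_right \<phi> \<odot> split1 \<psi>)"
    by (rule tensor4_equal_sym[OF tensor4_cancel(1)[OF split_inverse(2)]])
  also have "\<dots> \<approx> split2 \<psi> \<odot> (split2 \<phi> \<odot> (pad_right \<phi> \<odot> split1 \<psi>))"
    by (rule tensor4_mult_assoc)
  also have "\<dots> \<approx> split2 \<psi> \<odot> (pad_left \<psi> \<odot> split3 \<phi>)"
    by (intro tensor4_mult_cong tensor4_equal_refl tensor4_equal_sym[OF pentagon_rotated])
  finally show ?thesis .
qed

text \<open>
Contract \<open>a \<otimes> b \<otimes> c \<otimes> d\<close> to \<open>a \<beta> S(b) \<alpha> c \<otimes> d\<close> on both sides of the first rotated pentagon.  On the right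
the antipode axioms turn the two comultiplications into counits, and what survives is
\<open>\<phi>\<^sub>1 \<beta> S(\<phi>\<^sub>2) \<alpha> \<phi>\<^sub>3 = 1\<close>.
\<close>

lemma antipode_pentagon:
  assumes S: "lin scale scale S" and S_mult: "\<And>x y. x \<in> A \<Longrightarrow> y \<in> A \<Longrightarrow> S (x * y) = S y * S x"
    and alpha: "\<And>x l. x \<in> A \<Longrightarrow> lin scale (*) l \<Longrightarrow> (\<Sum>(a, b)\<leftarrow>D x. l (S a * \<alpha> * b)) = E x * l \<alpha>"
    and beta: "\<And>x l. x \<in> A \<Longrightarrow> lin scale (*) l \<Longrightarrow> (\<Sum>(a, b)\<leftarrow>D x. l (a * \<beta> * S b)) = E x * l \<beta>"
    and assoc: "\<And>l. lin scale (*) l \<Longrightarrow> (\<Sum>(a, b, c)\<leftarrow>\<phi>. l (a * \<beta> * S b * \<alpha> * c)) = l 1"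
    and \<Phi>: "bilin scale scale \<Phi>"
  shows "(\<Sum>(p, q, r)\<leftarrow>\<psi>. \<Sum>(a, b, c)\<leftarrow>\<phi>. \<Sum>(d, e)\<leftarrow>D c.
      \<Phi> (a * \<beta> * S b * (S p * \<alpha> * q * d)) (r * e)) = \<Phi> 1 1"
proof -
  let ?L = "\<lambda>a b c d. \<Phi> (a * \<beta> * S b * \<alpha> * c) d"
  have S': "lin r scale (\<lambda>x. S (g x))" if "lin r scale g" for r g
    using lin_compose[OF S that] .
  have L: "quadlin scale ?L"
    by (intro quadlinI lin_intros bilinD[OF \<Phi>] S')
  have "(\<Sum>(p, q, r)\<leftarrow>\<psi>. \<Sum>(a, b, c)\<leftarrow>\<phi>. \<Sum>(d, e)\<leftarrow>D c.
      \<Phi> (a * \<beta> * S b * (S p * \<alpha> * q * d)) (r * e)) = (\<Sum>(a, b, c, d)\<leftarrow>pad_left \<psi> \<odot> split3 \<phi>. ?L a b c d)"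
    unfolding tensor4_sum_mult split_sums
    by (intro sum_list_cong3 sum_list_cong2) (simp add: S_mult phi_in psi_in mult.assoc)
  also have "\<dots> = (\<Sum>(a, b, c, d)\<leftarrow>split2 \<phi> \<odot> (pad_right \<phi> \<odot> split1 \<psi>). ?L a b c d)"
    using pentagon_rotated L by (simp add: tensor4_equal_def)
  also have "\<dots> = (\<Sum>(a, b, c)\<leftarrow>\<phi>. \<Sum>(d, e)\<leftarrow>D b. \<Sum>(a', b', c')\<leftarrow>\<phi>. \<Sum>(p, q, r)\<leftarrow>\<psi>. \<Sum>(d', e')\<leftarrow>D p.
      \<Phi> (a * a' * (d' * \<beta> * S e') * (S b' * (S d * \<alpha> * e) * c' * q)) (c * r))"
    unfolding tensor4_sum_mult split_sums
    by (intro sum_list_cong3 sum_list_cong2) (simp add: S_mult phi_in psi_in D_in mult_in mult.assoc)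
  also have "\<dots> = (\<Sum>(a, b, c)\<leftarrow>\<phi>. \<Sum>(d, e)\<leftarrow>D b. \<Sum>(a', b', c')\<leftarrow>\<phi>. \<Sum>(p, q, r)\<leftarrow>\<psi>. E p *
      \<Phi> (a * a' * \<beta> * (S b' * (S d * \<alpha> * e) * c' * q)) (c * r))"
    by (intro sum_list_cong3 sum_list_cong2 beta) (auto intro!: lin_intros bilinD[OF \<Phi>] elim: psi_in)
  also have "\<dots> = (\<Sum>(a, b, c)\<leftarrow>\<phi>. \<Sum>(d, e)\<leftarrow>D b. \<Sum>(a', b', c')\<leftarrow>\<phi>.
      \<Phi> (a * a' * \<beta> * (S b' * (S d * \<alpha> * e) * c')) c)"
    by (intro sum_list_cong3 sum_list_cong2, subst psi_counit1) (auto intro!: bilinI lin_intros bilinD[OF \<Phi>])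
  also have "\<dots> = (\<Sum>(a, b, c)\<leftarrow>\<phi>. E b * (\<Sum>(a', b', c')\<leftarrow>\<phi>. \<Phi> (a * a' * \<beta> * (S b' * \<alpha> * c')) c))"
    by (intro sum_list_cong3 alpha) (auto intro!: lin_intros bilinD[OF \<Phi>] elim: phi_in)
  also have "\<dots> = (\<Sum>(a', b', c')\<leftarrow>\<phi>. \<Phi> (1 * (a' * \<beta> * S b' * \<alpha> * c')) 1)"
    by (subst phi_counit2) (auto intro!: bilinI lin_intros bilinD[OF \<Phi>] simp: mult.assoc)
  also have "\<dots> = \<Phi> 1 1"
    by (subst assoc) (auto intro!: lin_intros bilinD[OF \<Phi>])
  finally show ?thesis .
qed

text \<open>
The counterpart of the previous identity for the opposite comultiplication, whose antipode is the inverse antipode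
\<open>T\<close>: contract
\<open>a \<otimes> b \<otimes> c \<otimes> d\<close> to \<open>a \<otimes> d \<beta> T(c) \<gamma> b\<close> in the second rotated pentagon.
\<close>

lemma inverse_antipode_pentagon:
  assumes T: "lin scale scale T" and T_mult: "\<And>x y. x \<in> A \<Longrightarrow> y \<in> A \<Longrightarrow> T (x * y) = T y * T x"
    and gamma: "\<And>x l. x \<in> A \<Longrightarrow> lin scale (*) l \<Longrightarrow> (\<Sum>(a, b)\<leftarrow>D x. l (T b * \<gamma> * a)) = E x * l \<gamma>"
    and beta: "\<And>x l. x \<in> A \<Longrightarrow> lin scale (*) l \<Longrightarrow> (\<Sum>(a, b)\<leftarrow>D x. l (b * \<beta> * T a)) = E x * l \<beta>"
    and assoc: "\<And>l. lin scale (*) l \<Longrightarrow> (\<Sum>(p, q, r)\<leftarrow>\<psi>. l (r * \<beta> * T q * \<gamma> * p)) = l 1"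
    and \<Phi>: "bilin scale scale \<Phi>"
  shows "(\<Sum>(a, b, c)\<leftarrow>\<phi>. \<Sum>(p, q, r)\<leftarrow>\<psi>. \<Sum>(d, e)\<leftarrow>D p.
      \<Phi> (a * d) (r * \<beta> * T q * T c * \<gamma> * b * e)) = \<Phi> 1 1"
proof -
  let ?L = "\<lambda>a b c d. \<Phi> a (d * \<beta> * T c * \<gamma> * b)"
  have T': "lin r scale (\<lambda>x. T (g x))" if "lin r scale g" for r g
    using lin_compose[OF T that] .
  have L: "quadlin scale ?L"
    by (intro quadlinI lin_intros bilinD[OF \<Phi>] T')
  have "(\<Sum>(a, b, c)\<leftarrow>\<phi>. \<Sum>(p, q, r)\<leftarrow>\<psi>. \<Sum>(d, e)\<leftarrow>D p.
      \<Phi> (a * d) (r * \<beta> * T q * T c * \<gamma> * b * e)) = (\<Sum>(a, b, c, d)\<leftarrow>pad_right \<phi> \<odot> split1 \<psi>. ?L a b c d)"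
    unfolding tensor4_sum_mult split_sums
    by (intro sum_list_cong3 sum_list_cong2) (simp add: T_mult phi_in psi_in mult.assoc)
  also have "\<dots> = (\<Sum>(a, b, c, d)\<leftarrow>split2 \<psi> \<odot> (pad_left \<psi> \<odot> split3 \<phi>). ?L a b c d)"
    using pentagon_rotated' L by (simp add: tensor4_equal_def)
  also have "\<dots> = (\<Sum>(p, q, r)\<leftarrow>\<psi>. \<Sum>(d, e)\<leftarrow>D q. \<Sum>(p', q', r')\<leftarrow>\<psi>. \<Sum>(a, b, c)\<leftarrow>\<phi>. \<Sum>(d', e')\<leftarrow>D c.
      \<Phi> (p * a) (r * r' * (e' * \<beta> * T d') * (T q' * (T e * \<gamma> * d) * p' * b)))"
    unfolding tensor4_sum_mult split_sums
    by (intro sum_list_cong3 sum_list_cong2) (simp add: T_mult phi_in psi_in D_in mult_in mult.assoc)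
  also have "\<dots> = (\<Sum>(p, q, r)\<leftarrow>\<psi>. \<Sum>(d, e)\<leftarrow>D q. \<Sum>(p', q', r')\<leftarrow>\<psi>. \<Sum>(a, b, c)\<leftarrow>\<phi>. E c *
      \<Phi> (p * a) (r * r' * \<beta> * (T q' * (T e * \<gamma> * d) * p' * b)))"
    by (intro sum_list_cong3 sum_list_cong2 beta) (auto intro!: lin_intros bilinD[OF \<Phi>] elim: phi_in)
  also have "\<dots> = (\<Sum>(p, q, r)\<leftarrow>\<psi>. \<Sum>(d, e)\<leftarrow>D q. \<Sum>(p', q', r')\<leftarrow>\<psi>.
      \<Phi> p (r * r' * \<beta> * (T q' * (T e * \<gamma> * d) * p')))"
    by (intro sum_list_cong3 sum_list_cong2, subst phi_counit3) (auto intro!: bilinI lin_intros bilinD[OF \<Phi>])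
  also have "\<dots> = (\<Sum>(p, q, r)\<leftarrow>\<psi>. E q * (\<Sum>(p', q', r')\<leftarrow>\<psi>. \<Phi> p (r * r' * \<beta> * (T q' * \<gamma> * p'))))"
    by (intro sum_list_cong3 gamma) (auto intro!: lin_intros bilinD[OF \<Phi>] elim: psi_in)
  also have "\<dots> = (\<Sum>(p', q', r')\<leftarrow>\<psi>. \<Phi> 1 (1 * (r' * \<beta> * T q' * \<gamma> * p')))"
    by (subst psi_counit2) (auto intro!: bilinI lin_intros bilinD[OF \<Phi>] simp: mult.assoc)
  also have "\<dots> = \<Phi> 1 1"
    by (subst assoc) (auto intro!: lin_intros bilinD[OF \<Phi>])
  finally show ?thesis .
qed

end

section \<open>Linear algebra\<close>

definition function_scale :: "'k::field \<Rightarrow> ('z \<Rightarrow> 'k) \<Rightarrow> 'z \<Rightarrow> 'k" where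
  "function_scale c f = (\<lambda>z. c * f z)"

lemma function_vector_space: "vector_space (function_scale :: 'k::field \<Rightarrow> ('z \<Rightarrow> 'k) \<Rightarrow> 'z \<Rightarrow> 'k)"
  by unfold_locales (auto simp: function_scale_def algebra_simps)

global_interpretation function_space: vector_space "function_scale :: 'k::field \<Rightarrow> ('z \<Rightarrow> 'k) \<Rightarrow> 'z \<Rightarrow> 'k"
  by (rule function_vector_space)

lemma sum_fun_apply: "sum f I z = (\<Sum>i\<in>I. f i z :: 'b::comm_monoid_add)"
  by (induction I rule: infinite_finite_induct) auto

lemma lin_sum_scaled: "lin s (*) l \<Longrightarrow> l (\<Sum>z\<in>I. s (c z) (f z)) = (\<Sum>z\<in>I. c z * l (f z))"
  by (simp add: lin_sum linD(2))

text \<open>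
The dimension estimates for spaces of homomorphisms rest on this one: a homogeneous linear system with
only the trivial solution has at least as many equations as unknowns.
\<close>

lemma injective_matrix_card_le:
  fixes A :: "'j \<Rightarrow> 'i \<Rightarrow> 'k::field"
  assumes "finite I" "finite J"
    and inj: "\<And>c. (\<And>j. j \<in> J \<Longrightarrow> (\<Sum>i\<in>I. A j i * c i) = 0) \<Longrightarrow> (\<And>i. i \<in> I \<Longrightarrow> c i = 0)"
  shows "card I \<le> card J"
proof -
  let ?g = "\<lambda>i j. if j \<in> J then A j i else 0"
  let ?u = "\<lambda>j j'. if j' = j then 1 else 0 :: 'k"
  have zero: "\<forall>i\<in>I. c i = 0" if c: "(\<Sum>i\<in>I. function_scale (c i) (?g i)) = 0" for c
  proof
    fix i assume "i \<in> I"
    moreover have "(\<Sum>i\<in>I. A j i * c i) = 0" if "j \<in> J" for j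
    proof -
      have "(\<Sum>i\<in>I. function_scale (c i) (?g i)) j = 0" using c by simp
      then show ?thesis using that by (simp add: sum_fun_apply function_scale_def mult.commute)
    qed
    ultimately show "c i = 0" using inj by blast
  qed
  have inj_g: "inj_on ?g I"
  proof (rule inj_onI, rule ccontr)
    fix i i' assume ii: "i \<in> I" "i' \<in> I" "?g i = ?g i'" "i \<noteq> i'"
    let ?c = "\<lambda>l. if l = i then 1 else if l = i' then - 1 else 0 :: 'k"
    have "(\<Sum>l\<in>I. function_scale (?c l) (?g l)) = (\<Sum>l\<in>{i, i'}. function_scale (?c l) (?g l))"
      using ii assms(1) by (intro sum.mono_neutral_right) (auto simp: function_scale_def fun_eq_iff)
    also have "\<dots> = 0" using ii(3,4) by (auto simp: function_scale_def fun_eq_iff)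
    finally show False using zero[of ?c] ii(1) by auto
  qed
  have "function_space.independent (?g ` I)"
    unfolding function_space.dependent_finite[OF finite_imageI[OF assms(1)]]
  proof safe
    fix u i assume "(\<Sum>v\<in>?g ` I. function_scale (u v) v) = 0" and i: "i \<in> I" "u (?g i) \<noteq> 0"
    then have "(\<Sum>i\<in>I. function_scale (u (?g i)) (?g i)) = 0"
      by (simp add: sum.reindex[OF inj_g])
    from zero[OF this] i show False by simp
  qed
  moreover have "?g ` I \<subseteq> function_space.span (?u ` J)"
  proof
    fix f assume "f \<in> ?g ` I"
    then obtain i where i: "i \<in> I" "f = ?g i" by auto
    have "(\<Sum>j\<in>J. function_scale (A j i) (?u j)) = ?g i"
      using assms(2) by (auto simp: fun_eq_iff sum_fun_apply function_scale_def sum.delta if_distrib cong: if_cong)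
    moreover have "(\<Sum>j\<in>J. function_scale (A j i) (?u j)) \<in> function_space.span (?u ` J)"
      by (intro function_space.span_sum function_space.span_scale function_space.span_base) simp
    ultimately show "f \<in> function_space.span (?u ` J)" using i by simp
  qed
  ultimately have "card (?g ` I) \<le> card (?u ` J)"
    using function_space.independent_span_bound assms(2) by blast
  also have "\<dots> \<le> card J" by (rule card_image_le[OF assms(2)])
  finally show ?thesis by (simp add: card_image[OF inj_g])
qed

context vector_space begin

text \<open>
The coordinate forms \<open>v\<close> come from an extension of the basis \<open>e\<close> to the whole space, so they are linear
everywhere and can be composed with other linear maps without side conditions.
\<close>

lemma adapted_basis:
  assumes V: "subspace V" and W: "subspace W" "W \<subseteq> V" and fin: "finite F" "V \<subseteq> span F"
  obtains e v where "dim W \<le> dim V"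
    "\<And>j. j < dim V \<Longrightarrow> e j \<in> V" "\<And>j. j < dim W \<Longrightarrow> e j \<in> W"
    "\<And>j. lin scale (*) (v j)"
    "\<And>i j. i < dim V \<Longrightarrow> j < dim V \<Longrightarrow> v i (e j) = (if i = j then 1 else 0)"
    "\<And>x. x \<in> V \<Longrightarrow> x = (\<Sum>j<dim V. scale (v j x) (e j))"
    "\<And>x j. x \<in> W \<Longrightarrow> dim W \<le> j \<Longrightarrow> j < dim V \<Longrightarrow> v j x = 0"
proof -
  obtain B' where B': "B' \<subseteq> W" "independent B'" "W \<subseteq> span B'" "card B' = dim W"
    using basis_exists[of W] by blast
  obtain B where B: "B' \<subseteq> B" "B \<subseteq> V" "independent B" "V \<subseteq> span B"
    using maximal_independent_subset_extend[of B' V] B' W by blast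
  have finB: "finite B" using independent_span_bound[OF fin(1) B(3)] B(2) fin(2) by blast
  then have finB': "finite B'" using B(1) finite_subset by blast
  have cardB: "card B = dim V" using basis_card_eq_dim[OF B(2) B(4) B(3)] .
  let ?d = "dim W" and ?n = "dim V"
  have le: "?d \<le> ?n" using card_mono[OF finB B(1)] B'(4) cardB by simp
  obtain f where f: "bij_betw f {0..<?d} B'"
    using ex_bij_betw_nat_finite[OF finB'] B'(4) by auto
  have "card (B - B') = ?n - ?d" using card_Diff_subset[OF finB' B(1)] B'(4) cardB by simp
  then obtain g where g: "bij_betw g {0..<?n - ?d} (B - B')"
    using ex_bij_betw_nat_finite[of "B - B'"] finB by auto
  define e where "e j = (if j < ?d then f j else g (j - ?d))" for j
  have e1: "bij_betw e {0..<?d} B'"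
    using f by (rule bij_betw_cong[THEN iffD1, rotated]) (simp add: e_def)
  have sh: "bij_betw (\<lambda>j. j - ?d) {?d..<?n} {0..<?n - ?d}"
    by (rule bij_betw_byWitness[where f' = "\<lambda>j. j + ?d"]) auto
  have e2: "bij_betw e {?d..<?n} (B - B')"
    using bij_betw_trans[OF sh g] by (rule bij_betw_cong[THEN iffD1, rotated]) (simp add: e_def)
  have e: "bij_betw e {0..<?n} B"
  proof -
    have "bij_betw e ({0..<?d} \<union> {?d..<?n}) (B' \<union> (B - B'))"
      by (rule bij_betw_combine[OF e1 e2]) auto
    moreover have "{0..<?d} \<union> {?d..<?n} = {0..<?n}" using le by auto
    ultimately show ?thesis using B(1) by (simp add: Un_absorb1)
  qed
  define X where "X = extend_basis B"
  have X: "independent X" "span X = UNIV" "B \<subseteq> X"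
    using independent_extend_basis[OF B(3)] span_extend_basis[OF B(3)] extend_basis_superset[OF B(3)]
    by (auto simp: X_def)
  define v where "v j x = representation X x (e j)" for j x
  have v: "lin scale (*) (v j)" for j
    using X(2) by (simp add: lin_def v_def representation_add[OF X(1)] representation_scale[OF X(1)])
  have ve: "v i (e j) = (if i = j then 1 else 0)" if "i < ?n" "j < ?n" for i j
  proof -
    have "e j \<in> X" using e that X(3) by (auto simp: bij_betw_def)
    then have "v i (e j) = (if e j = e i then 1 else 0)"
      by (simp add: v_def representation_basis[OF X(1)])
    also have "e j = e i \<longleftrightarrow> i = j"
      using e that by (auto simp: bij_betw_def inj_on_def)
    finally show ?thesis .
  qed
  have expand: "v j (\<Sum>i<?n. scale (c i) (e i)) = c j" if "j < ?n" for c j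
    using that by (simp add: lin_sum[OF v] linD[OF v] ve sum.delta if_distrib cong: if_cong)
  have in_span: "\<exists>c. x = (\<Sum>i<?n. scale (c i) (e i))" if "x \<in> V" for x
  proof -
    have "x \<in> span B" using that B(4) by auto
    then obtain u where "x = (\<Sum>b\<in>B. scale (u b) b)" by (auto simp: span_finite[OF finB])
    also have "\<dots> = (\<Sum>i<?n. scale (u (e i)) (e i))"
      using sum.reindex_bij_betw[OF e, of "\<lambda>b. scale (u b) b"] by (simp add: atLeast0LessThan)
    finally show ?thesis by (rule exI[of _ "\<lambda>i. u (e i)"])
  qed
  show ?thesis
  proof
    show "?d \<le> ?n" by (rule le)
    show "e j \<in> V" if "j < ?n" for j using e B(2) that by (auto simp: bij_betw_def)
    show "e j \<in> W" if "j < ?d" for j using e1 B'(1) that by (auto simp: bij_betw_def)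
    show "lin scale (*) (v j)" for j by (rule v)
    show "v i (e j) = (if i = j then 1 else 0)" if "i < ?n" "j < ?n" for i j using that by (rule ve)
    show "x = (\<Sum>j<?n. scale (v j x) (e j))" if "x \<in> V" for x
    proof -
      obtain c where c: "x = (\<Sum>i<?n. scale (c i) (e i))" using in_span[OF \<open>x \<in> V\<close>] ..
      then have "v j x = c j" if "j < ?n" for j using expand[OF that] by simp
      with c show ?thesis by simp
    qed
    show "v j x = 0" if "x \<in> W" "?d \<le> j" "j < ?n" for x j
    proof -
      have "x \<in> span B'" using that B'(3) by auto
      then obtain u where "x = (\<Sum>b\<in>B'. scale (u b) b)" by (auto simp: span_finite[OF finB'])
      also have "\<dots> = (\<Sum>i<?d. scale (u (e i)) (e i))"
        using sum.reindex_bij_betw[OF e1, of "\<lambda>b. scale (u b) b"] by (simp add: atLeast0LessThan)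
      finally have "v j x = (\<Sum>i<?d. u (e i) * v j (e i))"
        by (simp add: lin_sum[OF v] linD[OF v])
      also have "\<dots> = 0" using that le by (intro sum.neutral) (auto simp: ve)
      finally show ?thesis .
    qed
  qed
qed

lemma basis_of_subspace:
  assumes V: "subspace V" and fin: "finite F" "V \<subseteq> span F"
  obtains e v where
    "\<And>j. j < dim V \<Longrightarrow> e j \<in> V"
    "\<And>j. lin scale (*) (v j)"
    "\<And>i j. i < dim V \<Longrightarrow> j < dim V \<Longrightarrow> v i (e j) = (if i = j then 1 else 0)"
    "\<And>x. x \<in> V \<Longrightarrow> x = (\<Sum>j<dim V. scale (v j x) (e j))"
proof -
  have zero: "{0} \<subseteq> V" using subspace_0[OF V] by simp
  show ?thesis
    by (rule adapted_basis[OF V subspace_single_0 zero fin], rule that)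
qed

lemma independent_family_card_le:
  assumes V: "subspace V" and fin: "finite F" "V \<subseteq> span F"
    and I: "finite I" and f: "\<And>i. i \<in> I \<Longrightarrow> f i \<in> V"
    and indep: "\<And>c i. (\<Sum>i\<in>I. scale (c i) (f i)) = 0 \<Longrightarrow> i \<in> I \<Longrightarrow> c i = 0"
  shows "card I \<le> dim V"
proof -
  obtain e v where v: "\<And>j. lin scale (*) (v j)"
    and x_eq: "\<And>x. x \<in> V \<Longrightarrow> x = (\<Sum>j<dim V. scale (v j x) (e j))"
    by (rule basis_of_subspace[OF V fin], rule that)
  have "card I \<le> card {..<dim V}"
  proof (rule injective_matrix_card_le[where A = "\<lambda>j i. v j (f i)"])
    fix c i assume rows: "\<And>j. j \<in> {..<dim V} \<Longrightarrow> (\<Sum>i\<in>I. v j (f i) * c i) = 0" and i: "i \<in> I"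
    let ?s = "\<Sum>i\<in>I. scale (c i) (f i)"
    have "?s \<in> V" by (intro subspace_sum[OF V] subspace_scale[OF V] f)
    moreover have "(\<Sum>j<dim V. scale (v j ?s) (e j)) = 0"
      using rows by (intro sum.neutral) (simp add: lin_sum_scaled[OF v] mult.commute)
    ultimately have "?s = 0" using x_eq by metis
    then show "c i = 0" by (rule indep[OF _ i])
  qed (use I in auto)
  then show ?thesis by simp
qed

text \<open>
Function spaces are infinite-dimensional in general; spaces of homomorphisms are recognized as
finite-dimensional, with a bound on the dimension, by finitely many forms that separate their elements.
\<close>

lemma finite_dimensional_of_separating_forms:
  assumes V: "subspace V" and J: "finite J" and l: "\<And>j. j \<in> J \<Longrightarrow> lin scale (*) (l j)"
    and sep: "\<And>x. x \<in> V \<Longrightarrow> (\<And>j. j \<in> J \<Longrightarrow> l j x = 0) \<Longrightarrow> x = 0"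
  obtains F where "finite F" "V \<subseteq> span F" "dim V \<le> card J"
proof -
  have bound: "card I \<le> card J" if I: "finite I" "I \<subseteq> V" "independent I" for I
  proof (rule injective_matrix_card_le[OF I(1) J, of l])
    fix c i assume z: "\<And>j. j \<in> J \<Longrightarrow> (\<Sum>i\<in>I. l j i * c i) = 0" and i: "i \<in> I"
    have "(\<Sum>i\<in>I. scale (c i) i) = 0"
    proof (rule sep)
      show "(\<Sum>i\<in>I. scale (c i) i) \<in> V"
        using I(2) by (intro subspace_sum[OF V] subspace_scale[OF V]) auto
      show "l j (\<Sum>i\<in>I. scale (c i) i) = 0" if "j \<in> J" for j
        using z[OF that] by (simp add: lin_sum[OF l[OF that]] linD[OF l[OF that]] mult.commute)
    qed
    with I i show "c i = 0" using independentD[of I I c i] by auto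
  qed
  obtain B where B: "B \<subseteq> V" "independent B" "V \<subseteq> span B" "card B = dim V"
    using basis_exists by blast
  have "finite B"
  proof (rule ccontr)
    assume "infinite B"
    then obtain I where "I \<subseteq> B" "finite I" "card I = Suc (card J)"
      using infinite_arbitrarily_large by blast
    with bound[of I] B(1) independent_mono[OF B(2)] show False by auto
  qed
  with bound[of B] B that[of B] show ?thesis by auto
qed

end

section \<open>Matrix representations and homomorphisms into them\<close>

text \<open>
Finite-dimensional modules are given by matrices, so that modules of all dimensions live in one type and a
supremum over all of them makes sense.  The result is \<open>0\<close> beyond the size \<open>p\<close>, which makes the associative law an
equality of functions.
\<close>

definition mat_act :: "nat \<Rightarrow> ('a \<Rightarrow> nat \<Rightarrow> nat \<Rightarrow> 'k::field) \<Rightarrow> 'a \<Rightarrow> (nat \<Rightarrow> 'k) \<Rightarrow> nat \<Rightarrow> 'k" where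
  "mat_act p \<sigma> x w i = (if i < p then \<Sum>j<p. \<sigma> x i j * w j else 0)"

lemma mat_act_add: "mat_act p \<sigma> x (\<lambda>j. f j + g j) i = mat_act p \<sigma> x f i + mat_act p \<sigma> x g i"
  by (simp add: mat_act_def sum.distrib distrib_left)

lemma mat_act_sum_list: "mat_act p \<sigma> x (\<lambda>j. \<Sum>z\<leftarrow>zs. f z j) i = (\<Sum>z\<leftarrow>zs. mat_act p \<sigma> x (f z) i)"
  by (induction zs) (simp_all add: mat_act_add, simp add: mat_act_def)

lemma mat_act_sum_list2: "mat_act p \<sigma> x (\<lambda>j. \<Sum>(a, b)\<leftarrow>zs. f a b j) i = (\<Sum>(a, b)\<leftarrow>zs. mat_act p \<sigma> x (f a b) i)"
  using mat_act_sum_list[of p \<sigma> x "\<lambda>(a, b). f a b" zs i] by (simp add: case_prod_unfold)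

lemma mat_act_sum_list3: "mat_act p \<sigma> x (\<lambda>j. \<Sum>(a, b, c)\<leftarrow>zs. f a b c j) i = (\<Sum>(a, b, c)\<leftarrow>zs. mat_act p \<sigma> x (f a b c) i)"
  using mat_act_sum_list[of p \<sigma> x "\<lambda>(a, b, c). f a b c" zs i] by (simp add: case_prod_unfold)

lemma mat_act_zero: "(\<And>j. j < p \<Longrightarrow> w j = 0) \<Longrightarrow> mat_act p \<sigma> x w i = 0"
  by (simp add: mat_act_def)

lemma mat_act_cong: "(\<And>j. j < p \<Longrightarrow> w j = w' j) \<Longrightarrow> mat_act p \<sigma> x w i = mat_act p \<sigma> x w' i"
  by (simp add: mat_act_def)

lemma mat_act_scale: "mat_act p \<sigma> x (\<lambda>j. c * f j) i = c * mat_act p \<sigma> x f i"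
  by (simp add: mat_act_def sum_distrib_left algebra_simps)

lemma mat_act_sum: "mat_act p \<sigma> x (\<lambda>j. \<Sum>z\<in>I. f z j) i = (\<Sum>z\<in>I. mat_act p \<sigma> x (f z) i)"
proof (cases "i < p")
  case True
  then show ?thesis by (simp add: mat_act_def sum_distrib_left) (rule sum.swap)
qed (simp add: mat_act_def)

context k_algebra begin

text \<open>
As for the comultiplication, the matrix entries are linear on the whole algebra but multiplicative
only on \<open>K\<close>.
\<close>

definition representation_of :: "'a set \<Rightarrow> nat \<Rightarrow> ('a \<Rightarrow> nat \<Rightarrow> nat \<Rightarrow> 'k) \<Rightarrow> bool" where
  "representation_of K p \<sigma> \<longleftrightarrow> (\<forall>i j. lin scale (*) (\<lambda>x. \<sigma> x i j)) \<and>
     (\<forall>i<p. \<forall>j<p. \<sigma> 1 i j = (if i = j then 1 else 0)) \<and>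
     (\<forall>x\<in>K. \<forall>y\<in>K. \<forall>i<p. \<forall>j<p. \<sigma> (x * y) i j = (\<Sum>l<p. \<sigma> x i l * \<sigma> y l j))"

lemma mat_act_lin:
  assumes "representation_of K p \<sigma>" "lin r scale g"
  shows "lin r (*) (\<lambda>x. mat_act p \<sigma> (g x) w i)"
proof -
  have "lin r (*) (\<lambda>x. \<sigma> (g x) i j)" for j
    using assms by (auto simp: representation_of_def intro: lin_compose[of scale "(*)"])
  then show ?thesis
    unfolding mat_act_def by (cases "i < p") (auto intro!: lin_form_intros, simp add: lin_def)
qed

lemma mat_act_lin_vector:
  assumes "\<And>j. lin r (*) (\<lambda>x. f x j)"
  shows "lin r (*) (\<lambda>x. mat_act p \<sigma> a (f x) i)"
  unfolding mat_act_def by (cases "i < p") (auto intro!: lin_form_intros assms, simp add: lin_def)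

lemma mat_act_mult:
  assumes "representation_of K p \<sigma>" "x \<in> K" "y \<in> K"
  shows "mat_act p \<sigma> (x * y) w = mat_act p \<sigma> x (mat_act p \<sigma> y w)"
proof
  fix i
  show "mat_act p \<sigma> (x * y) w i = mat_act p \<sigma> x (mat_act p \<sigma> y w) i"
  proof (cases "i < p")
    case True
    then have "mat_act p \<sigma> (x * y) w i = (\<Sum>j<p. \<Sum>l<p. \<sigma> x i l * \<sigma> y l j * w j)"
      using assms by (simp add: mat_act_def representation_of_def sum_distrib_right)
    also have "\<dots> = (\<Sum>l<p. \<Sum>j<p. \<sigma> x i l * \<sigma> y l j * w j)" by (rule sum.swap)
    also have "\<dots> = mat_act p \<sigma> x (mat_act p \<sigma> y w) i"
      using True by (simp add: mat_act_def sum_distrib_left mult.assoc)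
    finally show ?thesis .
  qed (simp add: mat_act_def)
qed

lemma mat_act_one: "representation_of K p \<sigma> \<Longrightarrow> i < p \<Longrightarrow> mat_act p \<sigma> 1 w i = w i"
  by (simp add: mat_act_def representation_of_def if_distrib[of "\<lambda>x. x * _"] sum.delta cong: if_cong)

end

text \<open>
A homomorphism is given by its coordinate functions: \<open>f (m, i)\<close> is the \<open>i\<close>-th coordinate of the image of \<open>m\<close>.  It
is \<open>0\<close> where it is meaningless, so that different functions are different homomorphisms.
\<close>

definition homs :: "'a set \<Rightarrow> 'm set \<Rightarrow> ('k::field \<Rightarrow> 'm::ab_group_add \<Rightarrow> 'm) \<Rightarrow> ('a \<Rightarrow> 'm \<Rightarrow> 'm) \<Rightarrow> nat \<Rightarrow>
    ('a \<Rightarrow> nat \<Rightarrow> nat \<Rightarrow> 'k) \<Rightarrow> ('m \<times> nat \<Rightarrow> 'k) set" where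
  "homs K U t act p \<sigma> = {f. (\<forall>m i. m \<notin> U \<or> \<not> i < p \<longrightarrow> f (m, i) = 0) \<and>
     (\<forall>m\<in>U. \<forall>m'\<in>U. \<forall>i. f (m + m', i) = f (m, i) + f (m', i)) \<and>
     (\<forall>c. \<forall>m\<in>U. \<forall>i. f (t c m, i) = c * f (m, i)) \<and>
     (\<forall>x\<in>K. \<forall>m\<in>U. \<forall>i<p. f (act x m, i) = mat_act p \<sigma> x (\<lambda>j. f (m, j)) i)}"

definition hom_dim :: "'a set \<Rightarrow> 'm set \<Rightarrow> ('k::field \<Rightarrow> 'm::ab_group_add \<Rightarrow> 'm) \<Rightarrow> ('a \<Rightarrow> 'm \<Rightarrow> 'm) \<Rightarrow> nat \<Rightarrow>
    ('a \<Rightarrow> nat \<Rightarrow> nat \<Rightarrow> 'k) \<Rightarrow> nat" where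
  "hom_dim K U t act p \<sigma> = vector_space.dim (function_scale :: 'k \<Rightarrow> ('m \<times> nat \<Rightarrow> 'k) \<Rightarrow> 'm \<times> nat \<Rightarrow> 'k) (homs K U t act p \<sigma>)"

lemma homs_subspace: "function_space.subspace (homs K U t act p \<sigma>)"
  unfolding function_space.subspace_def
  by (auto simp: homs_def function_scale_def mat_act_scale mat_act_add mat_act_zero algebra_simps)

lemma lin_evaluation: "lin function_scale (*) (\<lambda>f. f z)"
  by (simp add: lin_def function_scale_def)

context vector_space begin

lemma hom_sum:
  assumes f: "f \<in> homs K U scale act p \<sigma>" and U: "subspace U" and e: "\<And>s. s \<in> I \<Longrightarrow> e s \<in> U"
  shows "f (\<Sum>s\<in>I. scale (c s) (e s), i) = (\<Sum>s\<in>I. c s * f (e s, i))"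
  using e
proof (induction I rule: infinite_finite_induct)
  case (insert x I)
  have "f (scale (c x) (e x) + (\<Sum>s\<in>I. scale (c s) (e s)), i) = f (scale (c x) (e x), i) + f (\<Sum>s\<in>I. scale (c s) (e s), i)"
    using f insert.prems subspace_scale[OF U] subspace_sum[OF U, of I "\<lambda>s. scale (c s) (e s)"] by (auto simp: homs_def)
  with insert f show ?case by (simp add: homs_def)
next
  have zero: "f (0, i) = 0"
  proof -
    have "f (scale 0 0, i) = 0 * f (0, i)" using f subspace_0[OF U] unfolding homs_def by blast
    then show ?thesis by simp
  qed
  { case (infinite I) with zero show ?case by simp }
  { case empty with zero show ?case by simp }
qed

lemma homs_finite_dimensional:
  assumes U: "subspace U" and F: "finite F" "U \<subseteq> span F"
  obtains G where "finite G" "homs K U scale act p \<sigma> \<subseteq> function_space.span G"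
    "hom_dim K U scale act p \<sigma> \<le> dim U * p"
proof -
  obtain e v where e: "\<And>j. j < dim U \<Longrightarrow> e j \<in> U"
    and x: "\<And>x. x \<in> U \<Longrightarrow> x = (\<Sum>j<dim U. scale (v j x) (e j))"
    using basis_of_subspace[OF U F] by metis
  have sep: "f = 0" if f: "f \<in> homs K U scale act p \<sigma>"
    and z: "\<And>si. si \<in> {..<dim U} \<times> {..<p} \<Longrightarrow> f (e (fst si), snd si) = 0" for f
  proof
    fix mi :: "'b \<times> nat" obtain m i where mi: "mi = (m, i)" by fastforce
    show "f mi = 0 mi"
    proof (cases "m \<in> U \<and> i < p")
      case True
      then have "f (m, i) = f (\<Sum>j<dim U. scale (v j m) (e j), i)" using x by simp
      also have "\<dots> = (\<Sum>j<dim U. v j m * f (e j, i))" by (rule hom_sum[OF f U]) (use e in auto)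
      also have "\<dots> = 0" using z True by (intro sum.neutral) auto
      finally show ?thesis by (simp add: mi)
    next
      case False with f show ?thesis by (auto simp: homs_def mi)
    qed
  qed
  show ?thesis
  proof (rule function_space.finite_dimensional_of_separating_forms[OF homs_subspace[of K U scale act p \<sigma>],
        of "{..<dim U} \<times> {..<p}" "\<lambda>si f. f (e (fst si), snd si)"])
    show "f = 0" if "f \<in> homs K U scale act p \<sigma>"
      "\<And>si. si \<in> {..<dim U} \<times> {..<p} \<Longrightarrow> f (e (fst si), snd si) = 0" for f
      using that by (rule sep)
  next
    fix G assume "finite G" "homs K U scale act p \<sigma> \<subseteq> function_space.span G"
      "function_space.dim (homs K U scale act p \<sigma>) \<le> card ({..<dim U} \<times> {..<p})"
    then show thesis by (intro that[of G]) (simp_all add: hom_dim_def)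
  qed (simp_all add: lin_evaluation)
qed

end

lemma (in vector_space) homs_basis:
  assumes "subspace U" "finite F" "U \<subseteq> span F"
  obtains b w where "\<And>a. a < hom_dim K U scale act p \<sigma> \<Longrightarrow> b a \<in> homs K U scale act p \<sigma>"
    "\<And>a. lin function_scale (*) (w a)"
    "\<And>a a'. a < hom_dim K U scale act p \<sigma> \<Longrightarrow> a' < hom_dim K U scale act p \<sigma> \<Longrightarrow>
      w a (b a') = (if a = a' then 1 else 0)"
    "\<And>f. f \<in> homs K U scale act p \<sigma> \<Longrightarrow> f = (\<Sum>a<hom_dim K U scale act p \<sigma>. function_scale (w a f) (b a))"
proof -
  obtain G where G: "finite G" "homs K U scale act p \<sigma> \<subseteq> function_space.span G"
    by (rule homs_finite_dimensional[OF assms])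
  show ?thesis
    by (rule function_space.basis_of_subspace[OF homs_subspace G], rule that[unfolded hom_dim_def])
qed

section \<open>Linear maps on Hopf modules\<close>

context projected_quasibialgebra begin

text \<open>
Quasi-coassociativity, multiplied by \<open>\<psi>\<close> on both sides.
\<close>

lemma psi_D_coassoc:
  assumes \<Phi>: "trilin scale scale scale \<Phi>" and x: "x \<in> A"
  shows "(\<Sum>(a, b)\<leftarrow>D x. \<Sum>(c, d)\<leftarrow>D b. \<Sum>(p, q, r)\<leftarrow>\<psi>. \<Phi> (p * a) (q * c) (r * d)) =
         (\<Sum>(a, b)\<leftarrow>D x. \<Sum>(c, d)\<leftarrow>D a. \<Sum>(p, q, r)\<leftarrow>\<psi>. \<Phi> (c * p) (d * q) (b * r))"
proof -
  let ?\<Omega> = "\<lambda>u v w. \<Sum>(p, q, r)\<leftarrow>\<psi>. \<Sum>(p', q', r')\<leftarrow>\<psi>. \<Phi> (p * u * p') (q * v * q') (r * w * r')"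
  have \<Omega>: "trilin scale scale scale ?\<Omega>"
    by (intro trilinI lin_intros trilinD[OF \<Phi>])
  have "(\<Sum>(a', b', c')\<leftarrow>\<phi>. ?\<Omega> (a * a') (b * b') (c * c')) = (\<Sum>(p, q, r)\<leftarrow>\<psi>. \<Phi> (p * a) (q * b) (r * c))" for a b c
  proof -
    have "(\<Sum>(a', b', c')\<leftarrow>\<phi>. ?\<Omega> (a * a') (b * b') (c * c')) =
      (\<Sum>(p, q, r)\<leftarrow>\<psi>. \<Sum>(a', b', c')\<leftarrow>\<phi>. \<Sum>(p', q', r')\<leftarrow>\<psi>. \<Phi> (p * a * (a' * p')) (q * b * (b' * q')) (r * c * (c' * r')))"
      by (subst sum_list_swap33) (simp add: mult.assoc)
    also have "\<dots> = (\<Sum>(p, q, r)\<leftarrow>\<psi>. \<Phi> (p * a) (q * b) (r * c))"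
      by (intro sum_list_cong3, subst phi_psi(1)) (auto intro!: trilinI lin_intros trilinD[OF \<Phi>])
    finally show ?thesis .
  qed
  moreover have "(\<Sum>(a', b', c')\<leftarrow>\<phi>. ?\<Omega> (a' * a) (b' * b) (c' * c)) = (\<Sum>(p, q, r)\<leftarrow>\<psi>. \<Phi> (a * p) (b * q) (c * r))" for a b c
  proof -
    have "(\<Sum>(a', b', c')\<leftarrow>\<phi>. ?\<Omega> (a' * a) (b' * b) (c' * c)) =
      (\<Sum>(p, q, r)\<leftarrow>\<psi>. \<Sum>(a', b', c')\<leftarrow>\<phi>. \<Sum>(p', q', r')\<leftarrow>\<psi>. \<Phi> (p * a' * (a * p')) (q * b' * (b * q')) (r * c' * (c * r')))"
      by (subst sum_list_swap33) (simp add: mult.assoc)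
    also have "\<dots> = (\<Sum>(p, q, r)\<leftarrow>\<psi>. \<Phi> (1 * (a * p)) (1 * (b * q)) (1 * (c * r)))"
      by (subst phi_psi(2)) (auto intro!: trilinI lin_intros trilinD[OF \<Phi>])
    finally show ?thesis by simp
  qed
  moreover have "(\<Sum>(a', b', c')\<leftarrow>\<phi>. \<Sum>(a, b)\<leftarrow>D x. \<Sum>(c, d)\<leftarrow>D a. ?\<Omega> (a' * c) (b' * d) (c' * b)) =
    (\<Sum>(a, b)\<leftarrow>D x. \<Sum>(c, d)\<leftarrow>D a. \<Sum>(a', b', c')\<leftarrow>\<phi>. ?\<Omega> (a' * c) (b' * d) (c' * b))"
    unfolding sum_list_swap23[of _ \<phi>] ..
  ultimately show ?thesis
    using D_coassoc[OF \<Omega> x] by simp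
qed

text \<open>
Let \<open>H\<close> be the ambient algebra.  Here \<open>F\<close> is an \<open>A\<close>-linear map from \<open>M\<close> to \<open>X \<otimes> H\<^sup>*\<close>, written as a bilinear map
on \<open>M \<times> H\<close> with values in \<open>X\<close>; the \<open>A\<close>-linearity reads \<open>F(x m, y) = x\<^sub>1 F(m, y x\<^sub>2)\<close>.  If \<open>A\<close> were a Hopf
algebra, then \<open>F(m, y) = S(y\<^sub>1) F(y\<^sub>2 m, 1)\<close> for \<open>y \<in> A\<close>, so that the values \<open>F(m, 1)\<close> would determine the
restriction to \<open>M \<times> A\<close>.  In general \<open>F(m, 1)\<close> is replaced by \<open>S(\<psi>\<^sub>1) \<alpha> \<psi>\<^sub>2 F(m, \<psi>\<^sub>3)\<close>.
\<close>

lemma restriction_determined: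
  assumes K: "quasiantipode scale A \<Delta> \<epsilon> \<phi> S' \<alpha> \<beta>"
    and M: "bimodule_over scale A scaleM lact ract"
    and \<sigma>: "representation_of A p \<sigma>"
    and F: "\<And>i. bilin scaleM scale (\<lambda>m y. F m y i)"
    and F_lact: "\<And>x m y i. x \<in> A \<Longrightarrow> i < p \<Longrightarrow>
      F (lact x m) y i = (\<Sum>(a, b)\<leftarrow>D x. mat_act p \<sigma> a (F m (y * b)) i)"
    and R: "\<And>m i. i < p \<Longrightarrow> (\<Sum>(u, v, w)\<leftarrow>\<psi>. mat_act p \<sigma> (S' u * \<alpha> * v) (F m w) i) = 0"
    and y: "y \<in> A" and i: "i < p"
  shows "F m y i = 0"
proof -
  interpret K: quasiantipode scale A \<Delta> \<epsilon> \<phi> S' \<alpha> \<beta> by fact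
  interpret M: bimodule_over scale A scaleM lact ract by fact
  define S where "S x = S' (P x)" for x
  have S_lin: "lin scale scale S"
    using K.antipode_add[OF projection_in projection_in] K.antipode_scale[OF projection_in] projection_lin
    by (simp add: lin_def S_def)
  have S_eq: "S x = S' x" if "x \<in> A" for x using that by (simp add: S_def projection_id)
  have S_in: "S x \<in> A" for x
    using K.antipode_bij projection_in[of x] by (auto simp: S_def bij_betw_def)
  have S_lin': "lin scale scale (\<lambda>x. S (g x))" if "lin scale scale g" for g
    using lin_compose[OF S_lin that] .
  have S_mult: "S (x * y) = S y * S x" if "x \<in> A" "y \<in> A" for x y
    using that by (simp add: S_eq mult_in K.antipode_mult)
  have alpha: "(\<Sum>(a, b)\<leftarrow>D x. l (S a * \<alpha> * b)) = E x * l \<alpha>" if "x \<in> A" "lin scale (*) l" for x l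
  proof -
    have "(\<Sum>(a, b)\<leftarrow>D x. l (S a * \<alpha> * b)) = (\<Sum>(a, b)\<leftarrow>D x. l (S' a * \<alpha> * b))"
      by (rule sum_list_cong2) (simp add: S_eq D_in)
    also have "\<dots> = l (\<Sum>(a, b)\<leftarrow>\<Delta> x. S' a * \<alpha> * b)"
      using that by (simp add: lin_sum_list2 D_eq)
    finally show ?thesis using that by (simp add: K.antipode_alpha linD E_eq)
  qed
  have beta: "(\<Sum>(a, b)\<leftarrow>D x. l (a * \<beta> * S b)) = E x * l \<beta>" if "x \<in> A" "lin scale (*) l" for x l
  proof -
    have "(\<Sum>(a, b)\<leftarrow>D x. l (a * \<beta> * S b)) = (\<Sum>(a, b)\<leftarrow>D x. l (a * \<beta> * S' b))"
      by (rule sum_list_cong2) (simp add: S_eq D_in)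
    also have "\<dots> = l (\<Sum>(a, b)\<leftarrow>\<Delta> x. a * \<beta> * S' b)"
      using that by (simp add: lin_sum_list2 D_eq)
    finally show ?thesis using that by (simp add: K.antipode_beta linD E_eq)
  qed
  have assoc: "(\<Sum>(a, b, c)\<leftarrow>\<phi>. l (a * \<beta> * S b * \<alpha> * c)) = l 1" if "lin scale (*) l" for l
  proof -
    have "(\<Sum>(a, b, c)\<leftarrow>\<phi>. l (a * \<beta> * S b * \<alpha> * c)) = (\<Sum>(a, b, c)\<leftarrow>\<phi>. l (a * \<beta> * S' b * \<alpha> * c))"
      by (rule sum_list_cong3) (simp add: S_eq phi_in)
    also have "\<dots> = l (\<Sum>(a, b, c)\<leftarrow>\<phi>. a * \<beta> * S' b * \<alpha> * c)"
      by (rule lin_sum_list3[OF that, symmetric])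
    finally show ?thesis by (simp add: K.antipode_associator)
  qed
  have F_lin: "lin scale (*) (\<lambda>x. F m (g x) j)" if "lin scale scale g" for g m j
    using bilinD(2)[OF F that] .
  note lins = lin_intros mat_act_lin[OF \<sigma>] mat_act_lin_vector F_lin S_lin S_lin'
  note ins = mult_in S_in D_in phi_in psi_in K.alpha_closed K.beta_closed
  have R': "(\<Sum>(u, v, w)\<leftarrow>\<psi>. mat_act p \<sigma> (S u * \<alpha> * v) (F m w) i) = 0" if "i < p" for m i
    by (subst R[OF that, of m, symmetric], rule sum_list_cong3) (simp add: S_eq psi_in)
  \<comment> \<open>The same computation as in a Hopf algebra, with coassociativity in the form corrected by \<open>\<psi>\<close>.\<close>
  have translated: "(\<Sum>(u, v, w)\<leftarrow>\<psi>. mat_act p \<sigma> (S u * \<alpha> * v) (F m (y * w)) i) = 0" if y: "y \<in> A" and i: "i < p" for m y i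
  proof -
    let ?\<Omega> = "\<lambda>u v w. mat_act p \<sigma> (S u * \<alpha> * v) (F m w) i"
    have \<Omega>: "trilin scale scale scale ?\<Omega>"
      by (intro trilinI lins)
    have "0 = (\<Sum>(a, b)\<leftarrow>D y. mat_act p \<sigma> (S a) (\<lambda>l. \<Sum>(u, v, w)\<leftarrow>\<psi>. mat_act p \<sigma> (S u * \<alpha> * v) (F (lact b m) w) l) i)"
    proof -
      have "(\<Sum>(a, b)\<leftarrow>D y. mat_act p \<sigma> (S a) (\<lambda>l. \<Sum>(u, v, w)\<leftarrow>\<psi>. mat_act p \<sigma> (S u * \<alpha> * v) (F (lact b m) w) l) i) = (\<Sum>(a, b)\<leftarrow>D y. 0)"
        by (intro sum_list_cong2 mat_act_zero R')
      then show ?thesis by (simp add: case_prod_unfold)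
    qed
    also have "\<dots> = (\<Sum>(a, b)\<leftarrow>D y. \<Sum>(u, v, w)\<leftarrow>\<psi>. mat_act p \<sigma> (S a * (S u * \<alpha> * v)) (F (lact b m) w) i)"
      unfolding mat_act_sum_list3
      by (intro sum_list_cong2 sum_list_cong3, subst mat_act_mult[OF \<sigma>]) (auto intro: ins)
    also have "\<dots> = (\<Sum>(a, b)\<leftarrow>D y. \<Sum>(u, v, w)\<leftarrow>\<psi>. \<Sum>(c, d)\<leftarrow>D b. ?\<Omega> (u * a) (v * c) (w * d))"
    proof (rule sum_list_cong2, rule sum_list_cong3)
      fix a b u v w assume in1: "(a, b) \<in> set (D y)" and in2: "(u, v, w) \<in> set \<psi>"
      have "mat_act p \<sigma> (S a * (S u * \<alpha> * v)) (F (lact b m) w) i =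
          mat_act p \<sigma> (S (u * a) * \<alpha> * v) (\<lambda>j. \<Sum>(c, d)\<leftarrow>D b. mat_act p \<sigma> c (F m (w * d)) j) i"
        using in1 in2 by (subst mat_act_cong[OF F_lact]) (auto simp: S_mult ins mult.assoc intro: ins)
      also have "\<dots> = (\<Sum>(c, d)\<leftarrow>D b. mat_act p \<sigma> (S (u * a) * \<alpha> * v) (mat_act p \<sigma> c (F m (w * d))) i)"
        by (rule mat_act_sum_list2)
      also have "\<dots> = (\<Sum>(c, d)\<leftarrow>D b. ?\<Omega> (u * a) (v * c) (w * d))"
        using in1 in2 by (intro sum_list_cong2, subst mat_act_mult[OF \<sigma>, symmetric]) (auto intro: ins simp: mult.assoc)
      finally show "mat_act p \<sigma> (S a * (S u * \<alpha> * v)) (F (lact b m) w) i = (\<Sum>(c, d)\<leftarrow>D b. ?\<Omega> (u * a) (v * c) (w * d))" .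
    qed
    also have "\<dots> = (\<Sum>(a, b)\<leftarrow>D y. \<Sum>(c, d)\<leftarrow>D b. \<Sum>(u, v, w)\<leftarrow>\<psi>. ?\<Omega> (u * a) (v * c) (w * d))"
      unfolding sum_list_swap23 ..
    also have "\<dots> = (\<Sum>(a, b)\<leftarrow>D y. \<Sum>(c, d)\<leftarrow>D a. \<Sum>(u, v, w)\<leftarrow>\<psi>. ?\<Omega> (c * u) (d * v) (b * w))"
      by (rule psi_D_coassoc[OF \<Omega> y])
    also have "\<dots> = (\<Sum>(a, b)\<leftarrow>D y. E a * (\<Sum>(u, v, w)\<leftarrow>\<psi>. ?\<Omega> u v (b * w)))"
    proof (intro sum_list_cong2)
      fix a b assume in1: "(a, b) \<in> set (D y)"
      have "(\<Sum>(c, d)\<leftarrow>D a. \<Sum>(u, v, w)\<leftarrow>\<psi>. ?\<Omega> (c * u) (d * v) (b * w)) =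
          (\<Sum>(c, d)\<leftarrow>D a. \<Sum>(u, v, w)\<leftarrow>\<psi>. mat_act p \<sigma> (S u * (S c * \<alpha> * d) * v) (F m (b * w)) i)"
        using in1 by (intro sum_list_cong2 sum_list_cong3) (simp add: S_mult D_in psi_in mult.assoc)
      also have "\<dots> = E a * (\<Sum>(u, v, w)\<leftarrow>\<psi>. ?\<Omega> u v (b * w))"
        using in1 by (subst alpha) (auto intro!: lins intro: ins)
      finally show "(\<Sum>(c, d)\<leftarrow>D a. \<Sum>(u, v, w)\<leftarrow>\<psi>. ?\<Omega> (c * u) (d * v) (b * w)) = E a * (\<Sum>(u, v, w)\<leftarrow>\<psi>. ?\<Omega> u v (b * w))" .
    qed
    also have "\<dots> = (\<Sum>(u, v, w)\<leftarrow>\<psi>. ?\<Omega> u v (y * w))"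
      by (rule D_counit_left[OF _ y]) (intro lins)
    finally show ?thesis by simp
  qed
  \<comment> \<open>To remove \<open>\<psi>\<close>, the vanishing expression is used at \<open>\<phi>\<^sub>3 m\<close> and multiplied by \<open>\<phi>\<^sub>1 \<beta> S(\<phi>\<^sub>2)\<close>.\<close>
  let ?\<Phi> = "\<lambda>x z. mat_act p \<sigma> x (F m (y * z)) i"
  have "F m y i = ?\<Phi> 1 1"
    using i by (simp add: mat_act_one[OF \<sigma>])
  also have "\<dots> = (\<Sum>(u, v, w)\<leftarrow>\<psi>. \<Sum>(a, b, c)\<leftarrow>\<phi>. \<Sum>(d, e)\<leftarrow>D c.
      ?\<Phi> (a * \<beta> * S b * (S u * \<alpha> * v * d)) (w * e))"
    by (rule antipode_pentagon[symmetric, OF S_lin S_mult alpha beta assoc]) (auto intro!: bilinI lins)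
  also have "\<dots> = (\<Sum>(u, v, w)\<leftarrow>\<psi>. \<Sum>(a, b, c)\<leftarrow>\<phi>.
      mat_act p \<sigma> (a * \<beta> * S b) (mat_act p \<sigma> (S u * \<alpha> * v) (F (lact c m) (y * w))) i)"
  proof (intro sum_list_cong3)
    fix u v w a b c assume in1: "(u, v, w) \<in> set \<psi>" and in2: "(a, b, c) \<in> set \<phi>"
    have "mat_act p \<sigma> (S u * \<alpha> * v) (F (lact c m) (y * w)) j =
      (\<Sum>(d, e)\<leftarrow>D c. mat_act p \<sigma> (S u * \<alpha> * v * d) (F m (y * (w * e))) j)" for j
    proof -
      have "mat_act p \<sigma> (S u * \<alpha> * v) (F (lact c m) (y * w)) j =
        mat_act p \<sigma> (S u * \<alpha> * v) (\<lambda>j. \<Sum>(d, e)\<leftarrow>D c. mat_act p \<sigma> d (F m (y * w * e)) j) j"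
        using in2 by (subst mat_act_cong[OF F_lact]) (auto intro: ins)
      also have "\<dots> = (\<Sum>(d, e)\<leftarrow>D c. mat_act p \<sigma> (S u * \<alpha> * v) (mat_act p \<sigma> d (F m (y * w * e))) j)"
        by (rule mat_act_sum_list2)
      also have "\<dots> = (\<Sum>(d, e)\<leftarrow>D c. mat_act p \<sigma> (S u * \<alpha> * v * d) (F m (y * (w * e))) j)"
        using in1 by (intro sum_list_cong2, subst mat_act_mult[OF \<sigma>, symmetric]) (auto intro: ins simp: mult.assoc)
      finally show ?thesis .
    qed
    then have "mat_act p \<sigma> (a * \<beta> * S b) (mat_act p \<sigma> (S u * \<alpha> * v) (F (lact c m) (y * w))) i =
       (\<Sum>(d, e)\<leftarrow>D c. mat_act p \<sigma> (a * \<beta> * S b) (mat_act p \<sigma> (S u * \<alpha> * v * d) (F m (y * (w * e)))) i)"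
      by (simp add: mat_act_sum_list2 cong: mat_act_cong)
    also have "\<dots> = (\<Sum>(d, e)\<leftarrow>D c. ?\<Phi> (a * \<beta> * S b * (S u * \<alpha> * v * d)) (w * e))"
      using in1 in2 by (intro sum_list_cong2, subst mat_act_mult[OF \<sigma>, symmetric]) (auto intro: ins)
    finally show "(\<Sum>(d, e)\<leftarrow>D c. ?\<Phi> (a * \<beta> * S b * (S u * \<alpha> * v * d)) (w * e)) =
       mat_act p \<sigma> (a * \<beta> * S b) (mat_act p \<sigma> (S u * \<alpha> * v) (F (lact c m) (y * w))) i" by simp
  qed
  also have "\<dots> = (\<Sum>(a, b, c)\<leftarrow>\<phi>. mat_act p \<sigma> (a * \<beta> * S b)
      (\<lambda>l. \<Sum>(u, v, w)\<leftarrow>\<psi>. mat_act p \<sigma> (S u * \<alpha> * v) (F (lact c m) (y * w)) l) i)"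
    unfolding mat_act_sum_list3 by (rule sum_list_swap33)
  also have "\<dots> = (\<Sum>(a, b, c)\<leftarrow>\<phi>. 0)"
    by (intro sum_list_cong3 mat_act_zero translated[OF y])
  finally show ?thesis by (simp add: case_prod_unfold)
qed

text \<open>
The inverse \<open>T\<close> of the antipode of \<open>H\<close> satisfies the antipode axioms with the tensor factors interchanged,
because \<open>T\<close> can be applied to the axioms for \<open>S\<close>.  The inverse \<open>\<psi>\<close> with entries in \<open>A\<close> agrees with
any inverse of the associator of \<open>H\<close>, so the axiom about the inverse associator holds for \<open>\<psi>\<close>.
\<close>

lemma inverse_antipode_identities:
  assumes H: "quasiantipode scale UNIV \<Delta>H \<epsilon> \<phi>H S \<alpha> \<beta>"
    and sub_comult: "\<And>x. x \<in> A \<Longrightarrow> tensor2_eq scale UNIV scale UNIV (\<Delta> x) (\<Delta>H x)"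
    and sub_assoc: "tensor3_eq scale UNIV scale UNIV scale UNIV \<phi> \<phi>H"
  obtains T where "lin scale scale T" "\<And>x y. T (x * y) = T y * T x"
    "\<And>x l. lin scale (*) l \<Longrightarrow> (\<Sum>(a, b)\<leftarrow>\<Delta>H x. l (T b * T \<alpha> * a)) = \<epsilon> x * l (T \<alpha>)"
    "\<And>x l. x \<in> A \<Longrightarrow> lin scale (*) l \<Longrightarrow> (\<Sum>(a, b)\<leftarrow>D x. l (T b * T \<alpha> * a)) = E x * l (T \<alpha>)"
    "\<And>x l. x \<in> A \<Longrightarrow> lin scale (*) l \<Longrightarrow> (\<Sum>(a, b)\<leftarrow>D x. l (b * T \<beta> * T a)) = E x * l (T \<beta>)"
    "\<And>l. lin scale (*) l \<Longrightarrow> (\<Sum>(p, q, r)\<leftarrow>\<psi>. l (r * T \<beta> * T q * T \<alpha> * p)) = l 1"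
proof -
  interpret H: quasiantipode scale UNIV \<Delta>H \<epsilon> \<phi>H S \<alpha> \<beta> by fact
  have bij: "bij S" using H.antipode_bij .
  define T where "T = inv S"
  have ST: "S (T x) = x" and TS: "T (S x) = x" for x
    using bij by (simp_all add: T_def bij_is_inj bij_is_surj surj_f_inv_f)
  have T: "lin scale scale T"
    unfolding lin_def by (metis ST TS H.antipode_add H.antipode_scale UNIV_I)
  have T_mult: "T (x * y) = T y * T x" for x y
    by (metis ST TS H.antipode_mult UNIV_I)
  have T': "lin r scale (\<lambda>x. T (g x))" if "lin r scale g" for r :: "'k \<Rightarrow> 'a \<Rightarrow> 'a" and g
    using lin_compose[OF T that] .
  have T_one: "T 1 = 1" by (metis TS H.antipode_one)
  have alpha: "(\<Sum>(a, b)\<leftarrow>\<Delta>H x. l (T b * T \<alpha> * a)) = \<epsilon> x * l (T \<alpha>)" if l: "lin scale (*) l" for x l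
  proof -
    have "(\<Sum>(a, b)\<leftarrow>\<Delta>H x. l (T b * T \<alpha> * a)) = l (T (\<Sum>(a, b)\<leftarrow>\<Delta>H x. S a * \<alpha> * b))"
      by (simp add: lin_sum_list2[OF lin_compose[OF l T]] T_mult TS mult.assoc)
    then show ?thesis by (simp add: H.antipode_alpha linD[OF T] linD[OF l])
  qed
  have beta: "(\<Sum>(a, b)\<leftarrow>\<Delta>H x. l (b * T \<beta> * T a)) = \<epsilon> x * l (T \<beta>)" if l: "lin scale (*) l" for x l
  proof -
    have "(\<Sum>(a, b)\<leftarrow>\<Delta>H x. l (b * T \<beta> * T a)) = l (T (\<Sum>(a, b)\<leftarrow>\<Delta>H x. a * \<beta> * S b))"
      by (simp add: lin_sum_list2[OF lin_compose[OF l T]] T_mult TS mult.assoc)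
    then show ?thesis by (simp add: H.antipode_beta linD[OF T] linD[OF l])
  qed
  obtain \<psi>H where \<psi>H: "tensor3_inverse scale UNIV \<phi>H \<psi>H" using H.associator_invertible by blast
  have inverse_unique: "(\<Sum>(p, q, r)\<leftarrow>\<psi>. \<Phi> p q r) = (\<Sum>(p, q, r)\<leftarrow>\<psi>H. \<Phi> p q r)"
    if \<Phi>: "trilin scale scale scale \<Phi>" for \<Phi>
  proof -
    have "(\<Sum>(p, q, r)\<leftarrow>\<psi>. \<Phi> p q r) = (\<Sum>(p, q, r)\<leftarrow>\<psi>. \<Sum>(a, b, c)\<leftarrow>tensor3_mult \<phi>H \<psi>H. \<Phi> (p * a) (q * b) (r * c))"
    proof (rule sum_list_cong3)
      fix p q r
      have "trilin scale scale scale (\<lambda>a b c. \<Phi> (p * a) (q * b) (r * c))"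
        by (intro trilinI trilinD[OF \<Phi>] lin_intros)
      moreover have "tensor3_eq scale UNIV scale UNIV scale UNIV (tensor3_mult \<phi>H \<psi>H) [(1, 1, 1)]"
        using \<psi>H by (simp add: tensor3_inverse_def)
      ultimately show "\<Phi> p q r = (\<Sum>(a, b, c)\<leftarrow>tensor3_mult \<phi>H \<psi>H. \<Phi> (p * a) (q * b) (r * c))"
        using tensor3_eq_evaluate by fastforce
    qed
    also have "\<dots> = (\<Sum>(p, q, r)\<leftarrow>\<psi>. \<Sum>(a, b, c)\<leftarrow>\<phi>H. \<Sum>(p', q', r')\<leftarrow>\<psi>H. \<Phi> (p * a * p') (q * b * q') (r * c * r'))"
      by (simp add: tensor3_mult_def tensor_sum_simps mult.assoc)
    also have "\<dots> = (\<Sum>(p, q, r)\<leftarrow>\<psi>. \<Sum>(a, b, c)\<leftarrow>\<phi>. \<Sum>(p', q', r')\<leftarrow>\<psi>H. \<Phi> (p * a * p') (q * b * q') (r * c * r'))"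
      by (rule sum_list_cong3, rule tensor3_eq_evaluate[OF sub_assoc, symmetric])
        (intro trilinI lin_intros trilinD[OF \<Phi>])
    also have "\<dots> = (\<Sum>(p', q', r')\<leftarrow>\<psi>H. \<Phi> p' q' r')"
      by (subst phi_psi(2)) (auto intro!: trilinI lin_intros trilinD[OF \<Phi>])
    finally show ?thesis .
  qed
  have assoc: "(\<Sum>(p, q, r)\<leftarrow>\<psi>. l (r * T \<beta> * T q * T \<alpha> * p)) = l 1" if l: "lin scale (*) l" for l
  proof -
    have "(\<Sum>(p, q, r)\<leftarrow>\<psi>. l (r * T \<beta> * T q * T \<alpha> * p)) = (\<Sum>(p, q, r)\<leftarrow>\<psi>H. l (r * T \<beta> * T q * T \<alpha> * p))"
      by (intro inverse_unique trilinI lin_compose[OF l] lin_intros T T')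
    also have "\<dots> = (\<Sum>(p, q, r)\<leftarrow>\<psi>H. l (T (S p * \<alpha> * q * \<beta> * S r)))"
      by (simp add: T_mult TS mult.assoc)
    also have "\<dots> = l (T (\<Sum>(p, q, r)\<leftarrow>\<psi>H. S p * \<alpha> * q * \<beta> * S r))"
      by (rule lin_sum_list3[OF lin_compose[OF l T], symmetric])
    also have "\<dots> = l 1"
      by (simp add: H.antipode_associator_inverse[OF \<psi>H] T_one)
    finally show ?thesis .
  qed
  show ?thesis
  proof
    show "lin scale scale T" by fact
    show "T (x * y) = T y * T x" for x y by (rule T_mult)
    show "(\<Sum>(a, b)\<leftarrow>\<Delta>H x. l (T b * T \<alpha> * a)) = \<epsilon> x * l (T \<alpha>)" if "lin scale (*) l" for x l
      by (rule alpha[OF that])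
    show "(\<Sum>(a, b)\<leftarrow>D x. l (T b * T \<alpha> * a)) = E x * l (T \<alpha>)" if "x \<in> A" "lin scale (*) l" for x l
      using tensor2_eq_evaluate[OF sub_comult[OF that(1)], of "\<lambda>a b. l (T b * T \<alpha> * a)"] that alpha[OF that(2)]
      by (simp add: D_eq E_eq bilinI lin_compose[OF that(2)] lin_intros T T')
    show "(\<Sum>(a, b)\<leftarrow>D x. l (b * T \<beta> * T a)) = E x * l (T \<beta>)" if "x \<in> A" "lin scale (*) l" for x l
      using tensor2_eq_evaluate[OF sub_comult[OF that(1)], of "\<lambda>a b. l (b * T \<beta> * T a)"] that beta[OF that(2)]
      by (simp add: D_eq E_eq bilinI lin_compose[OF that(2)] lin_intros T T')
    show "(\<Sum>(p, q, r)\<leftarrow>\<psi>. l (r * T \<beta> * T q * T \<alpha> * p)) = l 1" if "lin scale (*) l" for l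
      by (rule assoc[OF that])
  qed
qed

end

lemma (in bimodule_over) actions_lin:
  assumes K: "unital_subalgebra scale K" and "k_algebra scale" and x: "x \<in> K"
  shows "lin scaleM scaleM (lact x)" "lin scaleM scaleM (\<lambda>m. ract m x)"
    "lact (scale c x) m = scaleM c (lact x m)" "ract m (scale c x) = scaleM c (ract m x)"
proof -
  interpret R: k_algebra scale by fact
  have c: "scale c 1 \<in> K" for c
    using K by (simp add: unital_subalgebra_def R.subspace_scale)
  have comm: "scale c 1 * x = scale c x" "x * scale c 1 = scale c x" for c
    by (simp_all add: R.scale_mult_left R.scale_mult_right)
  show "lact (scale c x) m = scaleM c (lact x m)"
    using lact_mult[OF c x] by (simp add: comm lact_scalar)
  show "ract m (scale c x) = scaleM c (ract m x)"
    using ract_mult[OF x c] by (simp add: comm ract_scalar)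
  have "lact x (scaleM c m) = scaleM c (lact x m)" for c m
    using lact_mult[OF c[of c] x, where m = m] lact_mult[OF x c[of c], where m = m] by (simp add: comm lact_scalar)
  then show "lin scaleM scaleM (lact x)"
    using x by (simp add: lin_def lact_add_right)
  have "ract (scaleM c m) x = scaleM c (ract m x)" for c m
    using ract_mult[OF c[of c] x, where m = m] ract_mult[OF x c[of c], where m = m] by (simp add: comm ract_scalar)
  then show "lin scaleM scaleM (\<lambda>m. ract m x)"
    using x by (simp add: lin_def ract_add_left)
qed

context projected_quasibialgebra begin

text \<open>
Here \<open>\<Theta>\<close> is an element of \<open>Hom\<^sub>A(M, X) \<otimes> H\<^sup>*\<close>, and the sum in the hypothesis is its image in
\<open>Hom\<^sub>A(M, X \<otimes> H\<^sup>*)\<close>.  If \<open>H\<close> were a Hopf algebra with inverse antipode \<open>T\<close>, then \<open>\<Theta>\<close> would be recovered by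
applying the map twice: \<open>\<Theta>(m\<^sub>0\<^sub>0, y T(m\<^sub>1) m\<^sub>0\<^sub>1) = \<Theta>(m, y)\<close>.  In general the second
coaction is applied to \<open>m\<^sub>0 \<psi>\<^sub>1\<close> instead of \<open>m\<^sub>0\<close>, and the factors of \<open>\<phi>\<close> are inserted to the left of
the three factors, so that the coassociativity law of \<open>M\<close> applies.
\<close>

lemma coaction_separates:
  assumes H: "quasiantipode scale UNIV \<Delta>H \<epsilon> \<phi>H S \<alpha> \<beta>"
    and sub_comult: "\<And>x. x \<in> A \<Longrightarrow> tensor2_eq scale UNIV scale UNIV (\<Delta> x) (\<Delta>H x)"
    and sub_assoc: "tensor3_eq scale UNIV scale UNIV scale UNIV \<phi> \<phi>H"
    and M: "hopf_module scale \<Delta>H \<epsilon> \<phi>H A scaleM lact ract \<delta>"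
    and \<sigma>: "representation_of A p \<sigma>"
    and \<Theta>: "\<And>i. bilin scaleM scale (\<lambda>m y. \<Theta> m y i)"
    and \<Theta>_lact: "\<And>x m y i. x \<in> A \<Longrightarrow> i < p \<Longrightarrow> \<Theta> (lact x m) y i = mat_act p \<sigma> x (\<Theta> m y) i"
    and zero: "\<And>m y i. i < p \<Longrightarrow> (\<Sum>(n, h)\<leftarrow>\<delta> m. \<Theta> n (y * h) i) = 0"
    and i: "i < p"
  shows "\<Theta> m y i = 0"
proof -
  interpret M: hopf_module scale \<Delta>H \<epsilon> \<phi>H A scaleM lact ract \<delta> by fact
  have alg: "k_algebra scale" by unfold_locales
  obtain T where T: "lin scale scale T" and T_mult: "\<And>x y. T (x * y) = T y * T x"
    and alphaH: "\<And>x l. lin scale (*) l \<Longrightarrow> (\<Sum>(a, b)\<leftarrow>\<Delta>H x. l (T b * T \<alpha> * a)) = \<epsilon> x * l (T \<alpha>)"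
    and alpha: "\<And>x l. x \<in> A \<Longrightarrow> lin scale (*) l \<Longrightarrow> (\<Sum>(a, b)\<leftarrow>D x. l (T b * T \<alpha> * a)) = E x * l (T \<alpha>)"
    and beta: "\<And>x l. x \<in> A \<Longrightarrow> lin scale (*) l \<Longrightarrow> (\<Sum>(a, b)\<leftarrow>D x. l (b * T \<beta> * T a)) = E x * l (T \<beta>)"
    and assoc: "\<And>l. lin scale (*) l \<Longrightarrow> (\<Sum>(p, q, r)\<leftarrow>\<psi>. l (r * T \<beta> * T q * T \<alpha> * p)) = l 1"
    using inverse_antipode_identities[OF H sub_comult sub_assoc] by blast
  have T': "lin scale scale (\<lambda>x. T (g x))" if "lin scale scale g" for g
    using lin_compose[OF T that] .
  have \<Theta>1: "lin scaleM (*) (\<lambda>m. \<Theta> (g m) y j)" if "lin scaleM scaleM g" for g y j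
    using bilinD(1)[OF \<Theta> that] .
  have \<Theta>2: "lin scale (*) (\<lambda>y. \<Theta> m (g y) j)" if "lin scale scale g" for g m j
    using bilinD(2)[OF \<Theta> that] .
  have lact_lin: "lin scaleM scaleM (\<lambda>m. lact x (g m))" if "x \<in> A" "lin scaleM scaleM g" for x g
    using lin_compose[OF M.actions_lin(1)[OF subalgebra alg that(1)] that(2)] .
  have ract_lin: "lin scaleM scaleM (\<lambda>m. ract (g m) x)" if "x \<in> A" "lin scaleM scaleM g" for x g
    using lin_compose[OF M.actions_lin(2)[OF subalgebra alg that(1)] that(2)] .
  have ract_lin2: "lin scale scaleM (\<lambda>x. ract m (P x))" for m
    using M.ract_add_right[OF projection_in projection_in] M.actions_lin(4)[OF subalgebra alg projection_in]
      projection_lin by (simp add: lin_def)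
  note lins = lin_intros \<Theta>1 \<Theta>2 lact_lin ract_lin T T' lin_id[of scaleM]
  \<comment> \<open>Coassociativity and the antipode axiom reduce the doubled coaction to \<open>m\<close> itself.\<close>
  have vanish: "(\<Sum>(a, b, c)\<leftarrow>\<phi>. \<Sum>(d, e)\<leftarrow>D u. \<Theta> (ract m (a * d)) (y * (w * T \<beta> * T v * T c * T \<alpha> * b * e)) i) = 0"
    if in\<psi>: "(u, v, w) \<in> set \<psi>" for u v w
  proof -
    let ?y = "y * (w * T \<beta> * T v)"
    have u: "u \<in> A" using in\<psi> by (rule psi_in)
    have Du: "set (D u) \<subseteq> A \<times> A" "tensor2_eq scale UNIV scale UNIV (D u) (\<Delta>H u)"
      using comult_closed[OF u] sub_comult[OF u] by (simp_all add: D_eq u)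
    let ?\<Omega> = "\<lambda>d e x h' h. \<Theta> (ract x d) (?y * T h * T \<alpha> * h' * e) i"
    have \<Omega>: "trilin scaleM scale scale (?\<Omega> d e)" if "d \<in> A" for d e
      using that by (intro trilinI lins)
    have "0 = (\<Sum>(a, b, c)\<leftarrow>\<phi>. \<Sum>(n, h)\<leftarrow>\<delta> m. mat_act p \<sigma> a
        (\<lambda>j. \<Sum>(n', h')\<leftarrow>\<delta> (ract n u). \<Theta> n' (?y * T h * T c * T \<alpha> * b * h') j) i)"
    proof -
      have "(\<Sum>(a, b, c)\<leftarrow>\<phi>. \<Sum>(n, h)\<leftarrow>\<delta> m. mat_act p \<sigma> a
        (\<lambda>j. \<Sum>(n', h')\<leftarrow>\<delta> (ract n u). \<Theta> n' (?y * T h * T c * T \<alpha> * b * h') j) i) =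
        (\<Sum>(a, b, c)\<leftarrow>\<phi>. \<Sum>(n, h)\<leftarrow>\<delta> m. 0)"
        by (rule sum_list_cong3, rule sum_list_cong2, rule mat_act_zero, rule zero)
      then show ?thesis by (simp add: case_prod_unfold)
    qed
    also have "\<dots> = (\<Sum>(a, b, c)\<leftarrow>\<phi>. \<Sum>(n, h)\<leftarrow>\<delta> m. \<Sum>(n', h')\<leftarrow>\<delta> (ract n u).
        \<Theta> (lact a n') (?y * T h * T c * T \<alpha> * b * h') i)"
      unfolding mat_act_sum_list2
      by (rule sum_list_cong3, intro sum_list_cong2) (simp add: \<Theta>_lact i phi_in)
    also have "\<dots> = (\<Sum>(a, b, c)\<leftarrow>\<phi>. \<Sum>(n, h)\<leftarrow>\<delta> m. \<Sum>(n', h')\<leftarrow>\<delta> n. \<Sum>(d, e)\<leftarrow>D u.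
        \<Theta> (lact a (ract n' d)) (?y * T h * T c * T \<alpha> * b * (h' * e)) i)"
    proof (rule sum_list_cong3, rule sum_list_cong2)
      fix a b c n h assume in\<phi>: "(a, b, c) \<in> set \<phi>"
      have "bilin scaleM scale (\<lambda>n' h'. \<Theta> (lact a n') (?y * T h * T c * T \<alpha> * b * h') i)"
        using phi_in(1)[OF in\<phi>] by (intro bilinI lins)
      from tensor2_eq_evaluate[OF M.coact_ract[OF u Du] this]
      show "(\<Sum>(n', h')\<leftarrow>\<delta> (ract n u). \<Theta> (lact a n') (?y * T h * T c * T \<alpha> * b * h') i) =
         (\<Sum>(n', h')\<leftarrow>\<delta> n. \<Sum>(d, e)\<leftarrow>D u. \<Theta> (lact a (ract n' d)) (?y * T h * T c * T \<alpha> * b * (h' * e)) i)"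
        by (simp add: tensor_sum_simps)
    qed
    also have "\<dots> = (\<Sum>(a, b, c)\<leftarrow>\<phi>. \<Sum>(n, h)\<leftarrow>\<delta> m. \<Sum>(n', h')\<leftarrow>\<delta> n. \<Sum>(d, e)\<leftarrow>D u.
        ?\<Omega> d e (lact a n') (b * h') (c * h))"
      by (rule sum_list_cong3, intro sum_list_cong2) (simp add: T_mult M.lact_ract phi_in D_in mult.assoc)
    also have "\<dots> = (\<Sum>(d, e)\<leftarrow>D u. \<Sum>(a, b, c)\<leftarrow>\<phi>. \<Sum>(n, h)\<leftarrow>\<delta> m. \<Sum>(n', h')\<leftarrow>\<delta> n.
        ?\<Omega> d e (lact a n') (b * h') (c * h))"
      by (simp only: sum_list_swap22[of _ "D u"] sum_list_swap23)
    also have "\<dots> = (\<Sum>(d, e)\<leftarrow>D u. \<Sum>(n, h)\<leftarrow>\<delta> m. \<Sum>(h1, h2)\<leftarrow>\<Delta>H h. \<Sum>(a, b, c)\<leftarrow>\<phi>.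
        ?\<Omega> d e (ract n a) (h1 * b) (h2 * c))"
    proof (rule sum_list_cong2)
      fix d e assume inD: "(d, e) \<in> set (D u)"
      from tensor3_eq_evaluate[OF M.coact_coassoc[OF associator_closed sub_assoc] \<Omega>[OF D_in(1)[OF inD]]]
      show "(\<Sum>(a, b, c)\<leftarrow>\<phi>. \<Sum>(n, h)\<leftarrow>\<delta> m. \<Sum>(n', h')\<leftarrow>\<delta> n. ?\<Omega> d e (lact a n') (b * h') (c * h)) =
        (\<Sum>(n, h)\<leftarrow>\<delta> m. \<Sum>(h1, h2)\<leftarrow>\<Delta>H h. \<Sum>(a, b, c)\<leftarrow>\<phi>. ?\<Omega> d e (ract n a) (h1 * b) (h2 * c))"
        by (simp add: tensor_sum_simps)
    qed
    also have "\<dots> = (\<Sum>(d, e)\<leftarrow>D u. \<Sum>(n, h)\<leftarrow>\<delta> m. \<epsilon> h * (\<Sum>(a, b, c)\<leftarrow>\<phi>.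
        \<Theta> (ract n (a * d)) (?y * (T c * T \<alpha> * b) * e) i))"
    proof (intro sum_list_cong2)
      fix d e n h assume inD: "(d, e) \<in> set (D u)"
      have "(\<Sum>(h1, h2)\<leftarrow>\<Delta>H h. \<Sum>(a, b, c)\<leftarrow>\<phi>. ?\<Omega> d e (ract n a) (h1 * b) (h2 * c)) =
        (\<Sum>(h1, h2)\<leftarrow>\<Delta>H h. \<Sum>(a, b, c)\<leftarrow>\<phi>. \<Theta> (ract n (a * d)) (?y * (T c * (T h2 * T \<alpha> * h1) * b) * e) i)"
        using inD by (intro sum_list_cong2 sum_list_cong3) (simp add: T_mult M.ract_mult phi_in D_in mult.assoc)
      also have "\<dots> = \<epsilon> h * (\<Sum>(a, b, c)\<leftarrow>\<phi>. \<Theta> (ract n (a * d)) (?y * (T c * T \<alpha> * b) * e) i)"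
        by (rule alphaH) (intro lins)
      finally show "(\<Sum>(h1, h2)\<leftarrow>\<Delta>H h. \<Sum>(a, b, c)\<leftarrow>\<phi>. ?\<Omega> d e (ract n a) (h1 * b) (h2 * c)) =
        \<epsilon> h * (\<Sum>(a, b, c)\<leftarrow>\<phi>. \<Theta> (ract n (a * d)) (?y * (T c * T \<alpha> * b) * e) i)" .
    qed
    also have "\<dots> = (\<Sum>(d, e)\<leftarrow>D u. \<Sum>(a, b, c)\<leftarrow>\<phi>. \<Theta> (ract m (a * d)) (?y * (T c * T \<alpha> * b) * e) i)"
    proof (rule sum_list_cong2)
      fix d e assume inD: "(d, e) \<in> set (D u)"
      let ?g = "\<lambda>n. \<Sum>(a, b, c)\<leftarrow>\<phi>. \<Theta> (ract n (a * d)) (?y * (T c * T \<alpha> * b) * e) i"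
      have g: "lin scaleM (*) ?g"
        using inD by (intro lin_sum_listI lin_case_prod \<Theta>1 ract_lin lin_id) (auto intro: mult_in D_in phi_in)
      have "(\<Sum>(n, h)\<leftarrow>\<delta> m. \<epsilon> h * ?g n) = ?g (\<Sum>(n, h)\<leftarrow>\<delta> m. scaleM (\<epsilon> h) n)"
        by (subst lin_sum_list2[OF g]) (simp add: linD(2)[OF g])
      then show "(\<Sum>(n, h)\<leftarrow>\<delta> m. \<epsilon> h * ?g n) = ?g m"
        by (simp add: M.coact_counit)
    qed
    also have "\<dots> = (\<Sum>(a, b, c)\<leftarrow>\<phi>. \<Sum>(d, e)\<leftarrow>D u. \<Theta> (ract m (a * d)) (y * (w * T \<beta> * T v * T c * T \<alpha> * b * e)) i)"
      by (subst sum_list_swap23) (simp add: mult.assoc)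
    finally show ?thesis by simp
  qed
  \<comment> \<open>The projection makes the right action linear on all of \<open>H\<close>, as the identity for \<open>T\<close> requires.\<close>
  have "\<Theta> m y i = \<Theta> (ract m (P 1)) (y * 1) i"
    by (simp add: projection_id one_in M.ract_one)
  also have "\<dots> = (\<Sum>(a, b, c)\<leftarrow>\<phi>. \<Sum>(u, v, w)\<leftarrow>\<psi>. \<Sum>(d, e)\<leftarrow>D u.
      \<Theta> (ract m (P (a * d))) (y * (w * T \<beta> * T v * T c * T \<alpha> * b * e)) i)"
    by (rule inverse_antipode_pentagon[symmetric, OF T T_mult alpha beta assoc])
      (auto intro!: bilinI bilinD(1)[OF \<Theta>] ract_lin2 lins)
  also have "\<dots> = (\<Sum>(u, v, w)\<leftarrow>\<psi>. \<Sum>(a, b, c)\<leftarrow>\<phi>. \<Sum>(d, e)\<leftarrow>D u.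
      \<Theta> (ract m (P (a * d))) (y * (w * T \<beta> * T v * T c * T \<alpha> * b * e)) i)"
    by (rule sum_list_swap33)
  also have "\<dots> = (\<Sum>(u, v, w)\<leftarrow>\<psi>. \<Sum>(a, b, c)\<leftarrow>\<phi>. \<Sum>(d, e)\<leftarrow>D u.
      \<Theta> (ract m (a * d)) (y * (w * T \<beta> * T v * T c * T \<alpha> * b * e)) i)"
    by (intro sum_list_cong3 sum_list_cong2) (simp add: projection_id mult_in phi_in D_in)
  also have "\<dots> = (\<Sum>(u, v, w)\<leftarrow>\<psi>. 0)"
    by (intro sum_list_cong3 vanish)
  finally show ?thesis by (simp add: case_prod_unfold)
qed

end

section \<open>The dimension inequality\<close>

lemma sum_div_mod: "(\<Sum>L<p * q :: nat. g (L div q) (L mod q)) = (\<Sum>k<p. \<Sum>l<q. g k l :: 'b::comm_monoid_add)"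
proof -
  have "(\<Sum>L<p * q. g (L div q) (L mod q)) = (\<Sum>(k, l)\<in>{..<p} \<times> {..<q}. g k l)"
  proof (rule sum.reindex_bij_witness[of _ "\<lambda>(k, l). k * q + l" "\<lambda>L. (L div q, L mod q)"])
    fix L assume "L \<in> {..<p * q}"
    then have "L < p * q" "0 < q" by (auto intro: gr0I)
    then show "(L div q, L mod q) \<in> {..<p} \<times> {..<q}" by (simp add: less_mult_imp_div_less)
  next
    fix kl assume "kl \<in> {..<p} \<times> {..<q}"
    then obtain k l where kl: "kl = (k, l)" "k < p" "l < q" by auto
    have "k * q + l < Suc k * q" using kl by simp
    also have "\<dots> \<le> p * q" using kl by (intro mult_le_mono1) simp
    finally show "(case kl of (k, l) \<Rightarrow> k * q + l) \<in> {..<p * q}" using kl by simp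
  qed auto
  then show ?thesis by (simp add: sum.cartesian_product)
qed

lemma sum_list_sum_swap: "(\<Sum>x\<leftarrow>xs. \<Sum>k\<in>I. f x k) = (\<Sum>k\<in>I. \<Sum>x\<leftarrow>xs. f x k :: 'b::comm_monoid_add)"
  by (induction xs) (auto simp: sum.distrib)

lemma sum_list_sum_swap2: "(\<Sum>(a, b)\<leftarrow>xs. \<Sum>k\<in>I. f a b k) = (\<Sum>k\<in>I. \<Sum>(a, b)\<leftarrow>xs. f a b k :: 'b::comm_monoid_add)"
  by (induction xs) (auto simp: sum.distrib)

context projected_quasibialgebra begin

text \<open>
The module \<open>X \<otimes> (H/A)\<^sup>*\<close>, where \<open>H\<close> is the ambient algebra.  The vectors \<open>e j\<close> with \<open>j < q\<close>
represent a basis of \<open>H/A\<close> and the forms \<open>v j\<close> are the coordinates; the index \<open>i * q + j\<close> stands for the \<open>i\<close>-th coordinate in \<open>X\<close> and the \<open>j\<close>-th in the dual.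
\<close>

definition tensor_quotient_rep :: "(nat \<Rightarrow> 'a) \<Rightarrow> (nat \<Rightarrow> 'a \<Rightarrow> 'k) \<Rightarrow> nat \<Rightarrow>
    ('a \<Rightarrow> nat \<Rightarrow> nat \<Rightarrow> 'k) \<Rightarrow> 'a \<Rightarrow> nat \<Rightarrow> nat \<Rightarrow> 'k" where
  "tensor_quotient_rep e v q \<sigma> x I J =
     (\<Sum>(a, b)\<leftarrow>D x. \<sigma> a (I div q) (J div q) * v (J mod q) (e (I mod q) * b))"

lemma tensor_quotient_representation:
  assumes \<sigma>: "representation_of A p \<sigma>"
    and v: "\<And>j. lin scale (*) (v j)"
    and ve: "\<And>i j. i < q \<Longrightarrow> j < q \<Longrightarrow> v i (e j) = (if i = j then 1 else 0)"
    and vA: "\<And>j x. j < q \<Longrightarrow> x \<in> A \<Longrightarrow> v j x = 0"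
    and expand: "\<And>y. y - (\<Sum>j<q. scale (v j y) (e j)) \<in> A"
  shows "representation_of A (p * q) (tensor_quotient_rep e v q \<sigma>)"
proof -
  have \<sigma>_lin: "lin scale (*) (\<lambda>x. \<sigma> x i j)" for i j
    using \<sigma> by (simp add: representation_of_def)
  have \<sigma>_lin': "lin scale (*) (\<lambda>x. \<sigma> (g x) i j)" if "lin scale scale g" for g i j
    by (rule lin_compose[OF \<sigma>_lin that])
  have v': "lin scale (*) (\<lambda>x. v j (g x))" if "lin scale scale g" for g j
    by (rule lin_compose[OF v that])
  have form: "bilin scale scale (\<lambda>a b. \<sigma> a i k * v l (e j * b))" for i k l j
    by (intro bilinI lin_intros \<sigma>_lin' v')
  have v_mult: "v l (e j * (b * d)) = (\<Sum>t<q. v t (e j * b) * v l (e t * d))"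
    if "l < q" "d \<in> A" for l j b d
  proof -
    let ?s = "\<Sum>t<q. scale (v t (e j * b)) (e t)"
    have "v l ((e j * b - ?s) * d) = 0"
      using vA[OF that(1)] mult_in[OF expand that(2)] by blast
    then have "v l (e j * b * d) = v l (?s * d)"
      by (simp add: left_diff_distrib linD[OF v])
    also have "\<dots> = (\<Sum>t<q. v t (e j * b) * v l (e t * d))"
      by (simp add: sum_distrib_right scale_mult_left lin_sum[OF v] linD[OF v])
    finally show ?thesis by (simp add: mult.assoc)
  qed
  show ?thesis
    unfolding representation_of_def
  proof (intro conjI allI impI ballI)
    show "lin scale (*) (\<lambda>x. tensor_quotient_rep e v q \<sigma> x i j)" for i j
      unfolding tensor_quotient_rep_def by (rule D_lin[OF form lin_id])
    show "tensor_quotient_rep e v q \<sigma> 1 I J = (if I = J then 1 else 0)" if "I < p * q" "J < p * q" for I J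
    proof -
      have q: "0 < q" using that by (auto intro: gr0I)
      have "tensor_quotient_rep e v q \<sigma> 1 I J = \<sigma> 1 (I div q) (J div q) * v (J mod q) (e (I mod q) * 1)"
        unfolding tensor_quotient_rep_def by (rule D_one[OF form])
      also have "\<dots> = (if I div q = J div q \<and> J mod q = I mod q then 1 else 0)"
        using \<sigma> that q by (auto simp: representation_of_def less_mult_imp_div_less ve)
      also have "I div q = J div q \<and> J mod q = I mod q \<longleftrightarrow> I = J"
        by (metis div_mult_mod_eq)
      finally show ?thesis .
    qed
    show "tensor_quotient_rep e v q \<sigma> (x * y) I J =
        (\<Sum>L<p * q. tensor_quotient_rep e v q \<sigma> x I L * tensor_quotient_rep e v q \<sigma> y L J)"
      if xy: "x \<in> A" "y \<in> A" and IJ: "I < p * q" "J < p * q" for x y I J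
    proof -
      have q: "0 < q" using IJ by (auto intro: gr0I)
      have div: "I div q < p" "J div q < p" "J mod q < q" using IJ q by (auto simp: less_mult_imp_div_less)
      have "tensor_quotient_rep e v q \<sigma> (x * y) I J =
          (\<Sum>(a, b)\<leftarrow>D x. \<Sum>(c, d)\<leftarrow>D y. \<sigma> (a * c) (I div q) (J div q) * v (J mod q) (e (I mod q) * (b * d)))"
        unfolding tensor_quotient_rep_def by (rule D_mult[OF form xy])
      also have "\<dots> = (\<Sum>(a, b)\<leftarrow>D x. \<Sum>(c, d)\<leftarrow>D y. \<Sum>k<p. \<Sum>l<q.
          (\<sigma> a (I div q) k * v l (e (I mod q) * b)) * (\<sigma> c k (J div q) * v (J mod q) (e l * d)))"
      proof (intro sum_list_cong2)
        fix a b c d assume "(a, b) \<in> set (D x)" "(c, d) \<in> set (D y)"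
        then have "a \<in> A" "c \<in> A" "d \<in> A" by (auto intro: D_in)
        then have "\<sigma> (a * c) (I div q) (J div q) = (\<Sum>k<p. \<sigma> a (I div q) k * \<sigma> c k (J div q))"
          using \<sigma> div by (simp add: representation_of_def)
        then show "\<sigma> (a * c) (I div q) (J div q) * v (J mod q) (e (I mod q) * (b * d)) = (\<Sum>k<p. \<Sum>l<q.
          (\<sigma> a (I div q) k * v l (e (I mod q) * b)) * (\<sigma> c k (J div q) * v (J mod q) (e l * d)))"
          using v_mult[OF div(3) \<open>d \<in> A\<close>] by (simp add: sum_product mult_ac)
      qed
      also have "\<dots> = (\<Sum>k<p. \<Sum>l<q. \<Sum>(a, b)\<leftarrow>D x. \<Sum>(c, d)\<leftarrow>D y.
          (\<sigma> a (I div q) k * v l (e (I mod q) * b)) * (\<sigma> c k (J div q) * v (J mod q) (e l * d)))"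
        by (simp only: sum_list_sum_swap2)
      also have "\<dots> = (\<Sum>k<p. \<Sum>l<q. (\<Sum>(a, b)\<leftarrow>D x. \<sigma> a (I div q) k * v l (e (I mod q) * b)) *
          (\<Sum>(c, d)\<leftarrow>D y. \<sigma> c k (J div q) * v (J mod q) (e l * d)))"
        by (simp add: case_prod_unfold sum_list_const_mult sum_list_mult_const)
      also have "\<dots> = (\<Sum>L<p * q. tensor_quotient_rep e v q \<sigma> x I L * tensor_quotient_rep e v q \<sigma> y L J)"
        unfolding tensor_quotient_rep_def
        by (rule sum_div_mod[symmetric, where g = "\<lambda>k l. (\<Sum>(a, b)\<leftarrow>D x. \<sigma> a (I div q) k * v l (e (I mod q) * b)) *
          (\<Sum>(c, d)\<leftarrow>D y. \<sigma> c k (J div q) * v (J mod q) (e l * d))"])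
      finally show ?thesis .
    qed
  qed
qed

end

lemma sum_lessThan_add: "(\<Sum>j<d + q :: nat. f j) = (\<Sum>j<d. f j) + (\<Sum>j<q. f (d + j) :: 'b::comm_monoid_add)"
  by (induction q) (simp_all add: add.assoc)

context projected_quasibialgebra begin

text \<open>
The coaction turns \<open>\<Theta>\<close> into an \<open>A\<close>-linear map from \<open>M\<close> to \<open>X \<otimes> H\<^sup>*\<close>, because it is linear for the
diagonal left action.
\<close>

lemma coaction_transform:
  assumes sub_comult: "\<And>x. x \<in> A \<Longrightarrow> tensor2_eq scale UNIV scale UNIV (\<Delta> x) (\<Delta>H x)"
    and M: "hopf_module scale \<Delta>H \<epsilon> \<phi>H A scaleM lact ract \<delta>"
    and \<Theta>: "\<And>i. bilin scaleM scale (\<lambda>m y. \<Theta> m y i)"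
    and \<Theta>_lact: "\<And>x m y i. x \<in> A \<Longrightarrow> i < p \<Longrightarrow> \<Theta> (lact x m) y i = mat_act p \<sigma> x (\<Theta> m y) i"
  defines "F \<equiv> \<lambda>m y i. \<Sum>(n, h)\<leftarrow>\<delta> m. \<Theta> n (y * h) i"
  shows "bilin scaleM scale (\<lambda>m y. F m y i)"
    and "x \<in> A \<Longrightarrow> i < p \<Longrightarrow> F (lact x m) y i = (\<Sum>(a, b)\<leftarrow>D x. mat_act p \<sigma> a (F m (y * b)) i)"
proof -
  interpret M: hopf_module scale \<Delta>H \<epsilon> \<phi>H A scaleM lact ract \<delta> by fact
  have form: "bilin scaleM scale (\<lambda>n h. \<Theta> n (y * h) i)" for y i
    by (intro bilinI bilinD[OF \<Theta>] lin_intros lin_id[of scaleM])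
  have hom: "\<Theta> (scaleM c n) y i = c * \<Theta> n y i" for c n y i
    using \<Theta>[of i] by (simp add: bilin_def lin_def)
  have "lin scaleM (*) (\<lambda>m. F m y i)" for y
  proof -
    have "F (m + m') y i = F m y i + F m' y i" for m m'
      using tensor2_eq_evaluate[OF M.coact_add form[of y i]] by (simp add: F_def)
    moreover have "F (scaleM c m) y i = c * F m y i" for c m
      using tensor2_eq_evaluate[OF M.coact_scale form[of y i]]
      by (simp add: F_def tensor_sum_simps hom sum_list_const_mult)
    ultimately show ?thesis by (simp add: lin_def)
  qed
  moreover have "lin scale (*) (\<lambda>y. F m y i)" for m
    unfolding F_def by (intro lin_intros bilinD(2)[OF \<Theta>])
  ultimately show "bilin scaleM scale (\<lambda>m y. F m y i)"
    by (rule bilinI)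
  assume x: "x \<in> A" and i: "i < p"
  have "set (D x) \<subseteq> A \<times> A" "tensor2_eq scale UNIV scale UNIV (D x) (\<Delta>H x)"
    using comult_closed[OF x] sub_comult[OF x] by (simp_all add: D_eq x)
  from tensor2_eq_evaluate[OF M.coact_lact[OF x this] form[of y i]]
  have "F (lact x m) y i = (\<Sum>(a, b)\<leftarrow>D x. \<Sum>(n, h)\<leftarrow>\<delta> m. \<Theta> (lact a n) (y * (b * h)) i)"
    by (simp add: F_def tensor_sum_simps)
  also have "\<dots> = (\<Sum>(a, b)\<leftarrow>D x. mat_act p \<sigma> a (F m (y * b)) i)"
    unfolding F_def mat_act_sum_list2
    by (intro sum_list_cong2) (simp add: \<Theta>_lact i D_in mult.assoc)
  finally show "F (lact x m) y i = (\<Sum>(a, b)\<leftarrow>D x. mat_act p \<sigma> a (F m (y * b)) i)" .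
qed

text \<open>
An \<open>A\<close>-linear map to \<open>X \<otimes> H\<^sup>*\<close> that vanishes on \<open>M \<times> A\<close> takes values in \<open>X \<otimes> (H/A)\<^sup>*\<close>.
\<close>

lemma quotient_hom:
  assumes v: "\<And>j. lin scale (*) (v j)"
    and expand: "\<And>y. y - (\<Sum>j<q. scale (v j y) (e j)) \<in> A"
    and F: "\<And>i. bilin scaleM scale (\<lambda>m y. F m y i)"
    and F_lact: "\<And>x m y i. x \<in> A \<Longrightarrow> i < p \<Longrightarrow>
      F (lact x m) y i = (\<Sum>(a, b)\<leftarrow>D x. mat_act p \<sigma> a (F m (y * b)) i)"
    and F_zero: "\<And>m y i. y \<in> A \<Longrightarrow> i < p \<Longrightarrow> F m y i = 0"
  shows "(\<lambda>(m, I). if I < p * q then F m (e (I mod q)) (I div q) else 0) \<in>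
           homs A UNIV scaleM lact (p * q) (tensor_quotient_rep e v q \<sigma>)"
    and "i < p \<Longrightarrow> F m y i = (\<Sum>j<q. v j y * F m (e j) i)"
proof -
  have F1: "lin scaleM (*) (\<lambda>m. F m y i)" and F2: "lin scale (*) (\<lambda>y. F m y i)" for m y i
    using F[of i] by (simp_all add: bilin_def)
  show expand_F: "F m y i = (\<Sum>j<q. v j y * F m (e j) i)" if "i < p" for m y i
    using F_zero[OF expand[of y] that, of m] by (simp add: linD[OF F2] lin_sum_scaled[OF F2])
  show "(\<lambda>(m, I). if I < p * q then F m (e (I mod q)) (I div q) else 0) \<in>
           homs A UNIV scaleM lact (p * q) (tensor_quotient_rep e v q \<sigma>)"
    unfolding homs_def
  proof (intro CollectI conjI allI ballI impI)
    fix x m I assume x: "x \<in> A" and I: "I < p * q"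
    then have i: "I div q < p" by (simp add: less_mult_imp_div_less)
    let ?i = "I div q" and ?e = "e (I mod q)"
    have "F (lact x m) ?e ?i = (\<Sum>(a, b)\<leftarrow>D x. \<Sum>k<p. \<Sum>l<q. \<sigma> a ?i k * v l (?e * b) * F m (e l) k)"
      unfolding F_lact[OF x i]
    proof (intro sum_list_cong2)
      fix a b
      have "mat_act p \<sigma> a (F m (?e * b)) ?i = (\<Sum>k<p. \<sigma> a ?i k * F m (?e * b) k)"
        using i by (simp add: mat_act_def)
      also have "\<dots> = (\<Sum>k<p. \<sigma> a ?i k * (\<Sum>l<q. v l (?e * b) * F m (e l) k))"
        by (intro sum.cong refl arg_cong2[where f = "(*)"] expand_F) simp
      finally show "mat_act p \<sigma> a (F m (?e * b)) ?i = (\<Sum>k<p. \<Sum>l<q. \<sigma> a ?i k * v l (?e * b) * F m (e l) k)"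
        by (simp add: sum_distrib_left mult.assoc)
    qed
    also have "\<dots> = (\<Sum>k<p. \<Sum>l<q. (\<Sum>(a, b)\<leftarrow>D x. \<sigma> a ?i k * v l (?e * b)) * F m (e l) k)"
      by (simp only: sum_list_sum_swap2) (simp add: case_prod_unfold sum_list_mult_const)
    also have "\<dots> = (\<Sum>L<p * q. tensor_quotient_rep e v q \<sigma> x I L * F m (e (L mod q)) (L div q))"
      unfolding tensor_quotient_rep_def
      by (rule sum_div_mod[symmetric, where g = "\<lambda>k l. (\<Sum>(a, b)\<leftarrow>D x. \<sigma> a ?i k * v l (?e * b)) * F m (e l) k"])
    finally show "(case (lact x m, I) of (m, I) \<Rightarrow> if I < p * q then F m (e (I mod q)) (I div q) else 0) =
      mat_act (p * q) (tensor_quotient_rep e v q \<sigma>) x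
        (\<lambda>j. case (m, j) of (m, I) \<Rightarrow> if I < p * q then F m (e (I mod q)) (I div q) else 0) I"
      using I by (simp add: mat_act_def)
  qed (auto simp: linD[OF F1])
qed

text \<open>
The unknowns are the coefficients of an element of \<open>Hom\<^sub>A(M, X) \<otimes> H\<^sup>*\<close>.  The equations express that its image in
\<open>Hom\<^sub>A(M, X \<otimes> H\<^sup>*)\<close> vanishes: first that its restriction to \<open>M \<times> A\<close> is \<open>0\<close>, by the \<open>dim M dim X\<close> conditions
from \<open>restriction_determined\<close>, and then that the resulting homomorphism to \<open>X \<otimes> (H/A)\<^sup>*\<close> is \<open>0\<close>.  The only
solution is \<open>0\<close>, by \<open>coaction_separates\<close>.
\<close>

lemma hom_dim_inequality:
  fixes lact :: "'a \<Rightarrow> 'm::ab_group_add \<Rightarrow> 'm"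
  assumes H: "quasiantipode scale UNIV \<Delta>H \<epsilon> \<phi>H S \<alpha> \<beta>"
    and sub_comult: "\<And>x. x \<in> A \<Longrightarrow> tensor2_eq scale UNIV scale UNIV (\<Delta> x) (\<Delta>H x)"
    and sub_assoc: "tensor3_eq scale UNIV scale UNIV scale UNIV \<phi> \<phi>H"
    and K: "quasiantipode scale A \<Delta> \<epsilon> \<phi> S' \<alpha>' \<beta>'"
    and M: "hopf_module scale \<Delta>H \<epsilon> \<phi>H A scaleM lact ract \<delta>"
    and finH: "finite BH" "span BH = UNIV"
    and finM: "finite BM" "module.span scaleM BM = UNIV"
    and \<sigma>: "representation_of A p \<sigma>"
  shows "\<exists>\<sigma>'. representation_of A (p * (dim UNIV - dim A)) \<sigma>' \<and>
    dim (UNIV :: 'a set) * hom_dim A UNIV scaleM lact p \<sigma> \<le>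
      vector_space.dim scaleM UNIV * p + hom_dim A UNIV scaleM lact (p * (dim UNIV - dim A)) \<sigma>'"
proof -
  interpret M: hopf_module scale \<Delta>H \<epsilon> \<phi>H A scaleM lact ract \<delta> by fact
  let ?n = "dim (UNIV :: 'a set)" and ?d = "dim A" and ?N = "M.dim UNIV"
  define q where "q = ?n - ?d"
  have A: "subspace A" using subalgebra by (simp add: unital_subalgebra_def)
  obtain e v where dn: "?d \<le> ?n"
    and eA: "\<And>j. j < ?d \<Longrightarrow> e j \<in> A" and v: "\<And>j. lin scale (*) (v j)"
    and ve: "\<And>i j. i < ?n \<Longrightarrow> j < ?n \<Longrightarrow> v i (e j) = (if i = j then 1 else 0)"
    and y_eq: "\<And>y. y = (\<Sum>j<?n. scale (v j y) (e j))"
    and vA: "\<And>x j. x \<in> A \<Longrightarrow> ?d \<le> j \<Longrightarrow> j < ?n \<Longrightarrow> v j x = 0"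
    by (rule adapted_basis[OF subspace_UNIV A subset_UNIV finH(1)]) (use finH(2) in auto)
  define e' v' where "e' j = e (?d + j)" and "v' j = v (?d + j)" for j
  have n_eq: "?n = ?d + q" using dn by (simp add: q_def)
  have expand: "y - (\<Sum>j<q. scale (v' j y) (e' j)) \<in> A" for y
  proof -
    have "y = (\<Sum>j<?d + q. scale (v j y) (e j))" using y_eq[of y] by (simp only: n_eq)
    also have "\<dots> = (\<Sum>j<?d. scale (v j y) (e j)) + (\<Sum>j<q. scale (v' j y) (e' j))"
      by (simp add: sum_lessThan_add e'_def v'_def)
    finally have "y - (\<Sum>j<q. scale (v' j y) (e' j)) = (\<Sum>j<?d. scale (v j y) (e j))"
      by (simp add: algebra_simps)
    also have "\<dots> \<in> A" by (intro subspace_sum[OF A] subspace_scale[OF A]) (simp add: eA)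
    finally show ?thesis .
  qed
  have v'_lin: "lin scale (*) (v' j)" for j by (simp add: v'_def v)
  define \<sigma>' where "\<sigma>' = tensor_quotient_rep e' v' q \<sigma>"
  have \<sigma>': "representation_of A (p * q) \<sigma>'"
    unfolding \<sigma>'_def
  proof (rule tensor_quotient_representation[OF \<sigma> v'_lin _ _ expand])
    show "v' i (e' j) = (if i = j then 1 else 0)" if "i < q" "j < q" for i j
      using ve[of "?d + i" "?d + j"] that by (simp add: e'_def v'_def n_eq)
    show "v' j x = 0" if "j < q" "x \<in> A" for j x
      using vA[OF that(2), of "?d + j"] that(1) by (simp add: v'_def n_eq)
  qed
  let ?homs = "homs A UNIV scaleM lact p \<sigma>" and ?homs' = "homs A UNIV scaleM lact (p * q) \<sigma>'"
  let ?h = "hom_dim A UNIV scaleM lact p \<sigma>" and ?h' = "hom_dim A UNIV scaleM lact (p * q) \<sigma>'"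
  have finM': "UNIV \<subseteq> M.span BM" using finM(2) by simp
  obtain b w where b: "\<And>a. a < ?h \<Longrightarrow> b a \<in> ?homs" and w: "\<And>a. lin function_scale (*) (w a)"
    and wb: "\<And>a a'. a < ?h \<Longrightarrow> a' < ?h \<Longrightarrow> w a (b a') = (if a = a' then 1 else 0)"
    by (rule M.homs_basis[OF M.subspace_UNIV finM(1) finM', where K = A and act = lact and p = p and \<sigma> = \<sigma>], rule that)
  obtain b' w' where w': "\<And>a. lin function_scale (*) (w' a)"
    and b': "\<And>f. f \<in> ?homs' \<Longrightarrow> f = (\<Sum>a<?h'. function_scale (w' a f) (b' a))"
    by (rule M.homs_basis[OF M.subspace_UNIV finM(1) finM', where K = A and act = lact and p = "p * q" and \<sigma> = \<sigma>'], rule that)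
  obtain eM vM where m_eq: "\<And>m. m = (\<Sum>s<?N. scaleM (vM s m) (eM s))"
    by (rule M.basis_of_subspace[OF M.subspace_UNIV finM(1) finM']) auto
  let ?I = "{..<?n} \<times> {..<?h}" and ?J = "({..<?N} \<times> {..<p}) <+> {..<?h'}"
  \<comment> \<open>\<open>Fb\<close> lists the images of the basis elements, \<open>R\<close> is the map that detects the restriction to \<open>M \<times> A\<close>, and \<open>G\<close> passes to the quotient.\<close>
  define Fb where "Fb \<iota> m y i = (\<Sum>(x, g)\<leftarrow>\<delta> m. v (fst \<iota>) (y * g) * b (snd \<iota>) (x, i))" for \<iota> m y i
  define R where "R F m i = (\<Sum>(x, y, z)\<leftarrow>\<psi>. mat_act p \<sigma> (S' x * \<alpha>' * y) (F m z) i)"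
    for F :: "'m \<Rightarrow> 'a \<Rightarrow> nat \<Rightarrow> 'k" and m i
  define G where "G F = (\<lambda>(m, I). if I < p * q then F m (e' (I mod q)) (I div q) else 0)"
    for F :: "'m \<Rightarrow> 'a \<Rightarrow> nat \<Rightarrow> 'k"
  let ?A = "\<lambda>j \<iota>. case j of Inl si \<Rightarrow> R (Fb \<iota>) (eM (fst si)) (snd si) | Inr z \<Rightarrow> w' z (G (Fb \<iota>))"
  have "card ?I \<le> card ?J"
  proof (rule injective_matrix_card_le[where A = ?A])
    fix c \<iota> assume rows: "\<And>j. j \<in> ?J \<Longrightarrow> (\<Sum>\<iota>\<in>?I. ?A j \<iota> * c \<iota>) = 0" and \<iota>: "\<iota> \<in> ?I"
    define \<Theta> where "\<Theta> m y i = (\<Sum>\<iota>\<in>?I. c \<iota> * (v (fst \<iota>) y * b (snd \<iota>) (m, i)))" for m y i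
    define F where "F m y i = (\<Sum>(x, g)\<leftarrow>\<delta> m. \<Theta> x (y * g) i)" for m y i
    have F_eq: "F m y i = (\<Sum>\<iota>\<in>?I. c \<iota> * Fb \<iota> m y i)" for m y i
      by (simp add: F_def \<Theta>_def Fb_def sum_list_sum_swap2 sum_list_mult_const2)
    have b_lin: "lin scaleM (*) (\<lambda>m. b a (m, i))" if "a < ?h" for a i
      using b[OF that] by (simp add: homs_def lin_def)
    have \<Theta>_bilin: "bilin scaleM scale (\<lambda>m y. \<Theta> m y i)" for i
      unfolding \<Theta>_def by (intro bilinI lin_form_intros b_lin v) auto
    have \<Theta>_lact: "\<Theta> (lact x m) y i = mat_act p \<sigma> x (\<Theta> m y) i" if "x \<in> A" "i < p" for x m y i
    proof -
      have "mat_act p \<sigma> x (\<Theta> m y) i = (\<Sum>\<iota>\<in>?I. c \<iota> * (v (fst \<iota>) y * mat_act p \<sigma> x (\<lambda>i. b (snd \<iota>) (m, i)) i))"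
        unfolding \<Theta>_def mat_act_sum mat_act_scale ..
      also have "\<dots> = \<Theta> (lact x m) y i"
        unfolding \<Theta>_def using b that by (intro sum.cong) (auto simp: homs_def)
      finally show ?thesis by simp
    qed
    have F_bilin: "bilin scaleM scale (\<lambda>m y. F m y i)" for i
      unfolding F_def by (rule coaction_transform(1)[OF sub_comult M \<Theta>_bilin \<Theta>_lact])
    have F_lact: "F (lact x m) y i = (\<Sum>(a, b)\<leftarrow>D x. mat_act p \<sigma> a (F m (y * b)) i)"
      if "x \<in> A" "i < p" for x m y i
      unfolding F_def by (rule coaction_transform(2)[OF sub_comult M \<Theta>_bilin \<Theta>_lact that])
    have R_zero: "R F m i = 0" if "i < p" for m i
    proof -
      have lin: "lin scaleM (*) (\<lambda>m. R F m i)"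
        unfolding R_def by (intro lin_form_intros mat_act_lin_vector bilinD(1)[OF F_bilin] lin_id)
      have "R F (eM s) i = 0" if "s < ?N" for s
      proof -
        have "R F (eM s) i = (\<Sum>\<iota>\<in>?I. c \<iota> * R (Fb \<iota>) (eM s) i)"
          by (simp add: R_def F_eq[abs_def] mat_act_sum mat_act_scale case_prod_unfold
              sum_list_sum_swap sum_list_const_mult)
        also have "\<dots> = 0"
          using rows[OF InlI, of "(s, i)"] that \<open>i < p\<close> by (simp add: mult.commute)
        finally show ?thesis .
      qed
      then have "R F (\<Sum>s<?N. scaleM (vM s m) (eM s)) i = 0"
        by (simp add: lin_sum_scaled[OF lin])
      then show ?thesis using m_eq by simp
    qed
    have F_zero: "F m y i = 0" if "y \<in> A" "i < p" for m y i
      by (rule restriction_determined[OF K M.bimodule_over_axioms \<sigma> F_bilin F_lact R_zero[unfolded R_def] that])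
    have "G F \<in> ?homs'"
      unfolding G_def \<sigma>'_def by (rule quotient_hom(1)[OF v'_lin expand F_bilin F_lact F_zero])
    moreover have "w' z (G F) = 0" if "z < ?h'" for z
    proof -
      have "G F = (\<Sum>\<iota>\<in>?I. function_scale (c \<iota>) (G (Fb \<iota>)))"
        by (auto simp: fun_eq_iff sum_fun_apply G_def function_scale_def F_eq)
      then have "w' z (G F) = (\<Sum>\<iota>\<in>?I. c \<iota> * w' z (G (Fb \<iota>)))"
        by (simp add: lin_sum_scaled[OF w'])
      also have "\<dots> = 0" using rows[OF InrI, of z] that by (simp add: mult.commute)
      finally show ?thesis .
    qed
    moreover from this have "(\<Sum>a<?h'. function_scale (w' a (G F)) (b' a)) = 0" by (intro sum.neutral) auto
    ultimately have "G F = 0" using b' by metis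
    then have F_e: "F m (e' l) k = 0" if "k < p" "l < q" for m k l
    proof -
      have "k * q + l < Suc k * q" using that by simp
      also have "\<dots> \<le> p * q" using that by (intro mult_le_mono1) simp
      finally have "k * q + l < p * q" .
      moreover have "G F (m, k * q + l) = 0" using \<open>G F = 0\<close> by simp
      ultimately show ?thesis using that by (simp add: G_def)
    qed
    have "F m y i = 0" if "i < p" for m y i
      using quotient_hom(2)[OF v'_lin expand F_bilin F_lact F_zero that, of m y] F_e[OF that] by simp
    then have \<Theta>_zero: "\<Theta> m y i = 0" if "i < p" for m y i
      unfolding F_def by (intro coaction_separates[OF H sub_comult sub_assoc M \<sigma> \<Theta>_bilin \<Theta>_lact _ that])
    obtain t a where ta: "\<iota> = (t, a)" "t < ?n" "a < ?h" using \<iota> by auto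
    have "(\<Sum>a<?h. function_scale (c (t, a)) (b a)) = 0"
    proof
      fix mi :: "'m \<times> nat" obtain m i where mi: "mi = (m, i)" by fastforce
      show "(\<Sum>a<?h. function_scale (c (t, a)) (b a)) mi = 0 mi"
      proof (cases "i < p")
        case True
        have "0 = \<Theta> m (e t) i" using \<Theta>_zero True by simp
        also have "\<dots> = (\<Sum>t'<?n. \<Sum>a<?h. c (t', a) * (v t' (e t) * b a (m, i)))"
          by (simp add: \<Theta>_def sum.cartesian_product case_prod_unfold)
        also have "\<dots> = (\<Sum>t'<?n. if t' = t then \<Sum>a<?h. c (t, a) * b a (m, i) else 0)"
          using ta by (intro sum.cong) (auto simp: ve)
        also have "\<dots> = (\<Sum>a<?h. c (t, a) * b a (m, i))" using ta by simp
        finally show ?thesis by (simp add: mi sum_fun_apply function_scale_def)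
      next
        case False
        then show ?thesis using b by (auto simp: mi sum_fun_apply function_scale_def homs_def intro!: sum.neutral)
      qed
    qed
    then have "0 = w a (\<Sum>a<?h. function_scale (c (t, a)) (b a))"
      by (simp add: linD(3)[OF w])
    also have "\<dots> = (\<Sum>a'<?h. c (t, a') * w a (b a'))" by (rule lin_sum_scaled[OF w])
    also have "\<dots> = (\<Sum>a'<?h. if a' = a then c (t, a) else 0)"
      using ta by (intro sum.cong) (auto simp: wb)
    also have "\<dots> = c (t, a)" using ta by simp
    finally show "c \<iota> = 0" using ta by simp
  qed auto
  then have "?n * ?h \<le> ?N * p + ?h'" by (simp add: card_Plus)
  with \<sigma>' show ?thesis unfolding q_def by blast
qed

end

section \<open>Generation and freeness by counting homomorphisms\<close>

text \<open>
Since the second step replaces \<open>r\<close> by some \<open>r'\<close> with \<open>p r' = p r * (n - d)\<close>, the supremum \<open>c\<close> of the ratios \<open>h r / p r\<close>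
satisfies \<open>n c \<le> N + c (n - d)\<close>.
\<close>

lemma ratio_bound:
  fixes h p :: "'r \<Rightarrow> nat"
  assumes bound: "\<And>r. r \<in> R \<Longrightarrow> h r \<le> N * p r"
    and step: "\<And>r. r \<in> R \<Longrightarrow> \<exists>r'\<in>R. p r' = p r * (n - d) \<and> n * h r \<le> N * p r + h r'"
    and dn: "d \<le> n" and r: "r \<in> R"
  shows "d * h r \<le> N * p r"
proof (cases "p r = 0 \<or> d = 0")
  case True
  then show ?thesis using bound[OF r] by auto
next
  case False
  define Q where "Q = {real (h r) / real (p r) | r. r \<in> R \<and> p r > 0}"
  have Q: "x \<le> real N" if "x \<in> Q" for x
  proof -
    obtain r where x: "x = real (h r) / real (p r)" "r \<in> R" "p r > 0" using \<open>x \<in> Q\<close> by (auto simp: Q_def)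
    have "real (h r) \<le> real (N * p r)" using bound[OF x(2)] of_nat_le_iff by blast
    then show ?thesis using x by (simp add: pos_divide_le_eq)
  qed
  then have bdd: "bdd_above Q" by (meson bdd_above.I)
  define c where "c = Sup Q"
  have h_le: "real (h r) \<le> c * real (p r)" if "r \<in> R" for r
  proof (cases "p r = 0")
    case True then show ?thesis using bound[OF that] by simp
  next
    case False
    then have "real (h r) / real (p r) \<le> c"
      unfolding c_def by (intro cSup_upper bdd) (use that in \<open>auto simp: Q_def\<close>)
    then show ?thesis using False by (simp add: pos_divide_le_eq)
  qed
  have "x \<le> (real N + c * real (n - d)) / real n" if "x \<in> Q" for x
  proof -
    obtain r where x: "x = real (h r) / real (p r)" "r \<in> R" "p r > 0" using \<open>x \<in> Q\<close> by (auto simp: Q_def)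
    obtain r' where r': "r' \<in> R" "p r' = p r * (n - d)" "n * h r \<le> N * p r + h r'"
      using step[OF x(2)] by blast
    have "real n * real (h r) \<le> real N * real (p r) + real (h r')"
      using r'(3) by (metis of_nat_add of_nat_le_iff of_nat_mult)
    also have "\<dots> \<le> real N * real (p r) + c * (real (p r) * real (n - d))"
      using h_le[OF r'(1)] r'(2) by simp
    also have "\<dots> = (real N + c * real (n - d)) * real (p r)" by (simp add: algebra_simps)
    finally have "real n * x * real (p r) \<le> (real N + c * real (n - d)) * real (p r)"
      using x(1,3) by simp
    then have "real n * x \<le> real N + c * real (n - d)" using x(3) by simp
    then show ?thesis using False dn by (simp add: pos_le_divide_eq mult.commute)
  qed
  then have "c \<le> (real N + c * real (n - d)) / real n"
    unfolding c_def by (intro cSup_least) (use r False in \<open>auto simp: Q_def\<close>)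
  then have "c * real n \<le> real N + c * (real n - real d)"
    using False dn by (simp add: field_simps of_nat_diff)
  then have "real d * c \<le> real N" by (simp add: algebra_simps)
  then have "real d * c * real (p r) \<le> real N * real (p r)" by (intro mult_right_mono) auto
  moreover have "real d * real (h r) \<le> real d * (c * real (p r))" by (intro mult_left_mono h_le r) auto
  ultimately have "real (d * h r) \<le> real (N * p r)" by simp
  then show ?thesis using of_nat_le_iff by blast
qed

text \<open>
A finite-dimensional left module over the subalgebra \<open>K\<close>, with carrier \<open>U\<close>.  A carrier is needed
for the powers of a module, whose exponent is a dimension and hence cannot be part of a type.
\<close>

locale finite_module = vector_space t
  for t :: "'k::field \<Rightarrow> 'm::ab_group_add \<Rightarrow> 'm" +
  fixes scale :: "'k \<Rightarrow> 'a::ring_1 \<Rightarrow> 'a"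
    and K :: "'a set" and P :: "'a \<Rightarrow> 'a"
    and act :: "'a \<Rightarrow> 'm \<Rightarrow> 'm" and U :: "'m set"
  assumes algebra: "k_algebra scale" and subalg: "unital_subalgebra scale K"
    and P_lin: "lin scale scale P" and P_in: "P x \<in> K" and P_id: "x \<in> K \<Longrightarrow> P x = x"
    and U: "subspace U" and finite_dim: "\<exists>F. finite F \<and> U \<subseteq> span F"
    and act_in: "x \<in> K \<Longrightarrow> m \<in> U \<Longrightarrow> act x m \<in> U"
    and act_add_left: "x \<in> K \<Longrightarrow> y \<in> K \<Longrightarrow> m \<in> U \<Longrightarrow> act (x + y) m = act x m + act y m"
    and act_add_right: "x \<in> K \<Longrightarrow> m \<in> U \<Longrightarrow> m' \<in> U \<Longrightarrow> act x (m + m') = act x m + act x m'"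
    and act_mult: "x \<in> K \<Longrightarrow> y \<in> K \<Longrightarrow> m \<in> U \<Longrightarrow> act (x * y) m = act x (act y m)"
    and act_scale: "x \<in> K \<Longrightarrow> m \<in> U \<Longrightarrow> act (scale c x) m = t c (act x m)"
    and act_one: "m \<in> U \<Longrightarrow> act 1 m = m"
begin

interpretation A: k_algebra scale by (rule algebra)

lemma K_sub: "A.subspace K" and K_one: "1 \<in> K" and K_mult: "x \<in> K \<Longrightarrow> y \<in> K \<Longrightarrow> x * y \<in> K"
  using subalg by (auto simp: unital_subalgebra_def)

lemmas K_closed = A.subspace_0[OF K_sub] A.subspace_add[OF K_sub] A.subspace_diff[OF K_sub]
  A.subspace_neg[OF K_sub] A.subspace_scale[OF K_sub] A.subspace_sum[OF K_sub] K_one K_mult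

lemma act_scale_right: "x \<in> K \<Longrightarrow> m \<in> U \<Longrightarrow> act x (t c m) = t c (act x m)"
  using act_mult[of x "scale c 1" m] act_scale[of 1 m c] act_scale[of x m c]
  by (simp add: K_closed A.scale_mult_right act_one)

lemma act_zero_left: "m \<in> U \<Longrightarrow> act 0 m = 0"
  using act_add_left[of 0 0 m] by (simp add: K_closed)

lemma act_zero_right: "x \<in> K \<Longrightarrow> act x 0 = 0"
  using act_add_right[of x 0 0] subspace_0[OF U] by simp

lemma act_sum_right: "x \<in> K \<Longrightarrow> (\<And>i. i \<in> I \<Longrightarrow> f i \<in> U) \<Longrightarrow> act x (\<Sum>i\<in>I. f i) = (\<Sum>i\<in>I. act x (f i))"
  by (induction I rule: infinite_finite_induct) (auto simp: act_zero_right act_add_right subspace_sum[OF U])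

lemma act_sum_left: "m \<in> U \<Longrightarrow> (\<And>i. i \<in> I \<Longrightarrow> f i \<in> K) \<Longrightarrow> act (\<Sum>i\<in>I. f i) m = (\<Sum>i\<in>I. act (f i) m)"
  by (induction I rule: infinite_finite_induct) (auto simp: act_zero_left act_add_left K_closed)

definition submodule :: "'m set \<Rightarrow> bool" where
  "submodule Q \<longleftrightarrow> subspace Q \<and> Q \<subseteq> U \<and> (\<forall>x\<in>K. \<forall>m\<in>Q. act x m \<in> Q)"

definition combination :: "nat \<Rightarrow> (nat \<Rightarrow> 'm) \<Rightarrow> (nat \<Rightarrow> 'a) \<Rightarrow> 'm" where
  "combination r g x = (\<Sum>i<r. act (x i) (g i))"

definition generates_modulo :: "nat \<Rightarrow> (nat \<Rightarrow> 'm) \<Rightarrow> 'm set \<Rightarrow> bool" where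
  "generates_modulo r g Q \<longleftrightarrow> (\<forall>i<r. g i \<in> U) \<and>
     (\<forall>m\<in>U. \<exists>x. (\<forall>i. x i \<in> K) \<and> m - combination r g x \<in> Q)"

lemma submoduleD:
  assumes "submodule Q"
  shows "subspace Q" "0 \<in> Q" "m \<in> Q \<Longrightarrow> m \<in> U" "x \<in> K \<Longrightarrow> m \<in> Q \<Longrightarrow> act x m \<in> Q"
    "m \<in> Q \<Longrightarrow> m' \<in> Q \<Longrightarrow> m + m' \<in> Q" "m \<in> Q \<Longrightarrow> m' \<in> Q \<Longrightarrow> m - m' \<in> Q" "m \<in> Q \<Longrightarrow> - m \<in> Q"
    "m \<in> Q \<Longrightarrow> t c m \<in> Q"
  using assms by (auto simp: submodule_def intro: subspace_0 subspace_add subspace_diff subspace_neg subspace_scale)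

lemma submodule_U: "submodule U"
  using U act_in by (simp add: submodule_def)

lemma submodule_zero: "submodule {0}"
  using subspace_0[OF U] by (simp add: submodule_def act_zero_right)

lemma combination_in: "(\<And>i. i < r \<Longrightarrow> g i \<in> U) \<Longrightarrow> (\<And>i. x i \<in> K) \<Longrightarrow> combination r g x \<in> U"
  unfolding combination_def by (intro subspace_sum[OF U]) (auto intro: act_in)

lemma combination_add: "(\<And>i. i < r \<Longrightarrow> g i \<in> U) \<Longrightarrow> (\<And>i. x i \<in> K) \<Longrightarrow> (\<And>i. y i \<in> K) \<Longrightarrow>
    combination r g (\<lambda>i. x i + y i) = combination r g x + combination r g y"
  by (simp add: combination_def act_add_left sum.distrib)

lemma combination_act: "(\<And>i. i < r \<Longrightarrow> g i \<in> U) \<Longrightarrow> (\<And>i. x i \<in> K) \<Longrightarrow> y \<in> K \<Longrightarrow>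
    combination r g (\<lambda>i. y * x i) = act y (combination r g x)"
  unfolding combination_def by (subst act_sum_right) (auto simp: act_mult intro: act_in)

lemma combination_scale: "(\<And>i. i < r \<Longrightarrow> g i \<in> U) \<Longrightarrow> (\<And>i. x i \<in> K) \<Longrightarrow>
    combination r g (\<lambda>i. scale c (x i)) = t c (combination r g x)"
  by (simp add: combination_def act_scale scale_sum_right)

lemma combination_diff: "(\<And>i. i < r \<Longrightarrow> g i \<in> U) \<Longrightarrow> (\<And>i. x i \<in> K) \<Longrightarrow> (\<And>i. y i \<in> K) \<Longrightarrow>
    combination r g (\<lambda>i. x i - y i) = combination r g x - combination r g y"
  using combination_add[of r g "\<lambda>i. x i - y i" y] by (simp add: K_closed)

lemma combination_single: "(\<And>i. i < r \<Longrightarrow> g i \<in> U) \<Longrightarrow> j < r \<Longrightarrow>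
    combination r g (\<lambda>i. if i = j then x else 0) = act x (g j)"
proof -
  assume g: "\<And>i. i < r \<Longrightarrow> g i \<in> U" and j: "j < r"
  have "combination r g (\<lambda>i. if i = j then x else 0) = (\<Sum>i<r. if i = j then act x (g j) else 0)"
    unfolding combination_def using g by (intro sum.cong) (auto simp: act_zero_left)
  then show ?thesis using j by simp
qed

lemma submodule_basis:
  assumes "submodule Q" "submodule W" "W \<subseteq> Q"
  obtains e v where "dim W \<le> dim Q"
    "\<And>j. j < dim Q \<Longrightarrow> e j \<in> Q" "\<And>j. j < dim W \<Longrightarrow> e j \<in> W"
    "\<And>j. lin t (*) (v j)"
    "\<And>i j. i < dim Q \<Longrightarrow> j < dim Q \<Longrightarrow> v i (e j) = (if i = j then 1 else 0)"
    "\<And>x. x \<in> Q \<Longrightarrow> x = (\<Sum>j<dim Q. t (v j x) (e j))"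
    "\<And>x j. x \<in> W \<Longrightarrow> dim W \<le> j \<Longrightarrow> j < dim Q \<Longrightarrow> v j x = 0"
proof -
  obtain F where F: "finite F" "U \<subseteq> span F" using finite_dim by blast
  have "Q \<subseteq> span F" using F(2) submoduleD(3)[OF assms(1)] by blast
  from adapted_basis[OF submoduleD(1)[OF assms(1)] submoduleD(1)[OF assms(2)] assms(3) F(1) this] that
  show ?thesis by blast
qed

lemma submodule_dim_less:
  assumes "submodule Q" "submodule W" "W \<subset> Q"
  shows "dim W < dim Q"
proof (rule ccontr)
  assume ge: "\<not> dim W < dim Q"
  obtain e v where e: "dim W \<le> dim Q" "\<And>j. j < dim W \<Longrightarrow> e j \<in> W"
    "\<And>x. x \<in> Q \<Longrightarrow> x = (\<Sum>j<dim Q. t (v j x) (e j))"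
    by (rule submodule_basis[OF assms(1,2)]) (use assms(3) in auto)
  have "Q \<subseteq> W"
  proof
    fix x assume "x \<in> Q"
    then have "x = (\<Sum>j<dim Q. t (v j x) (e j))" by (rule e)
    moreover have "(\<Sum>j<dim Q. t (v j x) (e j)) \<in> W"
      using ge e by (intro subspace_sum subspace_scale submoduleD(1)[OF assms(2)]) auto
    ultimately show "x \<in> W" by simp
  qed
  with assms(3) show False by auto
qed

text \<open>
If the generated submodule meets \<open>Q\<close> in more than \<open>W\<close>, then by maximality of \<open>W\<close> its intersection with \<open>Q\<close> and
\<open>W\<close> together span \<open>Q\<close>.
\<close>

lemma generates_modulo_maximal:
  assumes Q: "submodule Q" and W: "submodule W" "W \<subset> Q"
    and max: "\<And>V. submodule V \<Longrightarrow> W \<subseteq> V \<Longrightarrow> V \<subset> Q \<Longrightarrow> V = W"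
    and gen: "generates_modulo r g Q"
    and x: "\<And>i. x i \<in> K" "combination r g x \<in> Q" "combination r g x \<notin> W"
  shows "generates_modulo r g W"
proof -
  have g: "g i \<in> U" if "i < r" for i using gen that by (simp add: generates_modulo_def)
  define V where "V = {combination r g y + w | y w. (\<forall>i. y i \<in> K) \<and> combination r g y \<in> Q \<and> w \<in> W}"
  have zero: "combination r g (\<lambda>i. 0) = 0" by (simp add: combination_def act_zero_left g)
  have WQ: "w \<in> Q" if "w \<in> W" for w using that W(2) by auto
  have V: "submodule V"
    unfolding submodule_def
  proof (intro conjI ballI)
    show "subspace V"
    proof (rule subspaceI)
      show "0 \<in> V"
        unfolding V_def using submoduleD(2)[OF Q] submoduleD(2)[OF W(1)] zero
        by (intro CollectI exI[of _ "\<lambda>i. 0"] exI[of _ 0]) (simp add: K_closed)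
      show "a + b \<in> V" if "a \<in> V" "b \<in> V" for a b
      proof -
        obtain y w where a: "a = combination r g y + w" "\<forall>i. y i \<in> K" "combination r g y \<in> Q" "w \<in> W"
          using \<open>a \<in> V\<close> by (auto simp: V_def)
        obtain y' w' where b: "b = combination r g y' + w'" "\<forall>i. y' i \<in> K" "combination r g y' \<in> Q" "w' \<in> W"
          using \<open>b \<in> V\<close> by (auto simp: V_def)
        show ?thesis unfolding V_def
          by (intro CollectI exI[of _ "\<lambda>i. y i + y' i"] exI[of _ "w + w'"])
            (use a b in \<open>simp add: combination_add g K_closed submoduleD[OF Q] submoduleD[OF W(1)]\<close>)
      qed
      show "t c a \<in> V" if "a \<in> V" for c a
      proof -
        obtain y w where a: "a = combination r g y + w" "\<forall>i. y i \<in> K" "combination r g y \<in> Q" "w \<in> W"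
          using \<open>a \<in> V\<close> by (auto simp: V_def)
        show ?thesis unfolding V_def
          by (intro CollectI exI[of _ "\<lambda>i. scale c (y i)"] exI[of _ "t c w"])
            (use a in \<open>simp add: combination_scale g K_closed submoduleD[OF Q] submoduleD[OF W(1)] scale_right_distrib\<close>)
      qed
    qed
    show "V \<subseteq> U" using submoduleD(3)[OF Q] submoduleD(5)[OF Q] WQ by (auto simp: V_def)
    show "act z a \<in> V" if z: "z \<in> K" and "a \<in> V" for z a
    proof -
      obtain y w where a: "a = combination r g y + w" "\<forall>i. y i \<in> K" "combination r g y \<in> Q" "w \<in> W"
        using \<open>a \<in> V\<close> by (auto simp: V_def)
      have "act z a = combination r g (\<lambda>i. z * y i) + act z w"
        using a z by (simp add: combination_act g act_add_right submoduleD(3)[OF Q] submoduleD(3)[OF W(1)])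
      then show ?thesis unfolding V_def
        by (intro CollectI exI[of _ "\<lambda>i. z * y i"] exI[of _ "act z w"])
          (use a z in \<open>simp add: combination_act g K_closed submoduleD[OF Q] submoduleD[OF W(1)]\<close>)
    qed
  qed
  have "W \<subseteq> V"
  proof
    fix w assume "w \<in> W"
    then show "w \<in> V" unfolding V_def using submoduleD(2)[OF Q] zero
      by (intro CollectI exI[of _ "\<lambda>i. 0"] exI[of _ w]) (simp add: K_closed)
  qed
  moreover have "combination r g x \<in> V"
    unfolding V_def using x submoduleD(2)[OF W(1)]
    by (intro CollectI exI[of _ x] exI[of _ 0]) simp
  moreover have "V \<subseteq> Q" using submoduleD(5)[OF Q] WQ by (auto simp: V_def)
  ultimately have VQ: "V = Q" using max[OF V] x(3) by blast
  show ?thesis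
    unfolding generates_modulo_def
  proof (intro conjI allI impI ballI g)
    fix m assume "m \<in> U"
    then obtain y where y: "\<forall>i. y i \<in> K" "m - combination r g y \<in> Q"
      using gen by (auto simp: generates_modulo_def)
    then have "m - combination r g y \<in> V" by (simp add: VQ)
    then obtain z w where z: "m - combination r g y = combination r g z + w" "\<forall>i. z i \<in> K" "w \<in> W"
      unfolding V_def by blast
    have "m - combination r g (\<lambda>i. y i + z i) = w"
      using y z by (simp add: combination_add g algebra_simps)
    then show "\<exists>x. (\<forall>i. x i \<in> K) \<and> m - combination r g x \<in> W"
      using y z by (intro exI[of _ "\<lambda>i. y i + z i"]) (simp add: K_closed)
  qed
qed

text \<open>
The module \<open>Q/W\<close> as a matrix representation; \<open>b\<close> represents a basis and \<open>c\<close> gives the coordinates.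
\<close>

lemma subquotient_representation:
  assumes Q: "submodule Q" and W: "submodule W" "W \<subseteq> Q"
  obtains \<sigma> b c where "A.representation_of K (dim Q - dim W) \<sigma>"
    "\<And>j. j < dim Q - dim W \<Longrightarrow> b j \<in> Q" "\<And>j. lin t (*) (c j)"
    "\<And>i j. i < dim Q - dim W \<Longrightarrow> j < dim Q - dim W \<Longrightarrow> c i (b j) = (if i = j then 1 else 0)"
    "\<And>w j. j < dim Q - dim W \<Longrightarrow> w \<in> W \<Longrightarrow> c j w = 0"
    "\<And>q. q \<in> Q \<Longrightarrow> (\<And>j. j < dim Q - dim W \<Longrightarrow> c j q = 0) \<Longrightarrow> q \<in> W"
    "\<And>x q i. x \<in> K \<Longrightarrow> q \<in> Q \<Longrightarrow> i < dim Q - dim W \<Longrightarrow>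
      c i (act x q) = mat_act (dim Q - dim W) \<sigma> x (\<lambda>j. c j q) i"
proof -
  obtain e v where dWQ: "dim W \<le> dim Q"
    and eQ: "\<And>j. j < dim Q \<Longrightarrow> e j \<in> Q" and eW: "\<And>j. j < dim W \<Longrightarrow> e j \<in> W"
    and v: "\<And>j. lin t (*) (v j)"
    and ve: "\<And>i j. i < dim Q \<Longrightarrow> j < dim Q \<Longrightarrow> v i (e j) = (if i = j then 1 else 0)"
    and q_eq: "\<And>x. x \<in> Q \<Longrightarrow> x = (\<Sum>j<dim Q. t (v j x) (e j))"
    and vW: "\<And>x j. x \<in> W \<Longrightarrow> dim W \<le> j \<Longrightarrow> j < dim Q \<Longrightarrow> v j x = 0"
    by (rule submodule_basis[OF Q W], rule that)
  define p where "p = dim Q - dim W"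
  have dQ: "dim Q = dim W + p" using dWQ by (simp add: p_def)
  define b c where "b j = e (dim W + j)" and "c j = v (dim W + j)" for j
  have c_lin: "lin t (*) (c j)" for j by (simp add: c_def v)
  have bQ: "b j \<in> Q" if "j < p" for j using that by (simp add: b_def dQ eQ)
  have cb: "c i (b j) = (if i = j then 1 else 0)" if "i < p" "j < p" for i j
    using that ve[of "dim W + i" "dim W + j"] by (simp add: b_def c_def dQ)
  have cW: "c j w = 0" if "j < p" "w \<in> W" for j w
    using that vW[of w "dim W + j"] by (simp add: c_def dQ)
  have expand: "q - (\<Sum>j<p. t (c j q) (b j)) \<in> W" if "q \<in> Q" for q
  proof -
    have "q = (\<Sum>j<dim W + p. t (v j q) (e j))" using q_eq[OF that] by (simp only: dQ)
    also have "\<dots> = (\<Sum>j<dim W. t (v j q) (e j)) + (\<Sum>j<p. t (c j q) (b j))"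
      by (simp add: sum_lessThan_add b_def c_def)
    finally have "q - (\<Sum>j<p. t (c j q) (b j)) = (\<Sum>j<dim W. t (v j q) (e j))"
      by (simp add: algebra_simps)
    also have "\<dots> \<in> W" by (intro subspace_sum subspace_scale submoduleD(1)[OF W(1)]) (simp add: eW)
    finally show ?thesis .
  qed
  define \<sigma> where "\<sigma> x i j = (if j < p then c i (act (P x) (b j)) else 0)" for x i j
  have bU: "b j \<in> U" if "j < p" for j using submoduleD(3)[OF Q] bQ[OF that] by blast
  have c_act: "c i (act x q) = (\<Sum>j<p. \<sigma> x i j * c j q)" if x: "x \<in> K" and q: "q \<in> Q" and i: "i < p" for x q i
  proof -
    let ?s = "\<Sum>j<p. t (c j q) (b j)"
    have s: "?s \<in> U" by (intro subspace_sum subspace_scale U bU) simp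
    have qU: "q \<in> U" using submoduleD(3)[OF Q] q by blast
    have "act x q = act x (q - ?s) + act x ?s"
      using act_add_right[OF x _ s, of "q - ?s"] subspace_diff[OF U qU s] by simp
    moreover have "c i (act x (q - ?s)) = 0"
      by (intro cW i submoduleD(4)[OF W(1)] x expand q)
    ultimately have "c i (act x q) = c i (act x ?s)" by (simp add: linD[OF c_lin])
    also have "act x ?s = (\<Sum>j<p. t (c j q) (act x (b j)))"
      using x bU by (subst act_sum_right) (auto simp: act_scale_right subspace_scale[OF U])
    also have "c i \<dots> = (\<Sum>j<p. \<sigma> x i j * c j q)"
      using x by (simp add: lin_sum_scaled[OF c_lin] \<sigma>_def P_id mult.commute)
    finally show ?thesis .
  qed
  have \<sigma>: "A.representation_of K p \<sigma>"
    unfolding A.representation_of_def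
  proof (intro conjI allI impI ballI)
    show "lin scale (*) (\<lambda>x. \<sigma> x i j)" for i j
    proof (cases "j < p")
      case True
      have "lin scale t (\<lambda>x. act (P x) (b j))"
        using bU[OF True] by (simp add: lin_def linD[OF P_lin] act_add_left act_scale P_in)
      then show ?thesis using True lin_compose[OF c_lin] by (simp add: \<sigma>_def)
    qed (simp add: \<sigma>_def lin_def)
    show "\<sigma> 1 i j = (if i = j then 1 else 0)" if "i < p" "j < p" for i j
      using that by (simp add: \<sigma>_def P_id K_one act_one bU cb)
    show "\<sigma> (x * y) i j = (\<Sum>l<p. \<sigma> x i l * \<sigma> y l j)" if "x \<in> K" "y \<in> K" "i < p" "j < p" for x y i j
    proof -
      have "\<sigma> (x * y) i j = c i (act x (act y (b j)))"
        using that by (simp add: \<sigma>_def P_id K_mult act_mult bU)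
      also have "\<dots> = (\<Sum>l<p. \<sigma> x i l * c l (act y (b j)))"
        using that by (intro c_act submoduleD(4)[OF Q] bQ) auto
      finally show ?thesis using that by (simp add: \<sigma>_def P_id)
    qed
  qed
  show ?thesis
  proof (rule that[folded p_def])
    show "A.representation_of K p \<sigma>" by (rule \<sigma>)
    show "q \<in> W" if "q \<in> Q" "\<And>j. j < p \<Longrightarrow> c j q = 0" for q
      using expand[OF that(1)] that(2) by simp
    show "c i (act x q) = mat_act p \<sigma> x (\<lambda>j. c j q) i" if "x \<in> K" "q \<in> Q" "i < p" for x q i
      using c_act[OF that] that by (simp add: mat_act_def)
  qed (fact bQ c_lin cb cW)+
qed

lemma hom_family_card_le:
  assumes "finite I" and "\<And>i. i \<in> I \<Longrightarrow> f i \<in> homs K U t act p \<sigma>"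
    and "\<And>c i. (\<Sum>i\<in>I. function_scale (c i) (f i)) = 0 \<Longrightarrow> i \<in> I \<Longrightarrow> c i = 0"
  shows "card I \<le> hom_dim K U t act p \<sigma>"
proof -
  obtain F where F: "finite F" "U \<subseteq> span F" using finite_dim by blast
  obtain G where "finite G" "homs K U t act p \<sigma> \<subseteq> function_space.span G"
    by (rule homs_finite_dimensional[OF U F])
  then show ?thesis
    unfolding hom_dim_def
    by (rule function_space.independent_family_card_le[OF homs_subspace]) (fact assms)+
qed

text \<open>
A homomorphism to \<open>Q/W\<close> can be defined on generators.  If \<open>g\<close> generates modulo \<open>Q\<close>, every element has the
form \<open>combination r g x + q\<close>, and any \<open>\<tau>\<close> that is linear in \<open>(x, q)\<close> and maps the relations into \<open>W\<close> descends.
\<close>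

lemma presented_hom:
  assumes Q: "submodule Q" and gen: "generates_modulo r g Q"
    and c: "\<And>j. lin t (*) (c j)" and cW: "\<And>w j. j < p \<Longrightarrow> w \<in> W \<Longrightarrow> c j w = 0"
    and c_act: "\<And>x q i. x \<in> K \<Longrightarrow> q \<in> Q \<Longrightarrow> i < p \<Longrightarrow> c i (act x q) = mat_act p \<sigma> x (\<lambda>j. c j q) i"
    and \<tau>_in: "\<And>x q. (\<And>i. x i \<in> K) \<Longrightarrow> q \<in> Q \<Longrightarrow> \<tau> x q \<in> Q"
    and \<tau>_add: "\<And>x y q q'. (\<And>i. x i \<in> K) \<Longrightarrow> (\<And>i. y i \<in> K) \<Longrightarrow> q \<in> Q \<Longrightarrow> q' \<in> Q \<Longrightarrow>
      \<tau> (\<lambda>i. x i + y i) (q + q') = \<tau> x q + \<tau> y q'"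
    and \<tau>_act: "\<And>z x q. z \<in> K \<Longrightarrow> (\<And>i. x i \<in> K) \<Longrightarrow> q \<in> Q \<Longrightarrow> \<tau> (\<lambda>i. z * x i) (act z q) = act z (\<tau> x q)"
    and \<tau>_rel: "\<And>x q. (\<And>i. x i \<in> K) \<Longrightarrow> q \<in> Q \<Longrightarrow> combination r g x + q = 0 \<Longrightarrow> \<tau> x q \<in> W"
  obtains f where "f \<in> homs K U t act p \<sigma>"
    "\<And>x q i. (\<And>i. x i \<in> K) \<Longrightarrow> q \<in> Q \<Longrightarrow> i < p \<Longrightarrow> f (combination r g x + q, i) = c i (\<tau> x q)"
proof -
  have g: "g i \<in> U" if "i < r" for i using gen that by (simp add: generates_modulo_def)
  note comb = combination_add[of r g] combination_diff[of r g] combination_act[of r g] combination_in[of r g]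
  have unique: "c i (\<tau> x q) = c i (\<tau> y q')"
    if x: "\<And>i. x i \<in> K" and y: "\<And>i. y i \<in> K" and q: "q \<in> Q" "q' \<in> Q" and i: "i < p"
      and eq: "combination r g x + q = combination r g y + q'" for x y q q' i
  proof -
    have "combination r g (\<lambda>i. x i - y i) + (q - q') = 0"
      using eq x y by (simp add: comb g algebra_simps)
    then have "\<tau> (\<lambda>i. x i - y i) (q - q') \<in> W"
      using x y q by (intro \<tau>_rel) (auto intro: K_closed submoduleD[OF Q])
    then have "c i (\<tau> (\<lambda>i. x i - y i) (q - q')) = 0" by (rule cW[OF i])
    moreover have "\<tau> (\<lambda>i. (x i - y i) + y i) ((q - q') + q') = \<tau> (\<lambda>i. x i - y i) (q - q') + \<tau> y q'"
      using x y q by (intro \<tau>_add) (auto intro: K_closed submoduleD[OF Q])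
    ultimately show ?thesis by (simp add: linD[OF c])
  qed
  define X where "X m = (SOME x. (\<forall>i. x i \<in> K) \<and> m - combination r g x \<in> Q)" for m
  have X: "(\<forall>i. X m i \<in> K) \<and> m - combination r g (X m) \<in> Q" if "m \<in> U" for m
  proof -
    have "\<exists>x. (\<forall>i. x i \<in> K) \<and> m - combination r g x \<in> Q"
      using gen that by (simp add: generates_modulo_def)
    from someI_ex[OF this] show ?thesis by (simp add: X_def)
  qed
  define f where "f = (\<lambda>(m, i). if m \<in> U \<and> i < p then c i (\<tau> (X m) (m - combination r g (X m))) else 0)"
  have f_value: "f (combination r g x + q, i) = c i (\<tau> x q)" if x: "\<And>i. x i \<in> K" and q: "q \<in> Q" and i: "i < p" for x q i
  proof -
    let ?m = "combination r g x + q"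
    have m: "?m \<in> U" using x q g submoduleD(3)[OF Q] by (intro subspace_add[OF U] comb) auto
    show ?thesis using m i X[OF m] x q by (simp add: f_def) (intro unique, auto)
  qed
  have split: "\<exists>x q. (\<forall>i. x i \<in> K) \<and> q \<in> Q \<and> m = combination r g x + q" if "m \<in> U" for m
    using X[OF that] by (intro exI[of _ "X m"] exI[of _ "m - combination r g (X m)"]) auto
  have "f \<in> homs K U t act p \<sigma>"
    unfolding homs_def
  proof (intro CollectI conjI allI ballI impI)
    show "f (m, i) = 0" if "m \<notin> U \<or> \<not> i < p" for m i using that by (auto simp: f_def)
    show "f (m + m', i) = f (m, i) + f (m', i)" if "m \<in> U" "m' \<in> U" for m m' i
    proof (cases "i < p")
      case True
      obtain x q where x: "\<And>i. x i \<in> K" "q \<in> Q" "m = combination r g x + q" using split[OF \<open>m \<in> U\<close>] by blast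
      obtain y q' where y: "\<And>i. y i \<in> K" "q' \<in> Q" "m' = combination r g y + q'" using split[OF \<open>m' \<in> U\<close>] by blast
      have "m + m' = combination r g (\<lambda>i. x i + y i) + (q + q')"
        using x y by (simp add: comb g algebra_simps)
      then have "f (m + m', i) = c i (\<tau> (\<lambda>i. x i + y i) (q + q'))"
        using x y True by (simp only:) (intro f_value, auto intro: K_closed submoduleD[OF Q])
      also have "\<dots> = c i (\<tau> x q) + c i (\<tau> y q')"
        using x y by (simp add: \<tau>_add linD[OF c])
      finally show ?thesis using x y True by (simp add: f_value)
    qed (simp add: f_def)
    have act: "f (act z m, i) = c i (act z (\<tau> x q))"
      if "z \<in> K" "\<And>i. x i \<in> K" "q \<in> Q" "m = combination r g x + q" "i < p" for z m i x q
    proof -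
      have "act z m = combination r g (\<lambda>i. z * x i) + act z q"
        using that by (simp add: comb g act_add_right submoduleD(3)[OF Q])
      then have "f (act z m, i) = c i (\<tau> (\<lambda>i. z * x i) (act z q))"
        using that by (simp only:) (intro f_value, auto intro: K_closed submoduleD[OF Q])
      then show ?thesis using that by (simp add: \<tau>_act)
    qed
    show "f (t a m, i) = a * f (m, i)" if "m \<in> U" for a m i
    proof (cases "i < p")
      case True
      obtain x q where x: "\<And>i. x i \<in> K" "q \<in> Q" "m = combination r g x + q" using split[OF \<open>m \<in> U\<close>] by blast
      have scal: "act (scale a 1) n = t a n" if "n \<in> U" for n
        using act_scale[of 1 n a] that by (simp add: K_closed act_one)
      have "\<tau> x q \<in> U" using x by (intro submoduleD(3)[OF Q] \<tau>_in)
      then show ?thesis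
        using act[of "scale a 1", OF _ x True] that x True
        by (simp add: K_closed scal f_value linD[OF c])
    qed (simp add: f_def)
    show "f (act z m, i) = mat_act p \<sigma> z (\<lambda>j. f (m, j)) i" if "z \<in> K" "m \<in> U" "i < p" for z m i
    proof -
      obtain x q where x: "\<And>i. x i \<in> K" "q \<in> Q" "m = combination r g x + q" using split[OF \<open>m \<in> U\<close>] by blast
      have "f (act z m, i) = mat_act p \<sigma> z (\<lambda>j. c j (\<tau> x q)) i"
        using that x by (subst act[OF that(1) x that(3)]) (intro c_act \<tau>_in)
      also have "\<dots> = mat_act p \<sigma> z (\<lambda>j. f (m, j)) i"
        using x by (intro mat_act_cong) (simp add: f_value)
      finally show ?thesis .
    qed
  qed
  then show ?thesis using f_value by (rule that)
qed

text \<open>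
Let \<open>W\<close> be maximal in \<open>Q\<close>, and let \<open>L\<close> be the submodule generated by \<open>g\<close>.  If \<open>L \<inter> Q\<close> is not contained in \<open>W\<close>,
nothing has to be changed.  Otherwise the quotient by \<open>W\<close> is the direct sum of \<open>Q/W\<close> and of the image of \<open>L\<close>; in
particular the projection \<open>\<pi>\<close> to \<open>X = Q/W\<close> is a nonzero homomorphism that vanishes on \<open>g\<close>.  As \<open>h(X) \<le> r dim X\<close>, the
evaluation at \<open>g\<close>, from the homomorphisms to \<open>X\<close> into \<open>X\<^sup>r\<close>, is not injective and therefore not surjective.
A tuple outside its image is used to perturb \<open>g\<close>: were all relations between the \<open>g\<close> modulo \<open>W\<close> also relations
between the entries of the tuple, sending \<open>g\<close> to the tuple would define a homomorphism.
\<close>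

lemma generates_modulo_descend:
  assumes Q: "submodule Q" and W: "submodule W" "W \<subset> Q"
    and max: "\<And>V. submodule V \<Longrightarrow> W \<subseteq> V \<Longrightarrow> V \<subset> Q \<Longrightarrow> V = W"
    and gen: "generates_modulo r g Q"
    and bound: "\<And>p \<sigma>. A.representation_of K p \<sigma> \<Longrightarrow> hom_dim K U t act p \<sigma> \<le> r * p"
  shows "\<exists>g'. generates_modulo r g' W"
proof (cases "\<exists>x. (\<forall>i. x i \<in> K) \<and> combination r g x \<in> Q \<and> combination r g x \<notin> W")
  case True
  then show ?thesis using generates_modulo_maximal[OF Q W max gen] by blast
next
  case False
  then have star: "combination r g x \<in> W" if "\<And>i. x i \<in> K" "combination r g x \<in> Q" for x
    using that by blast
  have g: "g i \<in> U" if "i < r" for i using gen that by (simp add: generates_modulo_def)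
  define p where "p = dim Q - dim W"
  have p: "0 < p" using submodule_dim_less[OF Q W] by (simp add: p_def)
  obtain \<sigma> b c where \<sigma>: "A.representation_of K p \<sigma>"
    and b: "\<And>j. j < p \<Longrightarrow> b j \<in> Q" and c: "\<And>j. lin t (*) (c j)"
    and cb: "\<And>i j. i < p \<Longrightarrow> j < p \<Longrightarrow> c i (b j) = (if i = j then 1 else 0)"
    and cW: "\<And>w j. j < p \<Longrightarrow> w \<in> W \<Longrightarrow> c j w = 0"
    and c_act: "\<And>x q i. x \<in> K \<Longrightarrow> q \<in> Q \<Longrightarrow> i < p \<Longrightarrow> c i (act x q) = mat_act p \<sigma> x (\<lambda>j. c j q) i"
    by (rule subquotient_representation[OF Q W(1) psubset_imp_subset[OF W(2)], folded p_def], rule that)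
  let ?H = "homs K U t act p \<sigma>" and ?h = "hom_dim K U t act p \<sigma>"
  have bU: "b j \<in> U" if "j < p" for j using b[OF that] by (rule submoduleD(3)[OF Q])
  have single: "combination r g (\<lambda>l. if l = i then 1 else 0) = g i" if "i < r" for i
    using combination_single[of r g i 1] g that by (simp add: act_one)
  obtain \<pi> where \<pi>: "\<pi> \<in> ?H"
    and \<pi>_val: "\<And>x q i. (\<And>i. x i \<in> K) \<Longrightarrow> q \<in> Q \<Longrightarrow> i < p \<Longrightarrow> \<pi> (combination r g x + q, i) = c i q"
  proof (rule presented_hom[OF Q gen c cW c_act, where \<tau> = "\<lambda>x q. q"])
    show "q \<in> W" if x: "\<And>i. x i \<in> K" and q: "q \<in> Q" and eq: "combination r g x + q = 0" for x q
    proof -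
      have "combination r g x = - q" using eq by (simp add: eq_neg_iff_add_eq_0)
      then have "- q \<in> W" using star[of x] x q submoduleD(7)[OF Q q] by simp
      then show ?thesis using submoduleD(7)[OF W(1), of "- q"] by simp
    qed
  qed auto
  \<comment> \<open>A missing tuple can be taken to be a unit vector \<open>b j0\<close> in position \<open>i0\<close>.  If all unit vectors were values, their preimages together with \<open>\<pi>\<close> would form \<open>r * p + 1\<close> independent homomorphisms.\<close>
  have "\<exists>i0<r. \<exists>j0<p. \<forall>f\<in>?H. \<not> (\<forall>i<r. \<forall>j<p. f (g i, j) = (if i = i0 \<and> j = j0 then 1 else 0))"
  proof (rule ccontr)
    assume contra: "\<not> ?thesis"
    have "\<exists>f\<in>?H. \<forall>i<r. \<forall>j<p. f (g i, j) = (if i = fst ij \<and> j = snd ij then 1 else 0)"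
      if "ij \<in> {..<r} \<times> {..<p}" for ij
      using contra that by (cases ij) auto
    then obtain F where F: "\<And>ij. ij \<in> {..<r} \<times> {..<p} \<Longrightarrow> F ij \<in> ?H"
      and F_val: "\<And>ij i j. ij \<in> {..<r} \<times> {..<p} \<Longrightarrow> i < r \<Longrightarrow> j < p \<Longrightarrow>
        F ij (g i, j) = (if i = fst ij \<and> j = snd ij then 1 else 0)"
      by metis
    define f where "f o' = (case o' of None \<Rightarrow> \<pi> | Some ij \<Rightarrow> F ij)" for o'
    let ?IJ = "{..<r} \<times> {..<p}" and ?I = "insert None (Some ` ({..<r} \<times> {..<p}))"
    have fH: "f o' \<in> ?H" if "o' \<in> ?I" for o' using that F \<pi> by (auto simp: f_def)
    have "card ?I \<le> ?h"
    proof (rule hom_family_card_le[of ?I f])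
      fix e o' assume s: "(\<Sum>o'\<in>?I. function_scale (e o') (f o')) = 0" and o': "o' \<in> ?I"
      let ?s = "\<Sum>o'\<in>?I. function_scale (e o') (f o')"
      have sum_I: "?s z = e None * \<pi> z + (\<Sum>ij\<in>?IJ. e (Some ij) * F ij z)" for z
        by (simp add: sum_fun_apply function_scale_def f_def sum.reindex)
      have eS: "e (Some ij) = 0" if ij: "ij \<in> ?IJ" for ij
      proof -
        have r: "fst ij < r" "snd ij < p" using ij by auto
        have "\<pi> (g (fst ij), snd ij) = 0"
          using \<pi>_val[of "\<lambda>l. if l = fst ij then 1 else 0" 0 "snd ij"] r submoduleD(2)[OF Q]
          by (simp add: single K_closed linD[OF c])
        then have "0 = (\<Sum>ij'\<in>?IJ. e (Some ij') * F ij' (g (fst ij), snd ij))"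
          using sum_I[of "(g (fst ij), snd ij)"] s by simp
        also have "\<dots> = (\<Sum>ij'\<in>?IJ. if ij' = ij then e (Some ij) else 0)"
          using r by (intro sum.cong) (auto simp: F_val prod_eq_iff)
        also have "\<dots> = e (Some ij)" using ij by simp
        finally show ?thesis by simp
      qed
      have "\<pi> (b 0, 0) = 1"
      proof -
        have z: "combination r g (\<lambda>l. 0) = 0" by (simp add: combination_def act_zero_left g)
        show ?thesis using \<pi>_val[of "\<lambda>l. 0" "b 0" 0] p by (simp add: z b K_closed cb)
      qed
      then have "e None = 0" using sum_I[of "(b 0, 0)"] s eS by simp
      then show "e o' = 0" using o' eS by auto
    qed (auto simp: fH)
    moreover have "card ?I = Suc (r * p)" by (simp add: card_image)
    ultimately show False using bound[OF \<sigma>] by simp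
  qed
  then obtain i0 j0 where ij: "i0 < r" "j0 < p"
    and none: "\<And>f. f \<in> ?H \<Longrightarrow> \<not> (\<forall>i<r. \<forall>j<p. f (g i, j) = (if i = i0 \<and> j = j0 then 1 else 0))"
    by blast
  have "\<exists>x. (\<forall>i. x i \<in> K) \<and> combination r g x \<in> W \<and> act (x i0) (b j0) \<notin> W"
  proof (rule ccontr)
    assume "\<not> ?thesis"
    then have rel: "act (x i0) (b j0) \<in> W" if "\<And>i. x i \<in> K" "combination r g x \<in> W" for x using that by blast
    obtain f where f: "f \<in> ?H" and f_val: "\<And>x q i. (\<And>i. x i \<in> K) \<Longrightarrow> q \<in> Q \<Longrightarrow> i < p \<Longrightarrow>
        f (combination r g x + q, i) = c i (act (x i0) (b j0))"
    proof (rule presented_hom[OF Q gen c cW c_act, where \<tau> = "\<lambda>x q. act (x i0) (b j0)"])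
      show "act (x i0) (b j0) \<in> W" if x: "\<And>i. x i \<in> K" and q: "q \<in> Q" and eq: "combination r g x + q = 0" for x q
      proof -
        have "combination r g x = - q" using eq by (simp add: eq_neg_iff_add_eq_0)
        then show ?thesis using star[of x] x submoduleD(7)[OF Q q] by (intro rel) simp_all
      qed
    qed (use ij in \<open>auto simp: act_add_left act_mult bU intro: submoduleD(4)[OF Q] b\<close>)
    have "f (g i, j) = (if i = i0 \<and> j = j0 then 1 else 0)" if "i < r" "j < p" for i j
      using f_val[of "\<lambda>l. if l = i then 1 else 0" 0 j] that ij submoduleD(2)[OF Q]
      by (auto simp: single K_closed act_one act_zero_left bU cb linD[OF c])
    then show False using none[OF f] by blast
  qed
  then obtain x where x: "\<And>i. x i \<in> K" "combination r g x \<in> W" "act (x i0) (b j0) \<notin> W" by blast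
  define g' where "g' i = g i + (if i = i0 then b j0 else 0)" for i
  have g': "g' i \<in> U" if "i < r" for i
    using that g ij bU subspace_0[OF U] by (auto simp: g'_def intro: subspace_add[OF U])
  have comb': "combination r g' y = combination r g y + act (y i0) (b j0)" if y: "\<And>i. y i \<in> K" for y
  proof -
    have "combination r g' y = (\<Sum>i<r. act (y i) (g i) + (if i = i0 then act (y i0) (b j0) else 0))"
      unfolding combination_def
      by (intro sum.cong) (use y g bU ij in \<open>auto simp: g'_def act_add_right act_zero_right\<close>)
    then show ?thesis using ij by (simp add: sum.distrib combination_def)
  qed
  have actQ: "act (y i0) (b j0) \<in> Q" if "\<And>i. y i \<in> K" for y
    using that ij by (intro submoduleD(4)[OF Q] b)
  have gen': "generates_modulo r g' Q"
    unfolding generates_modulo_def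
  proof (intro conjI allI impI ballI g')
    fix m assume "m \<in> U"
    then obtain y where y: "\<forall>i. y i \<in> K" "m - combination r g y \<in> Q"
      using gen by (auto simp: generates_modulo_def)
    have "m - combination r g' y = (m - combination r g y) - act (y i0) (b j0)"
      using y by (simp add: comb')
    also have "\<dots> \<in> Q" using submoduleD(6)[OF Q y(2) actQ[of y]] y(1) by blast
    finally show "\<exists>x. (\<forall>i. x i \<in> K) \<and> m - combination r g' x \<in> Q"
      using y by blast
  qed
  have WQ: "combination r g x \<in> Q" using x(2) W(2) by auto
  have "combination r g' x \<in> Q" "combination r g' x \<notin> W"
    using x WQ actQ[of x] submoduleD(5)[OF Q] submoduleD(6)[OF W(1), of "combination r g' x" "combination r g x"]
    by (auto simp: comb')
  then show ?thesis using generates_modulo_maximal[OF Q W max gen', of x] x(1) by blast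
qed

text \<open>
Starting from \<open>Q = U\<close>, the submodule \<open>Q\<close> is replaced by a maximal proper submodule until it is \<open>0\<close>.
\<close>

theorem generated_by:
  assumes bound: "\<And>p \<sigma>. A.representation_of K p \<sigma> \<Longrightarrow> hom_dim K U t act p \<sigma> \<le> r * p"
  shows "\<exists>g. generates_modulo r g {0}"
proof -
  have "\<exists>g. generates_modulo r g {0}" if "submodule Q" "generates_modulo r g Q" for Q g
    using that
  proof (induction "dim Q" arbitrary: Q g rule: less_induct)
    case less
    show ?case
    proof (cases "Q = {0}")
      case True then show ?thesis using less.prems by blast
    next
      case False
      let ?P = "\<lambda>W. submodule W \<and> W \<subset> Q"
      have P0: "?P {0}" using False submodule_zero submoduleD(2)[OF less.prems(1)] by auto
      have bounded: "\<forall>W. ?P W \<longrightarrow> dim W < dim Q"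
        using submodule_dim_less[OF less.prems(1)] by simp
      obtain W where "?P W \<and> (\<forall>V. ?P V \<longrightarrow> dim V \<le> dim W)"
        using ex_has_greatest_nat[of ?P, OF P0 bounded] by (elim exE)
      then have W: "submodule W" "W \<subset> Q" and greatest: "\<And>V. ?P V \<Longrightarrow> dim V \<le> dim W" by simp_all
      have max: "V = W" if V: "submodule V" "W \<subseteq> V" "V \<subset> Q" for V
      proof (rule ccontr)
        assume "V \<noteq> W"
        then have "dim W < dim V" using submodule_dim_less[of V W] V W by auto
        with greatest[of V] V show False by auto
      qed
      have "\<exists>g'. generates_modulo r g' W"
        by (rule generates_modulo_descend[OF less.prems(1) W max less.prems(2) bound])
      then obtain g' where g': "generates_modulo r g' W" ..
      show ?thesis by (rule less.hyps[OF submodule_dim_less[OF less.prems(1) W] W(1) g'])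
    qed
  qed
  moreover have "generates_modulo r (\<lambda>i. 0) U"
    unfolding generates_modulo_def using subspace_0[OF U]
    by (auto intro!: exI[of _ "\<lambda>i. 0"] subspace_diff[OF U] combination_in K_closed)
  ultimately show ?thesis using submodule_U by blast
qed

text \<open>
A nontrivial relation between the \<open>g i\<close> would make one of the \<open>r * dim K\<close> spanning vectors \<open>e\<^sub>a g\<^sub>i\<close> superfluous.
\<close>

lemma unique_combination:
  assumes gen: "generates_modulo r g {0}" and dim: "r * A.dim K \<le> dim U"
    and fin: "finite B" "K \<subseteq> A.span B"
    and x: "\<And>i. x i \<in> K" "combination r g x = 0" and i: "i < r"
  shows "x i = 0"
proof (rule ccontr)
  assume xi: "x i \<noteq> 0"
  let ?d = "A.dim K"
  have g: "g i \<in> U" if "i < r" for i using gen that by (simp add: generates_modulo_def)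
  obtain e v where e: "\<And>j. j < ?d \<Longrightarrow> e j \<in> K"
    and x_eq: "\<And>x. x \<in> K \<Longrightarrow> x = (\<Sum>j<?d. scale (v j x) (e j))"
    by (rule A.basis_of_subspace[OF K_sub fin], rule that)
  let ?I = "{..<r} \<times> {..<?d}"
  define u where "u ia = act (e (snd ia)) (g (fst ia))" for ia
  have comb: "combination r g y = (\<Sum>ia\<in>?I. t (v (snd ia) (y (fst ia))) (u ia))" if y: "\<And>i. y i \<in> K" for y
  proof -
    have "act (y i) (g i) = (\<Sum>a<?d. t (v a (y i)) (u (i, a)))" if "i < r" for i
    proof -
      have "act (y i) (g i) = act (\<Sum>a<?d. scale (v a (y i)) (e a)) (g i)"
        using x_eq[OF y[of i]] by simp
      also have "\<dots> = (\<Sum>a<?d. act (scale (v a (y i)) (e a)) (g i))"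
        by (rule act_sum_left) (auto intro: g that K_closed e)
      finally show ?thesis using e g that by (simp add: act_scale u_def)
    qed
    then show ?thesis by (simp add: combination_def sum.cartesian_product case_prod_unfold)
  qed
  have "\<exists>a<?d. v a (x i) \<noteq> 0"
  proof (rule ccontr)
    assume "\<not> ?thesis"
    then have "(\<Sum>j<?d. scale (v j (x i)) (e j)) = 0" by (intro sum.neutral) auto
    with x_eq[OF x(1)[of i]] xi show False by simp
  qed
  then obtain a where a: "a < ?d" "v a (x i) \<noteq> 0" by blast
  let ?B = "u ` (?I - {(i, a)})"
  have "(\<Sum>ia\<in>?I. t (v (snd ia) (x (fst ia))) (u ia)) = 0"
    using comb[OF x(1)] x(2) by simp
  then have "t (v a (x i)) (u (i, a)) + (\<Sum>ia\<in>?I - {(i, a)}. t (v (snd ia) (x (fst ia))) (u ia)) = 0"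
    using a i by (subst (asm) sum.remove[of _ "(i, a)"]) auto
  then have "t (v a (x i)) (u (i, a)) = - (\<Sum>ia\<in>?I - {(i, a)}. t (v (snd ia) (x (fst ia))) (u ia))"
    by (simp add: eq_neg_iff_add_eq_0)
  also have "\<dots> \<in> span ?B"
    by (intro span_neg span_sum span_scale span_base) auto
  finally have "t (inverse (v a (x i))) (t (v a (x i)) (u (i, a))) \<in> span ?B"
    by (rule span_scale)
  then have u_in: "u (i, a) \<in> span ?B" using a by simp
  have "U \<subseteq> span ?B"
  proof
    fix m assume "m \<in> U"
    then obtain y where "\<forall>i. y i \<in> K" and m: "m = combination r g y"
      using gen by (auto simp: generates_modulo_def)
    then have y: "y i \<in> K" for i by simp
    have "u ia \<in> span ?B" if "ia \<in> ?I" for ia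
      using that u_in by (cases "ia = (i, a)") (auto intro: span_base)
    then show "m \<in> span ?B"
      unfolding m comb[OF y] by (intro span_sum span_scale)
  qed
  then have "dim U \<le> card ?B" by (rule dim_le_card) auto
  also have "\<dots> \<le> card (?I - {(i, a)})" by (rule card_image_le) auto
  also have "\<dots> < card ?I" using a i by (intro psubset_card_mono) auto
  finally show False using dim by simp
qed

end

section \<open>Powers of a module\<close>

definition power_scale :: "('k \<Rightarrow> 'm \<Rightarrow> 'm) \<Rightarrow> 'k \<Rightarrow> (nat \<Rightarrow> 'm) \<Rightarrow> nat \<Rightarrow> 'm" where
  "power_scale t c f = (\<lambda>i. t c (f i))"

definition power_act :: "nat \<Rightarrow> ('a \<Rightarrow> 'm \<Rightarrow> 'm::zero) \<Rightarrow> 'a \<Rightarrow> (nat \<Rightarrow> 'm) \<Rightarrow> nat \<Rightarrow> 'm" where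
  "power_act d act x f = (\<lambda>i. if i < d then act x (f i) else 0)"

definition power_carrier :: "nat \<Rightarrow> 'm::zero set \<Rightarrow> (nat \<Rightarrow> 'm) set" where
  "power_carrier d U = {f. (\<forall>i<d. f i \<in> U) \<and> (\<forall>i\<ge>d. f i = 0)}"

definition inclusion :: "nat \<Rightarrow> 'm::zero \<Rightarrow> nat \<Rightarrow> 'm" where
  "inclusion i m = (\<lambda>j. if j = i then m else 0)"

context finite_module begin

interpretation A: k_algebra scale by (rule algebra)

lemma power_vector_space: "vector_space (power_scale t)"
  by unfold_locales (auto simp: power_scale_def scale_right_distrib scale_left_distrib)

interpretation power: vector_space "power_scale t" by (rule power_vector_space)

lemma power_subspace: "power.subspace (power_carrier d U)"
  using U by (auto simp: power.subspace_def power_carrier_def power_scale_def subspace_0 subspace_add subspace_scale)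

lemma inclusion_in: "i < d \<Longrightarrow> m \<in> U \<Longrightarrow> inclusion i m \<in> power_carrier d U"
  using subspace_0[OF U] by (auto simp: inclusion_def power_carrier_def)

lemma inclusion_sum: "f \<in> power_carrier d U \<Longrightarrow> f = (\<Sum>i<d. inclusion i (f i))"
  by (auto simp: fun_eq_iff sum_fun_apply inclusion_def power_carrier_def not_less)

lemma inclusion_lin: "lin t (power_scale t) (inclusion i)"
  by (auto simp: lin_def inclusion_def power_scale_def fun_eq_iff)

lemma power_module: "finite_module (power_scale t) scale K P (power_act d act) (power_carrier d U)"
proof -
  obtain F where F: "finite F" "U \<subseteq> span F" using finite_dim by blast
  let ?G = "\<Union>i<d. inclusion i ` F"
  have "power_carrier d U \<subseteq> power.span ?G"
  proof
    fix f assume f: "f \<in> power_carrier d U"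
    have "inclusion i (f i) \<in> power.span ?G" if i: "i < d" for i
    proof -
      have "f i \<in> span F" using f F(2) i by (auto simp: power_carrier_def)
      then obtain T u where T: "finite T" "T \<subseteq> F" "f i = (\<Sum>b\<in>T. t (u b) b)"
        by (auto simp: span_explicit)
      then have "inclusion i (f i) = (\<Sum>b\<in>T. power_scale t (u b) (inclusion i b))"
        by (simp add: lin_sum[OF inclusion_lin] linD(2)[OF inclusion_lin])
      also have "\<dots> \<in> power.span ?G"
        using T i by (intro power.span_sum power.span_scale power.span_base) auto
      finally show ?thesis .
    qed
    then have "(\<Sum>i<d. inclusion i (f i)) \<in> power.span ?G" by (intro power.span_sum) auto
    then show "f \<in> power.span ?G" using inclusion_sum[OF f] by simp
  qed
  moreover have "finite ?G" using F(1) by auto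
  ultimately have fin: "\<exists>G. finite G \<and> power_carrier d U \<subseteq> power.span G" by blast
  show ?thesis
    by (intro finite_module.intro power_vector_space finite_module_axioms.intro algebra subalg P_lin P_in P_id power_subspace fin)
      (auto simp: power_act_def power_carrier_def power_scale_def fun_eq_iff act_in act_add_left
        act_add_right act_mult act_scale act_one)
qed

lemma power_dim: "d * dim U \<le> power.dim (power_carrier d U)"
proof -
  obtain F where F: "finite F" "U \<subseteq> span F" using finite_dim by blast
  obtain e v where e: "\<And>j. j < dim U \<Longrightarrow> e j \<in> U" and v: "\<And>j. lin t (*) (v j)"
    and ve: "\<And>i j. i < dim U \<Longrightarrow> j < dim U \<Longrightarrow> v i (e j) = (if i = j then 1 else 0)"
    by (rule basis_of_subspace[OF U F], rule that)
  interpret power_mod: finite_module "power_scale t" scale K P "power_act d act" "power_carrier d U"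
    by (rule power_module)
  obtain G where G: "finite G" "power_carrier d U \<subseteq> power.span G" using power_mod.finite_dim by blast
  let ?I = "{..<d} \<times> {..<dim U}"
  have "card ?I \<le> power.dim (power_carrier d U)"
  proof (rule power.independent_family_card_le[OF power_subspace G, of ?I "\<lambda>ia. inclusion (fst ia) (e (snd ia))"])
    fix c ia assume s: "(\<Sum>ia\<in>?I. power_scale t (c ia) (inclusion (fst ia) (e (snd ia)))) = 0" and ia: "ia \<in> ?I"
    have "0 = (\<Sum>ia\<in>?I. power_scale t (c ia) (inclusion (fst ia) (e (snd ia)))) (fst ia)"
      by (simp add: s)
    also have "\<dots> = (\<Sum>(i, a)\<in>?I. t (c (i, a)) (if fst ia = i then e a else 0))"
      by (simp add: sum_fun_apply power_scale_def inclusion_def case_prod_unfold)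
    also have "\<dots> = (\<Sum>i<d. if i = fst ia then \<Sum>a<dim U. t (c (i, a)) (e a) else 0)"
      unfolding sum.cartesian_product[symmetric] by (intro sum.cong) auto
    also have "\<dots> = (\<Sum>a<dim U. t (c (fst ia, a)) (e a))" using ia by auto
    finally have "0 = v (snd ia) (\<Sum>a<dim U. t (c (fst ia, a)) (e a))"
      by (simp add: linD(3)[OF v, symmetric])
    also have "\<dots> = (\<Sum>a<dim U. c (fst ia, a) * v (snd ia) (e a))" by (rule lin_sum_scaled[OF v])
    also have "\<dots> = (\<Sum>a<dim U. if a = snd ia then c ia else 0)"
      using ia by (intro sum.cong) (auto simp: ve)
    also have "\<dots> = c ia" using ia by auto
    finally show "c ia = 0" by simp
  qed (auto intro!: inclusion_in e)
  then show ?thesis by simp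
qed

text \<open>
A homomorphism on a power is determined by its restrictions to the summands.
\<close>

lemma power_hom_dim:
  "hom_dim K (power_carrier d U) (power_scale t) (power_act d act) p \<sigma> \<le> d * hom_dim K U t act p \<sigma>"
proof -
  let ?H = "homs K U t act p \<sigma>" and ?h = "hom_dim K U t act p \<sigma>"
  let ?H' = "homs K (power_carrier d U) (power_scale t) (power_act d act) p \<sigma>"
  obtain F where F: "finite F" "U \<subseteq> span F" using finite_dim by blast
  obtain w b where w: "\<And>a. lin function_scale (*) (w a)"
    and f_eq: "\<And>f. f \<in> ?H \<Longrightarrow> f = (\<Sum>a<?h. function_scale (w a f) (b a))"
    by (rule homs_basis[OF U F, where K = K and act = act and p = p and \<sigma> = \<sigma>], rule that)
  define res where "res i f = (\<lambda>(m, j). if m \<in> U then f (inclusion i m, j) else 0)"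
    for i and f :: "(nat \<Rightarrow> 'm) \<times> nat \<Rightarrow> 'k"
  have res: "res i f \<in> ?H" if f: "f \<in> ?H'" and i: "i < d" for i f
  proof -
    have add: "inclusion i (m + m') = inclusion i m + inclusion i m'" for m m' :: 'm
      using inclusion_lin[of i] by (simp add: lin_def)
    have scal: "inclusion i (t c m) = power_scale t c (inclusion i m)" for c m
      using inclusion_lin[of i] by (simp add: lin_def)
    have act: "inclusion i (act x m) = power_act d act x (inclusion i m)" if "x \<in> K" for x m
      using that i by (auto simp: inclusion_def power_act_def fun_eq_iff act_zero_right)
    show ?thesis
      using f i inclusion_in[OF i]
      by (auto simp: homs_def res_def add scal act subspace_add[OF U] subspace_scale[OF U] act_in)
  qed
  show ?thesis
  proof (rule function_space.finite_dimensional_of_separating_forms[OF homs_subspace[of K "power_carrier d U" "power_scale t" "power_act d act" p \<sigma>],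
        of "{..<d} \<times> {..<?h}" "\<lambda>ia f. w (snd ia) (res (fst ia) f)"])
    show "lin function_scale (*) (\<lambda>f. w (snd ia) (res (fst ia) f))" for ia
    proof -
      have "lin function_scale function_scale (res i)" for i
        by (auto simp: lin_def res_def function_scale_def fun_eq_iff)
      from lin_compose[OF w this] show ?thesis .
    qed
    show "f = 0" if f: "f \<in> ?H'" and z: "\<And>ia. ia \<in> {..<d} \<times> {..<?h} \<Longrightarrow> w (snd ia) (res (fst ia) f) = 0" for f
    proof
      fix gj :: "(nat \<Rightarrow> 'm) \<times> nat" obtain g j where gj: "gj = (g, j)" by fastforce
      have r0: "res i f = 0" if i: "i < d" for i
      proof -
        have "(\<Sum>a<?h. function_scale (w a (res i f)) (b a)) = 0"
          using z[of "(i, _)"] i by (intro sum.neutral) auto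
        with f_eq[OF res[OF f i]] show ?thesis by simp
      qed
      show "f gj = 0 gj"
      proof (cases "g \<in> power_carrier d U")
        case True
        have "f (g, j) = f (\<Sum>i<d. power_scale t 1 (inclusion i (g i)), j)"
          using inclusion_sum[OF True] by simp
        also have "\<dots> = (\<Sum>i<d. 1 * f (inclusion i (g i), j))"
        proof (rule power.hom_sum[OF f power_subspace])
          fix i assume "i \<in> {..<d}"
          moreover from this have "g i \<in> U" using True by (simp add: power_carrier_def)
          ultimately show "inclusion i (g i) \<in> power_carrier d U" by (simp add: inclusion_in)
        qed
        also have "\<dots> = 0"
        proof (intro sum.neutral ballI)
          fix i assume i: "i \<in> {..<d}"
          then have "res i f (g i, j) = 0" using r0[of i] by simp
          then show "1 * f (inclusion i (g i), j) = 0"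
            using i True by (simp add: res_def power_carrier_def)
        qed
        finally show ?thesis by (simp add: gj)
      next
        case False
        then show ?thesis using f by (simp add: homs_def gj)
      qed
    qed
  next
    assume "function_space.dim ?H' \<le> card ({..<d} \<times> {..<?h})"
    then show ?thesis by (simp add: hom_dim_def)
  qed auto
qed

text \<open>
On a free module the coordinate functions, composed with the character \<open>\<sigma>\<close>, are independent homomorphisms
to the one-dimensional module given by \<open>\<sigma>\<close>.
\<close>

lemma free_rank_le_hom_dim:
  assumes gen: "generates_modulo r g {0}"
    and unique: "\<And>x i. (\<And>i. x i \<in> K) \<Longrightarrow> combination r g x = 0 \<Longrightarrow> i < r \<Longrightarrow> x i = 0"
    and \<sigma>: "A.representation_of K 1 \<sigma>"
  shows "r \<le> hom_dim K U t act 1 \<sigma>"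
proof -
  have g: "g i \<in> U" if "i < r" for i using gen that by (simp add: generates_modulo_def)
  have \<sigma>_lin: "lin scale (*) (\<lambda>x. \<sigma> x 0 0)" and \<sigma>_one: "\<sigma> 1 0 0 = 1"
    and \<sigma>_mult: "\<And>x y. x \<in> K \<Longrightarrow> y \<in> K \<Longrightarrow> \<sigma> (x * y) 0 0 = \<sigma> x 0 0 * \<sigma> y 0 0"
    using \<sigma> by (auto simp: A.representation_of_def)
  define X where "X m = (SOME x. (\<forall>i. x i \<in> K) \<and> m - combination r g x \<in> {0})" for m
  have X: "(\<forall>i. X m i \<in> K) \<and> m = combination r g (X m)" if "m \<in> U" for m
  proof -
    have "\<exists>x. (\<forall>i. x i \<in> K) \<and> m - combination r g x \<in> {0}"
      using gen that by (simp add: generates_modulo_def)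
    from someI_ex[OF this] show ?thesis by (simp add: X_def)
  qed
  have X_eq: "X (combination r g x) i = x i" if x: "\<And>i. x i \<in> K" and i: "i < r" for x i
  proof -
    have m: "combination r g x \<in> U" using x g by (intro combination_in) auto
    have "combination r g (\<lambda>i. X (combination r g x) i - x i) = 0"
      using X[OF m] x g by (simp add: combination_diff)
    then have "X (combination r g x) i - x i = 0"
      using X[OF m] x i by (intro unique[of "\<lambda>i. X (combination r g x) i - x i"]) (auto intro: K_closed)
    then show ?thesis by simp
  qed
  define f where "f j = (\<lambda>(m, i :: nat). if m \<in> U \<and> i = 0 then \<sigma> (X m j) 0 0 else 0)" for j
  have f: "f j \<in> homs K U t act 1 \<sigma>" if j: "j < r" for j
  proof -
    have "X (m + m') j = X m j + X m' j" if "m \<in> U" "m' \<in> U" for m m'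
      using X_eq[of "\<lambda>i. X m i + X m' i" j] X[of m] X[of m'] that j g by (simp add: combination_add K_closed)
    moreover have "X (t c m) j = scale c (X m j)" if "m \<in> U" for c m
      using X_eq[of "\<lambda>i. scale c (X m i)" j] X[of m] that j g by (simp add: combination_scale K_closed)
    moreover have "X (act z m) j = z * X m j" if "m \<in> U" "z \<in> K" for z m
      using X_eq[of "\<lambda>i. z * X m i" j] X[of m] that j g by (simp add: combination_act K_closed)
    ultimately show ?thesis
      using X by (auto simp: homs_def f_def mat_act_def linD[OF \<sigma>_lin] \<sigma>_mult act_in
          subspace_add[OF U] subspace_scale[OF U])
  qed
  have "card {..<r} \<le> hom_dim K U t act 1 \<sigma>"
  proof (rule hom_family_card_le[of "{..<r}" f])
    fix c i assume s: "(\<Sum>j<r. function_scale (c j) (f j)) = 0" and i: "i \<in> {..<r}"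
    have "0 = (\<Sum>j<r. function_scale (c j) (f j)) (g i, 0)" by (simp add: s)
    also have "\<dots> = (\<Sum>j<r. c j * \<sigma> (X (g i) j) 0 0)"
      using g i by (simp add: sum_fun_apply function_scale_def f_def)
    also have "\<dots> = (\<Sum>j<r. if j = i then c i else 0)"
    proof (intro sum.cong refl)
      fix j assume "j \<in> {..<r}"
      then have "X (g i) j = (if j = i then 1 else 0)"
        using X_eq[of "\<lambda>l. if l = i then 1 else 0" j] combination_single[of r g i 1] g i
        by (simp add: K_closed act_one)
      then show "c j * \<sigma> (X (g i) j) 0 0 = (if j = i then c i else 0)"
        by (simp add: \<sigma>_one linD[OF \<sigma>_lin])
    qed
    also have "\<dots> = c i" using i by simp
    finally show "c i = 0" by simp
  qed (use f in auto)
  then show ?thesis by simp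
qed

text \<open>
The character \<open>\<sigma>\<close> is used to show that \<open>dim U\<close> is a multiple of \<open>dim K\<close>: the power of \<open>U\<close> with exponent
\<open>dim K\<close> is free of rank \<open>dim U\<close>.
\<close>

theorem freeness_criterion:
  assumes fin: "finite B" "K \<subseteq> A.span B"
    and \<sigma>: "A.representation_of K 1 \<sigma>"
    and bound: "\<And>p \<sigma>. A.representation_of K p \<sigma> \<Longrightarrow> A.dim K * hom_dim K U t act p \<sigma> \<le> dim U * p"
  obtains r g where "generates_modulo r g {0}"
    "\<And>x i. (\<And>i. x i \<in> K) \<Longrightarrow> combination r g x = 0 \<Longrightarrow> i < r \<Longrightarrow> x i = 0"
proof -
  let ?d = "A.dim K" and ?h = "hom_dim K U t act 1 \<sigma>"
  interpret power_mod: finite_module "power_scale t" scale K P "power_act ?d act" "power_carrier ?d U"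
    by (rule power_module)
  have "hom_dim K (power_carrier ?d U) (power_scale t) (power_act ?d act) p \<sigma> \<le> dim U * p"
    if "A.representation_of K p \<sigma>" for p \<sigma>
    using power_hom_dim[of ?d p \<sigma>] bound[OF that] by linarith
  then obtain g' where g': "power_mod.generates_modulo (dim U) g' {0}"
    using power_mod.generated_by by blast
  have "dim U \<le> hom_dim K (power_carrier ?d U) (power_scale t) (power_act ?d act) 1 \<sigma>"
    by (rule power_mod.free_rank_le_hom_dim[OF g' _ \<sigma>], rule power_mod.unique_combination[OF g' _ fin])
      (simp_all add: mult.commute power_dim)
  then have "dim U \<le> ?d * ?h" using power_hom_dim[of ?d 1 \<sigma>] by linarith
  moreover have "?d * ?h \<le> dim U" using bound[OF \<sigma>] by simp
  ultimately have dim_eq: "dim U = ?d * ?h" by simp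
  have d: "0 < ?d"
  proof (rule ccontr)
    assume "\<not> 0 < ?d"
    obtain e v where "\<And>x. x \<in> K \<Longrightarrow> x = (\<Sum>j<?d. scale (v j x) (e j))"
      by (rule A.basis_of_subspace[OF K_sub fin], rule that)
    from this[OF K_one] \<open>\<not> 0 < ?d\<close> show False by simp
  qed
  have "hom_dim K U t act p \<sigma> \<le> ?h * p" if "A.representation_of K p \<sigma>" for p \<sigma>
    using bound[OF that] d by (simp add: dim_eq)
  then obtain g where g: "generates_modulo ?h g {0}"
    using generated_by by blast
  show ?thesis
    by (rule that[OF g], rule unique_combination[OF g _ fin]) (simp_all add: dim_eq mult.commute)
qed

end

section \<open>Freeness of Hopf modules\<close>

lemma (in vector_space) projection_exists:
  assumes "subspace W" "finite B" "W \<subseteq> span B"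
  obtains P where "lin scale scale P" "\<And>x. P x \<in> W" "\<And>x. x \<in> W \<Longrightarrow> P x = x"
proof -
  obtain e v where e: "\<And>j. j < dim W \<Longrightarrow> e j \<in> W" and v: "\<And>j. lin scale (*) (v j)"
    and x: "\<And>x. x \<in> W \<Longrightarrow> x = (\<Sum>j<dim W. scale (v j x) (e j))"
    by (rule basis_of_subspace[OF assms], rule that)
  show ?thesis
  proof
    show "lin scale scale (\<lambda>x. \<Sum>j<dim W. scale (v j x) (e j))"
      by (simp add: lin_def linD[OF v] scale_left_distrib sum.distrib scale_sum_right)
    show "(\<Sum>j<dim W. scale (v j x) (e j)) \<in> W" for x
      by (intro subspace_sum[OF assms(1)] subspace_scale[OF assms(1)]) (simp add: e)
    show "(\<Sum>j<dim W. scale (v j x) (e j)) = x" if "x \<in> W" for x using x[OF that] by simp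
  qed
qed

text \<open>
Stated for an arbitrary action, so that it applies to the left and to the right action of \<open>K\<close> on \<open>M\<close>.
\<close>

lemma finite_spanning_set:
  assumes S: "vector_space scale" and T: "vector_space t"
    and K: "module.subspace scale K" and fin: "finite B" "K \<subseteq> module.span scale B"
    and act: "\<And>m. lin scale t (\<lambda>x. act (P x) m)" and P: "\<And>x. x \<in> K \<Longrightarrow> P x = x"
    and gen: "finitely_generated_module K act"
  obtains G where "finite G" "module.span t G = UNIV"
proof -
  interpret S: vector_space scale by (rule S)
  interpret T: vector_space t by (rule T)
  obtain e v where e: "\<And>j. j < S.dim K \<Longrightarrow> e j \<in> K"
    and x_eq: "\<And>x. x \<in> K \<Longrightarrow> x = (\<Sum>j<S.dim K. scale (v j x) (e j))"
    by (rule S.basis_of_subspace[OF K fin], rule that)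
  obtain C where C: "finite C" "\<And>m. \<exists>c. c ` C \<subseteq> K \<and> m = (\<Sum>b\<in>C. act (c b) b)"
    using gen by (auto simp: finitely_generated_module_def)
  let ?G = "(\<lambda>(j, b). act (P (e j)) b) ` ({..<S.dim K} \<times> C)"
  have "m \<in> T.span ?G" for m
  proof -
    obtain c where c: "c ` C \<subseteq> K" "m = (\<Sum>b\<in>C. act (c b) b)" using C(2) by blast
    have "act (c b) b \<in> T.span ?G" if b: "b \<in> C" for b
    proof -
      have cb: "c b \<in> K" using c(1) b by auto
      have "act (c b) b = act (P (\<Sum>j<S.dim K. scale (v j (c b)) (e j))) b"
        using x_eq[OF cb] P[OF cb] by simp
      also have "\<dots> = (\<Sum>j<S.dim K. t (v j (c b)) (act (P (e j)) b))"
        by (simp add: lin_sum[OF act] linD(2)[OF act])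
      also have "\<dots> \<in> T.span ?G"
        using b by (intro T.span_sum T.span_scale T.span_base) auto
      finally show ?thesis .
    qed
    then show ?thesis unfolding c(2) by (rule T.span_sum)
  qed
  then show ?thesis using C(1) by (intro that[of ?G]) auto
qed

lemma (in finite_module) free_module_of_combinations:
  assumes carrier: "U = UNIV" and gen: "generates_modulo r g {0}"
    and unique: "\<And>x i. (\<And>i. x i \<in> K) \<Longrightarrow> combination r g x = 0 \<Longrightarrow> i < r \<Longrightarrow> x i = 0"
  shows "free_module K act"
proof -
  interpret A: k_algebra scale by (rule algebra)
  have g: "g i \<in> U" if "i < r" for i by (simp add: carrier)
  have inj: "inj_on g {..<r}"
  proof (rule inj_onI, rule ccontr)
    fix i j assume ij: "i \<in> {..<r}" "j \<in> {..<r}" "g i = g j" "i \<noteq> j"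
    let ?x = "\<lambda>l. (if l = i then 1 else 0 :: 'a) - (if l = j then 1 else 0)"
    have "combination r g ?x = 0"
      using combination_diff[of r g "\<lambda>l. if l = i then 1 else 0" "\<lambda>l. if l = j then 1 else 0"]
        combination_single[of r g i 1] combination_single[of r g j 1] ij
      by (simp add: carrier K_closed act_one)
    then have "?x i = 0" using ij unique[of ?x i] by (simp add: K_closed)
    then show False using ij by simp
  qed
  let ?B = "g ` {..<r}"
  show ?thesis
    unfolding free_module_def
  proof (rule exI[of _ ?B], intro conjI allI impI)
    fix m
    have "m \<in> U" by (simp add: carrier)
    then obtain x where x: "\<forall>i. x i \<in> K" "m = combination r g x"
      using gen by (auto simp: generates_modulo_def)
    let ?c = "\<lambda>b. x (the_inv_into {..<r} g b)"
    have "m = (\<Sum>b\<in>?B. act (?c b) b)"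
      using x by (simp add: combination_def sum.reindex[OF inj] the_inv_into_f_f[OF inj])
    then show "\<exists>F c. finite F \<and> F \<subseteq> ?B \<and> c ` F \<subseteq> K \<and> m = (\<Sum>b\<in>F. act (c b) b)"
      using x by (intro exI[of _ ?B] exI[of _ ?c]) auto
  next
    fix F c assume F: "finite F" "F \<subseteq> ?B" "c ` F \<subseteq> K" "(\<Sum>b\<in>F. act (c b) b) = 0"
    define x where "x i = (if g i \<in> F then c (g i) else 0)" for i
    have x: "x i \<in> K" for i using F(3) by (auto simp: x_def K_closed)
    have "combination r g x = (\<Sum>b\<in>?B. if b \<in> F then act (c b) b else 0)"
      unfolding combination_def sum.reindex[OF inj]
      by (intro sum.cong) (auto simp: x_def act_zero_left carrier)
    also have "\<dots> = (\<Sum>b\<in>F. act (c b) b)"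
      using F(2) by (simp add: sum.inter_restrict[symmetric] Int_absorb1)
    finally have comb: "combination r g x = 0" using F(4) by simp
    show "\<forall>b\<in>F. c b = 0"
    proof
      fix b assume b: "b \<in> F"
      then obtain i where i: "i < r" "b = g i" using F(2) by auto
      then show "c b = 0" using unique[OF x comb i(1)] b by (simp add: x_def)
    qed
  qed
qed

theorem theorem3p5:
  fixes scale :: "'k::field \<Rightarrow> 'h::ring_1 \<Rightarrow> 'h"
    and \<Delta> :: "'h \<Rightarrow> ('h \<times> 'h) list"
    and \<epsilon> :: "'h \<Rightarrow> 'k"
    and \<phi> :: "('h \<times> 'h \<times> 'h) list"
    and K :: "'h set"
    and scaleM :: "'k \<Rightarrow> 'm::ab_group_add \<Rightarrow> 'm"
    and lact :: "'h \<Rightarrow> 'm \<Rightarrow> 'm"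
    and ract :: "'m \<Rightarrow> 'h \<Rightarrow> 'm"
    and \<delta> :: "'m \<Rightarrow> ('m \<times> 'h) list"
  assumes "quasi_hopf_algebra scale UNIV \<Delta> \<epsilon> \<phi>"
    and "\<exists>Basis. finite_dimensional_vector_space scale Basis"
    and "quasi_hopf_subalgebra scale \<Delta> \<epsilon> \<phi> K"
    and "hopf_module scale \<Delta> \<epsilon> \<phi> K scaleM lact ract \<delta>"
    and "finitely_generated_module K lact \<or> finitely_generated_module K (\<lambda>x m. ract m x)"
  shows "free_module K lact"
proof -
  obtain S \<alpha> \<beta> where H: "quasiantipode scale UNIV \<Delta> \<epsilon> \<phi> S \<alpha> \<beta>"
    using assms(1) by (auto simp: quasi_hopf_algebra_def)
  interpret H: quasiantipode scale UNIV \<Delta> \<epsilon> \<phi> S \<alpha> \<beta> by (rule H)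
  interpret M: hopf_module scale \<Delta> \<epsilon> \<phi> K scaleM lact ract \<delta> by (rule assms(4))
  obtain BH where "finite_dimensional_vector_space scale BH" using assms(2) by blast
  then interpret fd: finite_dimensional_vector_space scale BH .
  have BH: "finite BH" "H.span BH = UNIV" by (fact fd.finite_Basis, fact fd.span_Basis)
  obtain \<Delta>' \<phi>' where K: "unital_subalgebra scale K"
    and \<Delta>': "\<And>x. x \<in> K \<Longrightarrow> tensor2_eq scale UNIV scale UNIV (\<Delta>' x) (\<Delta> x)"
    and \<phi>': "tensor3_eq scale UNIV scale UNIV scale UNIV \<phi>' \<phi>"
    and "quasi_hopf_algebra scale K \<Delta>' \<epsilon> \<phi>'"
    using assms(3) by (auto simp: quasi_hopf_subalgebra_def)
  then obtain S' \<alpha>' \<beta>' where K': "quasiantipode scale K \<Delta>' \<epsilon> \<phi>' S' \<alpha>' \<beta>'"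
    by (auto simp: quasi_hopf_algebra_def)
  interpret K': quasiantipode scale K \<Delta>' \<epsilon> \<phi>' S' \<alpha>' \<beta>' by (rule K')
  have alg: "k_algebra scale" by unfold_locales
  have subK: "H.subspace K" using K by (simp add: unital_subalgebra_def)
  have K_span: "K \<subseteq> H.span BH" using BH by simp
  obtain P where P_lin: "lin scale scale P" and P_in: "\<And>x. P x \<in> K" and P_id: "\<And>x. x \<in> K \<Longrightarrow> P x = x"
    by (rule H.projection_exists[OF subK BH(1) K_span], rule that)
  obtain \<psi> where \<psi>: "tensor3_inverse scale K \<phi>' \<psi>" using K'.associator_invertible by blast
  interpret PK: projected_quasibialgebra scale K \<Delta>' \<epsilon> \<phi>' P \<psi>
    by unfold_locales (fact P_lin P_in P_id \<psi>)+
  note lact_lin = M.actions_lin(3)[OF K alg P_in] and ract_lin = M.actions_lin(4)[OF K alg P_in]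
  have act_lin: "lin scale scaleM (\<lambda>x. lact (P x) m)" "lin scale scaleM (\<lambda>x. ract m (P x))" for m
    using M.lact_add_left[OF P_in P_in] M.ract_add_right[OF P_in P_in] lact_lin ract_lin
    by (simp_all add: lin_def linD[OF P_lin])
  obtain BM where BM: "finite BM" "M.span BM = UNIV"
    using assms(5)
  proof
    assume gen: "finitely_generated_module K lact"
    show thesis
      by (rule finite_spanning_set[OF H.vector_space_axioms M.vector_space_axioms subK BH(1) K_span act_lin(1) P_id gen])
        (assumption, rule that)
  next
    assume gen: "finitely_generated_module K (\<lambda>x m. ract m x)"
    show thesis
      by (rule finite_spanning_set[OF H.vector_space_axioms M.vector_space_axioms subK BH(1) K_span act_lin(2) P_id gen])
        (assumption, rule that)
  qed
  interpret mod: finite_module scaleM scale K P lact UNIV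
  proof (intro finite_module.intro finite_module_axioms.intro M.vector_space_axioms alg K P_lin P_in P_id)
    show "\<exists>F. finite F \<and> UNIV \<subseteq> M.span F" using BM by (intro exI[of _ BM]) simp
  qed (simp_all add: M.subspace_UNIV M.lact_add_left M.lact_add_right M.lact_mult M.lact_one M.actions_lin(3)[OF K alg])
  let ?R = "{(p, \<sigma>). H.representation_of K p \<sigma>}"
  let ?h = "\<lambda>(p, \<sigma>). hom_dim K UNIV scaleM lact p \<sigma>"
  have bound: "H.dim K * hom_dim K UNIV scaleM lact p \<sigma> \<le> M.dim UNIV * p"
    if "H.representation_of K p \<sigma>" for p \<sigma>
  proof -
    have "H.dim K * ?h (p, \<sigma>) \<le> M.dim UNIV * fst (p, \<sigma>)"
    proof (rule ratio_bound[where R = ?R and n = "H.dim UNIV"])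
      show "?h r \<le> M.dim UNIV * fst r" if "r \<in> ?R" for r
      proof -
        obtain p \<sigma> where r: "r = (p, \<sigma>)" by fastforce
        have "UNIV \<subseteq> M.span BM" using BM by simp
        then show ?thesis unfolding r
          by (rule M.homs_finite_dimensional[OF M.subspace_UNIV BM(1), where K = K and act = lact and p = p and \<sigma> = \<sigma>]) simp
      qed
      show "\<exists>r'\<in>?R. fst r' = fst r * (H.dim UNIV - H.dim K) \<and> H.dim UNIV * ?h r \<le> M.dim UNIV * fst r + ?h r'"
        if r: "r \<in> ?R" for r
      proof -
        obtain p \<sigma> where p: "r = (p, \<sigma>)" "H.representation_of K p \<sigma>" using r by auto
        obtain \<sigma>' where "H.representation_of K (p * (H.dim UNIV - H.dim K)) \<sigma>'"
          "H.dim (UNIV :: 'h set) * hom_dim K UNIV scaleM lact p \<sigma> \<le>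
            M.dim UNIV * p + hom_dim K UNIV scaleM lact (p * (H.dim UNIV - H.dim K)) \<sigma>'"
          using PK.hom_dim_inequality[OF H \<Delta>' \<phi>' K' assms(4) BH BM p(2)] by blast
        then show ?thesis by (intro bexI[of _ "(p * (H.dim UNIV - H.dim K), \<sigma>')"]) (auto simp: p)
      qed
      show "H.dim K \<le> H.dim UNIV" by (rule fd.dim_subset[OF subset_UNIV])
    qed (use that in auto)
    then show ?thesis by simp
  qed
  have counit: "H.representation_of K 1 (\<lambda>x _ _. \<epsilon> x)"
    by (simp add: H.representation_of_def lin_def H.counit_add H.counit_scale H.counit_one H.counit_mult)
  show ?thesis
  proof (rule mod.freeness_criterion[OF BH(1) K_span counit bound])
    fix r g
    assume "mod.generates_modulo r g {0}"
      and "\<And>x i. (\<And>i. x i \<in> K) \<Longrightarrow> mod.combination r g x = 0 \<Longrightarrow> i < r \<Longrightarrow> x i = 0"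
    then show ?thesis by (rule mod.free_module_of_combinations[OF refl])
  qed
qed

end
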